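(* Let $K$ be a totally imaginary number field, $E$ a number field, and $M$ a Betti--de Rham system of realizations over $K$ with coefficients in $E$ with vanishing middle Hodge number. Let $n=\dim_E(M_\sigma)$ for any embedding $\sigma:K\to\mathbb{C}$. Then, in $(\mathbb{C}\otimes E)^*/E^*$, $$c^+_E(M)/c^-_E(M)=\delta(K)^n.$$
   Context: Systems over a number field. A weight-$w$ Betti--de Rham system $M$ over a number field $K$ with coefficients in $E$ consists of: - for each embedding $\sigma:K\to\mathbb{C}$, a finite-dimensional $E$-vector space $M_\sigma$; - involutive $E$-linear isomorphisms $\mathsf{F}_\infty:M_\sigma\to M_{c\sigma}$ ($c$ = complex conjugation); - a $K\otimes E$-module $M_{\mathrm{dR}}$ with a finite decreasing filtration $\mathcal{F}$; - $E\otimes\mathbb{C}$-linear comparison isomorphisms $M_\sigma\otimes_{\mathbb{Q}}\mathbb{C}\to M_{\mathrm{dR}}\otimes_{K,\sigma}\mathbb{C}$, compatible with complex conjugation via $\mathsf{F}_\infty$, such that each $M_\sigma\otimes\mathbb{C}=\bigoplus_{p+q=w}M^{p,q}_\sigma$ with $M^{p,q}_\sigma=\mathcal{F}^p\cap\overline{\mathcal{F}}^q$. Vanishing middle Hodge number means: $w$ is odd, or $w=2k$ and $M^{k,k}_\sigma=0$ for all $\sigma$. Restriction of scalars and periods. The restriction of scalars ${}_0M=\mathrm{Res}_{K/\mathbb{Q}}(M)$ is the weight-$w$ system over $\mathbb{Q}$ with coefficients in $E$ given by: - ${}_0M_{\mathrm B}=\bigoplus_{\sigma}M_\sigma$, with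 the involution $\mathsf{F}_\infty$ and eigenspaces ${}_0M^\pm$; - ${}_0M_{\mathrm{dR}}=M_{\mathrm{dR}}$ viewed as an $E$-vector space, with the same filtration; - comparison isomorphism the sum of the comparison isomorphisms, using $M_{\mathrm{dR}}\otimes_{\mathbb{Q}}\mathbb{C}=\bigoplus_\sigma M_{\mathrm{dR}}\otimes_{K,\sigma}\mathbb{C}$. By definition $c^\pm_E(M)=c^\pm_E({}_0M)$. These are the determinants, computed in $E$-bases, of the $E\otimes\mathbb{C}$-linear isomorphisms ${}_0M^\pm\otimes\mathbb{C}\to({}_0M_{\mathrm{dR}}/\mathcal{F}^{\lfloor w/2\rfloor+1})\otimes\mathbb{C}$ induced by the comparison isomorphism, well defined in $(E\otimes\mathbb{C})^*/E^*$. The invariant $\delta(K)$. If $K_1$ is a CM field with maximal totally real subfield $K_1^+$, write $K_1=K_1^+(\sqrt{D})$ with $D$ totally negative; then $\delta(K_1)$ is the class of a complex square root of $N_{K_1^+/\mathbb{Q}}(D)$ in $\mathbb{C}^*/\mathbb{Q}^*$. For general $K$, let $K_1$ be the largest CM or totally real subfield of $K$. Set $\delta(K)=1$ if $K_1$ is totally real, and $\delta(K)=\delta(K_1)^{[K:K_1]}$ if $K_1$ is CM. It is viewed in $(\mathbb{C}\otimes E)^*/E^*$ via the injection $\mathbb{C}^*/\mathbb{Q}^*\hookrightarrow(\mathbb{C}\otimes E)^*/E^*$. *)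

theory Defs
  imports
    Complex_Main
    "HOL-Library.Multiset"
    "HOL-Library.FuncSet"
    "HOL-Library.Function_Algebras"
    "Jordan_Normal_Form.Determinant"
begin

section \<open>Tensor products\<close>

text \<open>
  The tensor product of two abelian groups: the free commutative monoid on pairs modulo the
  congruence generated by biadditivity.  All groups below are rational vector spaces; for these
  the tensor product over the integers is the tensor product over the rationals, because a pure
  tensor is automatically balanced over the rationals (lemma \<open>tens_rat_balanced\<close> below).
\<close>

inductive tens_eq ::
  "('a::ab_group_add \<times> 'b::ab_group_add) multiset \<Rightarrow> ('a \<times> 'b) multiset \<Rightarrow> bool" where
  tens_refl: "tens_eq X X"
| tens_sym: "tens_eq X Y \<Longrightarrow> tens_eq Y X"
| tens_trans: "tens_eq X Y \<Longrightarrow> tens_eq Y Z \<Longrightarrow> tens_eq X Z"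
| tens_cong: "tens_eq X Y \<Longrightarrow> tens_eq X' Y' \<Longrightarrow> tens_eq (X + X') (Y + Y')"
| tens_zero_left: "tens_eq {#(0, b)#} {#}"
| tens_zero_right: "tens_eq {#(a, 0)#} {#}"
| tens_add_left: "tens_eq {#(a + a', b)#} {#(a, b), (a', b)#}"
| tens_add_right: "tens_eq {#(a, b + b')#} {#(a, b), (a, b')#}"

quotient_type (overloaded) ('a, 'b) tensor =
  "('a::ab_group_add \<times> 'b::ab_group_add) multiset" / tens_eq
  by (rule equivpI) (auto intro!: reflpI sympI transpI intro: tens_eq.intros)

lift_definition tens :: "'a::ab_group_add \<Rightarrow> 'b::ab_group_add \<Rightarrow> ('a, 'b) tensor"
  is "\<lambda>a b. {#(a, b)#}" .

lemma tens_eq_uminus: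
  "tens_eq X Y \<Longrightarrow> tens_eq (image_mset (\<lambda>(a, b). (- a, b)) X) (image_mset (\<lambda>(a, b). (- a, b)) Y)"
proof (induction rule: tens_eq.induct)
  case (tens_add_left a a' b)
  then show ?case using tens_eq.tens_add_left[of "- a" "- a'" b] by simp
qed (auto intro: tens_eq.intros)

lemma tens_eq_left_minus: "tens_eq (image_mset (\<lambda>(a, b). (- a, b)) X + X) {#}"
proof (induction X)
  case empty
  then show ?case by (auto intro: tens_eq.intros)
next
  case (add p X)
  obtain a b where p: "p = (a, b)" by force
  have "tens_eq {#(- a, b), (a, b)#} {#(- a + a, b)#}"
    by (intro tens_eq.tens_sym[OF tens_eq.tens_add_left])
  also have "tens_eq \<dots> {#}" by (simp add: tens_eq.tens_zero_left)
  finally (tens_eq.tens_trans) have *: "tens_eq {#(- a, b), (a, b)#} {#}" .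
  show ?case using tens_eq.tens_cong[OF * add.IH] by (simp add: p add_mset_commute)
qed

instantiation tensor :: (ab_group_add, ab_group_add) ab_group_add
begin

lift_definition zero_tensor :: "('a, 'b) tensor" is "{#}" .

lift_definition plus_tensor :: "('a, 'b) tensor \<Rightarrow> ('a, 'b) tensor \<Rightarrow> ('a, 'b) tensor"
  is "(+)" by (rule tens_eq.tens_cong)

lift_definition uminus_tensor :: "('a, 'b) tensor \<Rightarrow> ('a, 'b) tensor"
  is "image_mset (\<lambda>(a, b). (- a, b))" by (rule tens_eq_uminus)

definition minus_tensor :: "('a, 'b) tensor \<Rightarrow> ('a, 'b) tensor \<Rightarrow> ('a, 'b) tensor"
  where "minus_tensor x y = x + (- y)"

instance
proof
  fix a b c :: "('a, 'b) tensor"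
  show "a + b + c = a + (b + c)" by transfer (simp add: ac_simps tens_eq.tens_refl)
  show "a + b = b + a" by transfer (simp add: ac_simps tens_eq.tens_refl)
  show "0 + a = a" by transfer (simp add: tens_eq.tens_refl)
  show "- a + a = 0" by transfer (rule tens_eq_left_minus)
  show "a - b = a + (- b)" by (rule minus_tensor_def)
qed

end

lemma tensor_induct [case_names zero add, induct type: tensor]:
  assumes "P 0" and "\<And>a b x. P x \<Longrightarrow> P (tens a b + x)"
  shows "P x"
proof -
  obtain X where x: "x = abs_tensor X" by (metis Quotient3_abs_rep Quotient3_tensor)
  have "P (abs_tensor X)"
  proof (induction X)
    case empty
    then show ?case using assms(1) by (simp add: zero_tensor_def)
  next
    case (add p X)
    then show ?case using assms(2)[OF add.IH, of "fst p" "snd p"]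
      by (simp add: tens.abs_eq plus_tensor.abs_eq)
  qed
  then show ?thesis by (simp add: x)
qed

lemma tens_add_left: "tens (a + a') b = tens a b + tens a' b"
  by transfer (use tens_eq.tens_add_left in \<open>simp add: add_mset_commute\<close>)

lemma tens_add_right: "tens a (b + b') = tens a b + tens a b'"
  by transfer (use tens_eq.tens_add_right in \<open>simp add: add_mset_commute\<close>)

lemma tens_0_left [simp]: "tens 0 b = 0"
  by transfer (rule tens_eq.tens_zero_left)

lemma tens_0_right [simp]: "tens a 0 = 0"
  by transfer (rule tens_eq.tens_zero_right)

definition biadditive :: "('a::ab_group_add \<Rightarrow> 'b::ab_group_add \<Rightarrow> 'c::ab_group_add) \<Rightarrow> bool" where
  "biadditive f \<longleftrightarrow>
     (\<forall>a a' b. f (a + a') b = f a b + f a' b) \<and> (\<forall>a b b'. f a (b + b') = f a b + f a b')"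

text \<open>The homomorphism on the tensor product induced by a biadditive map (a junk value otherwise).\<close>

definition tensor_lift ::
  "('a::ab_group_add \<Rightarrow> 'b::ab_group_add \<Rightarrow> 'c::ab_group_add) \<Rightarrow> ('a, 'b) tensor \<Rightarrow> 'c" where
  "tensor_lift f x = (\<Sum>(a, b)\<in>#rep_tensor x. f a b)"

lemma biadditive_0:
  assumes "biadditive f"
  shows "f 0 b = 0" and "f a 0 = 0"
proof -
  have "f (0 + 0) b = f 0 b + f 0 b" "f a (0 + 0) = f a 0 + f a 0"
    using assms by (auto simp: biadditive_def simp del: add_0_left add_0_right)
  then show "f 0 b = 0" "f a 0 = 0" by auto
qed

lemma tens_eq_sum:
  assumes "biadditive f" "tens_eq X Y"
  shows "(\<Sum>(a, b)\<in>#X. f a b) = (\<Sum>(a, b)\<in>#Y. f a b)"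
  using assms(2)
  by (induction rule: tens_eq.induct)
     (use assms(1) in \<open>auto simp: biadditive_0 biadditive_def\<close>)

lemma tensor_lift_abs:
  assumes "biadditive f"
  shows "tensor_lift f (abs_tensor X) = (\<Sum>(a, b)\<in>#X. f a b)"
  unfolding tensor_lift_def
  by (rule tens_eq_sum[OF assms])
     (metis Quotient3_rep_abs Quotient3_tensor tens_eq.tens_refl)

lemma tensor_lift_0: "biadditive f \<Longrightarrow> tensor_lift f 0 = 0"
  by (simp add: zero_tensor_def tensor_lift_abs)

lemma tensor_lift_tens: "biadditive f \<Longrightarrow> tensor_lift f (tens a b) = f a b"
  by (simp add: tens.abs_eq tensor_lift_abs)

lemma tensor_lift_add:
  assumes "biadditive f"
  shows "tensor_lift f (x + y) = tensor_lift f x + tensor_lift f y"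
proof -
  obtain X Y where "x = abs_tensor X" "y = abs_tensor Y"
    by (metis Quotient3_abs_rep Quotient3_tensor)
  then show ?thesis
    by (simp add: plus_tensor.abs_eq tensor_lift_abs[OF assms])
qed

definition tensor_map ::
  "('a::ab_group_add \<Rightarrow> 'c::ab_group_add) \<Rightarrow> ('b::ab_group_add \<Rightarrow> 'd::ab_group_add) \<Rightarrow>
     ('a, 'b) tensor \<Rightarrow> ('c, 'd) tensor" where
  "tensor_map f g = tensor_lift (\<lambda>a b. tens (f a) (g b))"

text \<open>
  If \<open>s\<close> is a scalar multiplication of \<open>'e\<close> on \<open>'v\<close>, this is the induced scalar multiplication
  of \<open>'e \<otimes> 'c\<close> on \<open>'v \<otimes> 'c\<close>, namely \<open>(e \<otimes> z) (v \<otimes> y) = (e v) \<otimes> (z y)\<close>.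
\<close>

definition tensor_scale ::
  "('e::ab_group_add \<Rightarrow> 'v::ab_group_add \<Rightarrow> 'v) \<Rightarrow>
     ('e, 'c::comm_ring) tensor \<Rightarrow> ('v, 'c) tensor \<Rightarrow> ('v, 'c) tensor" where
  "tensor_scale s t x =
     tensor_lift (\<lambda>e z. tensor_lift (\<lambda>v y. tens (s e v) (z * y)) x) t"

lemma biadditive_scale_inner:
  assumes "biadditive s"
  shows "biadditive (\<lambda>v y. tens (s e v) (z * y :: 'c::comm_ring))"
  using assms by (auto simp: biadditive_def tens_add_left tens_add_right algebra_simps)

lemma biadditive_scale_outer:
  assumes "biadditive s"
  shows "biadditive (\<lambda>e z. tensor_lift (\<lambda>v y. tens (s e v) (z * y :: 'c::comm_ring)) x)"
proof (induction x)
  case zero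
  then show ?case
    by (simp add: biadditive_def tensor_lift_0[OF biadditive_scale_inner[OF assms]])
next
  case (add a b x)
  then show ?case using assms
    unfolding tensor_lift_add[OF biadditive_scale_inner[OF assms]]
      tensor_lift_tens[OF biadditive_scale_inner[OF assms]]
    by (auto simp: biadditive_def tens_add_left tens_add_right algebra_simps)
qed

lemma tensor_scale_simps:
  assumes "biadditive s"
  shows "tensor_scale s (tens e z) (tens v y) = tens (s e v) (z * y)"
    and "tensor_scale s (t + t') x = tensor_scale s t x + tensor_scale s t' x"
    and "tensor_scale s t (x + x') = tensor_scale s t x + tensor_scale s t x'"
    and "tensor_scale s 0 x = 0"
    and "tensor_scale s t 0 = 0"
proof -
  note o = biadditive_scale_outer[OF assms]
  note i = biadditive_scale_inner[OF assms]
  show "tensor_scale s (tens e z) (tens v y) = tens (s e v) (z * y)"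
    unfolding tensor_scale_def tensor_lift_tens[OF o] by (rule tensor_lift_tens[OF i])
  show left: "tensor_scale s (t + t') x = tensor_scale s t x + tensor_scale s t' x" for t t' x
    by (simp add: tensor_scale_def tensor_lift_add[OF o])
  have pure: "tensor_scale s (tens e z) x = tensor_lift (\<lambda>v y. tens (s e v) (z * y)) x" for e z x
    unfolding tensor_scale_def by (rule tensor_lift_tens[OF o])
  show 0: "tensor_scale s 0 x = 0" for x
    by (simp add: tensor_scale_def tensor_lift_0[OF o])
  show add: "tensor_scale s t (x + x') = tensor_scale s t x + tensor_scale s t x'" for x x'
  proof (induction t)
    case zero
    then show ?case by (simp add: 0)
  next
    case (add a b t)
    then show ?case
      by (simp add: left pure tensor_lift_add[OF i] add_ac)
  qed
  show "tensor_scale s t 0 = 0" using add[of 0 0] by simp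
qed

lemma biadditive_times: "biadditive ((*) :: 'a::comm_ring \<Rightarrow> 'a \<Rightarrow> 'a)"
  by (simp add: biadditive_def algebra_simps)

lemma field_char_0_functional:
  "\<exists>l :: 'a::field_char_0 \<Rightarrow> rat. (\<forall>x y. l (x + y) = l x + l y) \<and> l 1 = 1"
proof -
  interpret vector_space_pair "\<lambda>q (x::'a). of_rat q * x" "(*) :: rat \<Rightarrow> rat \<Rightarrow> rat"
    by unfold_locales (auto simp: algebra_simps of_rat_add of_rat_mult)
  have "vs1.independent {1}"
    by (simp add: vs1.dependent_single)
  from linear_independent_extend[OF this, of "\<lambda>_. 1"] obtain l where
    l: "Vector_Spaces.linear (\<lambda>q (x::'a). of_rat q * x) ((*) :: rat \<Rightarrow> rat \<Rightarrow> rat) l" "l 1 = 1" by auto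
  interpret l: Vector_Spaces.linear "\<lambda>q (x::'a). of_rat q * x" "(*) :: rat \<Rightarrow> rat \<Rightarrow> rat" l
    by (rule l)
  show ?thesis using l.add l(2) by blast
qed

lemma tens_1_1_neq_0: "tens (1::'a::field_char_0) (1::'b::field_char_0) \<noteq> 0"
proof
  assume *: "tens (1::'a) (1::'b) = 0"
  obtain l :: "'a \<Rightarrow> rat" where l: "\<forall>x y. l (x + y) = l x + l y" "l 1 = 1"
    using field_char_0_functional by blast
  obtain m :: "'b \<Rightarrow> rat" where m: "\<forall>x y. m (x + y) = m x + m y" "m 1 = 1"
    using field_char_0_functional by blast
  have b: "biadditive (\<lambda>x y. l x * m y)"
    using l m by (auto simp: biadditive_def algebra_simps)
  have "tensor_lift (\<lambda>x y. l x * m y) (tens 1 1) = 1"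
    using l m by (simp add: tensor_lift_tens[OF b])
  then show False by (simp add: * tensor_lift_0[OF b])
qed

instantiation tensor :: (field_char_0, field_char_0) comm_ring_1
begin

definition one_tensor :: "('a, 'b) tensor" where "one_tensor = tens 1 1"

definition times_tensor :: "('a, 'b) tensor \<Rightarrow> ('a, 'b) tensor \<Rightarrow> ('a, 'b) tensor" where
  "times_tensor = tensor_scale (*)"

instance
proof
  note simps = tensor_scale_simps[OF biadditive_times]
  fix a b c :: "('a, 'b) tensor"
  show distrib: "(a + b) * c = a * c + b * c" for a b c :: "('a, 'b) tensor"
    by (simp add: times_tensor_def simps)
  have add': "a * (b + c) = a * b + a * c" for a b c :: "('a, 'b) tensor"
    by (simp add: times_tensor_def simps)
  have z: "0 * b = 0" "b * 0 = 0" for b :: "('a, 'b) tensor"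
    by (simp_all add: times_tensor_def simps)
  have tt: "tens x y * tens x' y' = tens (x * x') (y * y')" for x x' :: 'a and y y' :: 'b
    by (simp add: times_tensor_def simps)
  have t1: "tens x y * b * c = tens x y * (b * c)" for x :: 'a and y :: 'b and b c
  proof (induction b)
    case zero
    then show ?case by (simp add: z)
  next
    case (add x' y' b)
    have "tens p q * tens x' y' * c = tens p q * (tens x' y' * c)" for p :: 'a and q :: 'b
      by (induction c) (simp_all add: z tt add' mult.assoc)
    then show ?case using add by (simp add: add' distrib)
  qed
  show "a * b * c = a * (b * c)"
    by (induction a) (simp_all add: z distrib t1)
  have t2: "tens x y * b = b * tens x y" for x :: 'a and y :: 'b and b
    by (induction b) (simp_all add: z tt distrib add' mult.commute)
  show "a * b = b * a"
    by (induction a) (simp_all add: z distrib add' t2)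
  show "1 * a = a"
    by (induction a) (simp_all add: z add' tt one_tensor_def)
  show "(0 :: ('a, 'b) tensor) \<noteq> 1"
    using tens_1_1_neq_0 by (metis one_tensor_def)
qed

end

lemma tens_times_tens: "tens x y * tens x' y' = tens (x * x') (y * y')"
  by (simp add: times_tensor_def tensor_scale_simps[OF biadditive_times])

lemma tens_rat_balanced:
  fixes s :: "rat \<Rightarrow> 'v::ab_group_add \<Rightarrow> 'v"
  assumes "vector_space s"
  shows "tens (s q v) (z::'c::field_char_0) = tens v (of_rat q * z)"
proof -
  interpret vector_space s by fact
  have nat: "tens (s (of_nat n) v) z = tens v (of_nat n * z)" for n v and z :: 'c
    by (induction n) (auto simp: scale_left_distrib tens_add_left tens_add_right algebra_simps)
  have neg: "tens (- v) z = tens v (- z)" for v and z :: 'c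
  proof -
    have "tens (- v) z + tens v z = 0" "tens v (- z) + tens v z = 0"
      by (simp_all flip: tens_add_left tens_add_right)
    then show ?thesis by (metis add_right_cancel)
  qed
  have int: "tens (s (of_int n) v) z = tens v (of_int n * z)" for n v and z :: 'c
    by (cases n rule: int_cases2) (simp_all add: nat neg)
  obtain a b where q: "q = of_int a / of_int b" "b \<noteq> 0"
    by (metis Fract_of_int_quotient Rat_cases less_irrefl)
  define u where "u = s (1 / of_int b) v"
  have v: "v = s (of_int b) u" using q by (simp add: u_def)
  have "s q v = s (of_int a) u" using q by (simp add: u_def)
  then have "tens (s q v) z = tens u (of_int a * z)" by (simp add: int)
  also have "of_int a * z = of_int b * (of_rat q * z)"
    using q by (simp add: of_rat_divide)
  also have "tens u \<dots> = tens v (of_rat q * z)" by (simp add: v int)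
  finally show ?thesis .
qed

inductive_set subgroup_generated_by :: "'a::ab_group_add set \<Rightarrow> 'a set" for S where
  "x \<in> S \<Longrightarrow> x \<in> subgroup_generated_by S"
| "0 \<in> subgroup_generated_by S"
| "x \<in> subgroup_generated_by S \<Longrightarrow> y \<in> subgroup_generated_by S \<Longrightarrow>
     x - y \<in> subgroup_generated_by S"

text \<open>
  For a rational subspace \<open>V\<close> of \<open>'v\<close>, the tensor product \<open>V \<otimes> \<complex>\<close>, realized as a
  subspace of \<open>'v \<otimes> \<complex>\<close> (the natural map is injective).
\<close>

definition complexification :: "'v::ab_group_add set \<Rightarrow> ('v, complex) tensor set" where
  "complexification V = subgroup_generated_by {tens v z | v z. v \<in> V}"


section \<open>Number fields\<close>

definition number_field :: "'k::field_char_0 itself \<Rightarrow> bool" where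
  "number_field _ \<longleftrightarrow>
     (\<exists>B::'k set. finite B \<and> module.span (\<lambda>q x. of_rat q * x) B = UNIV)"

definition is_subfield :: "'k::field set \<Rightarrow> bool" where
  "is_subfield F \<longleftrightarrow> 0 \<in> F \<and> 1 \<in> F \<and>
     (\<forall>x\<in>F. \<forall>y\<in>F. x + y \<in> F \<and> x * y \<in> F) \<and> (\<forall>x\<in>F. - x \<in> F \<and> inverse x \<in> F)"

definition adjoin :: "'k::field set \<Rightarrow> 'k \<Rightarrow> 'k set" where
  "adjoin F x = \<Inter> {L. is_subfield L \<and> F \<subseteq> L \<and> x \<in> L}"

text \<open>
  Complex embeddings of a subfield \<open>F\<close>; extensionality makes distinct functions distinct
  embeddings, and is no condition when \<open>F = UNIV\<close>.
\<close>

definition embeddings :: "'k::field set \<Rightarrow> ('k \<Rightarrow> complex) set" where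
  "embeddings F = {\<sigma> \<in> extensional F. \<sigma> 1 = 1 \<and>
     (\<forall>x\<in>F. \<forall>y\<in>F. \<sigma> (x + y) = \<sigma> x + \<sigma> y \<and> \<sigma> (x * y) = \<sigma> x * \<sigma> y)}"

definition conj_emb :: "('k \<Rightarrow> complex) \<Rightarrow> 'k \<Rightarrow> complex" where
  "conj_emb \<sigma> = cnj \<circ> \<sigma>"

definition totally_real :: "'k::field set \<Rightarrow> bool" where
  "totally_real F \<longleftrightarrow> (\<forall>\<sigma>\<in>embeddings F. \<sigma> ` F \<subseteq> \<real>)"

definition totally_imaginary :: "'k::field set \<Rightarrow> bool" where
  "totally_imaginary F \<longleftrightarrow> (\<forall>\<sigma>\<in>embeddings F. \<not> \<sigma> ` F \<subseteq> \<real>)"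

definition totally_negative :: "'k::field set \<Rightarrow> 'k \<Rightarrow> bool" where
  "totally_negative F D \<longleftrightarrow> D \<in> F \<and> (\<forall>\<sigma>\<in>embeddings F. \<sigma> D \<in> \<real> \<and> Re (\<sigma> D) < 0)"

definition field_basis :: "'k::field set \<Rightarrow> 'k set \<Rightarrow> 'k set \<Rightarrow> bool" where
  "field_basis F L B \<longleftrightarrow> B \<subseteq> L \<and> finite B \<and>
     (\<forall>x\<in>L. \<exists>!c. c \<in> B \<rightarrow>\<^sub>E F \<and> x = (\<Sum>b\<in>B. c b * b))"

definition field_degree :: "'k::field set \<Rightarrow> 'k set \<Rightarrow> nat" where
  "field_degree F L = (THE n. \<exists>B. field_basis F L B \<and> card B = n)"

text \<open>The norm down to the rationals, as a complex number.\<close>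

definition field_norm :: "'k::field set \<Rightarrow> 'k \<Rightarrow> complex" where
  "field_norm F x = (\<Prod>\<sigma>\<in>embeddings F. \<sigma> x)"

definition CM_field :: "'k::field set \<Rightarrow> bool" where
  "CM_field L \<longleftrightarrow> is_subfield L \<and> totally_imaginary L \<and>
     (\<exists>F. is_subfield F \<and> F \<subseteq> L \<and> totally_real F \<and> field_degree F L = 2)"

definition max_real_subfield :: "'k::field set \<Rightarrow> 'k set" where
  "max_real_subfield L = (GREATEST F. is_subfield F \<and> F \<subseteq> L \<and> totally_real F)"

definition max_CM_or_real_subfield :: "'k::field set" where
  "max_CM_or_real_subfield = (GREATEST L. is_subfield L \<and> (CM_field L \<or> totally_real L))"


section \<open>The groups of period classes\<close>

text \<open>The quotient of the units of \<open>\<complex>\<close> by those of \<open>\<rat>\<close>.\<close>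

definition scalar_class_eq :: "complex \<Rightarrow> complex \<Rightarrow> bool" where
  "scalar_class_eq x y \<longleftrightarrow> x \<noteq> 0 \<and> (\<exists>q. q \<noteq> 0 \<and> y = of_rat q * x)"

quotient_type scalar_class = complex / partial: scalar_class_eq
  morphisms rep_scalar_class scalar_class
proof (rule part_equivpI)
  show "\<exists>x. scalar_class_eq x x"
    by (rule exI[of _ 1]) (auto simp: scalar_class_eq_def intro!: exI[of _ 1])
  show "symp scalar_class_eq"
  proof (rule sympI)
    fix x y assume "scalar_class_eq x y"
    then obtain q where "x \<noteq> 0" "q \<noteq> 0" "y = of_rat q * x"
      by (auto simp: scalar_class_eq_def)
    then show "scalar_class_eq y x"
      by (auto simp: scalar_class_eq_def of_rat_inverse intro!: exI[of _ "inverse q"])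
  qed
  show "transp scalar_class_eq"
  proof (rule transpI)
    fix x y z assume "scalar_class_eq x y" "scalar_class_eq y z"
    then obtain q r where "x \<noteq> 0" "q \<noteq> 0" "y = of_rat q * x" "r \<noteq> 0" "z = of_rat r * y"
      by (auto simp: scalar_class_eq_def)
    then show "scalar_class_eq x z"
      by (auto simp: scalar_class_eq_def of_rat_mult intro!: exI[of _ "r * q"])
  qed
qed

instantiation scalar_class :: comm_monoid_mult
begin

lift_definition one_scalar_class :: scalar_class is 1
  by (auto simp: scalar_class_eq_def intro!: exI[of _ 1])

lift_definition times_scalar_class :: "scalar_class \<Rightarrow> scalar_class \<Rightarrow> scalar_class" is "(*)"
proof -
  fix a b c d assume "scalar_class_eq a b" "scalar_class_eq c d"
  then obtain q r where "a \<noteq> 0" "q \<noteq> 0" "b = of_rat q * a" "c \<noteq> 0" "r \<noteq> 0" "d = of_rat r * c"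
    by (auto simp: scalar_class_eq_def)
  then show "scalar_class_eq (a * c) (b * d)"
    by (auto simp: scalar_class_eq_def of_rat_mult intro!: exI[of _ "q * r"])
qed

instance
  by standard (transfer; auto simp: scalar_class_eq_def algebra_simps)+

end

text \<open>The quotient of the units of \<open>E \<otimes> \<complex>\<close> by those of \<open>E\<close>.\<close>

definition period_class_eq ::
  "('e::field_char_0, complex) tensor \<Rightarrow> ('e, complex) tensor \<Rightarrow> bool" where
  "period_class_eq x y \<longleftrightarrow> x dvd 1 \<and> (\<exists>e. e \<noteq> 0 \<and> y = tens e 1 * x)"

lemma tens_mult_tens_inverse: "e \<noteq> 0 \<Longrightarrow> tens (e::'e::field_char_0) (1::complex) * tens (inverse e) 1 = 1"
  by (simp add: tens_times_tens one_tensor_def)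

lemma tens_dvd_1: "e \<noteq> 0 \<Longrightarrow> tens (e::'e::field_char_0) (1::complex) dvd 1"
  by (metis dvdI tens_mult_tens_inverse)

quotient_type (overloaded) 'e period_class =
  "('e::field_char_0, complex) tensor" / partial: period_class_eq
  morphisms rep_period_class period_class
proof (rule part_equivpI)
  show "\<exists>x. period_class_eq x (x :: ('e, complex) tensor)"
    by (rule exI[of _ 1])
       (auto simp: period_class_eq_def one_tensor_def tens_times_tens intro!: exI[of _ 1])
  show "symp (period_class_eq :: ('e, complex) tensor \<Rightarrow> _)"
  proof (rule sympI)
    fix x y :: "('e, complex) tensor" assume "period_class_eq x y"
    then obtain e where e: "x dvd 1" "e \<noteq> 0" "y = tens e 1 * x"
      by (auto simp: period_class_eq_def)
    moreover have "y dvd 1" using e tens_dvd_1[of e] by (simp add: is_unit_mult_iff)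
    moreover have "tens (inverse e) 1 * y = x"
      using e tens_mult_tens_inverse[of e] by (metis mult.assoc mult.commute mult_1)
    ultimately show "period_class_eq y x"
      by (auto simp: period_class_eq_def intro!: exI[of _ "inverse e"])
  qed
  show "transp (period_class_eq :: ('e, complex) tensor \<Rightarrow> _)"
  proof (rule transpI)
    fix x y z :: "('e, complex) tensor" assume "period_class_eq x y" "period_class_eq y z"
    then obtain d e where "x dvd 1" "d \<noteq> 0" "y = tens d 1 * x" "e \<noteq> 0" "z = tens e 1 * y"
      by (auto simp: period_class_eq_def)
    then show "period_class_eq x z"
      by (auto simp: period_class_eq_def tens_times_tens mult.assoc[symmetric]
          intro!: exI[of _ "e * d"])
  qed
qed

lemma unit_inverse_unique:
  "x * u = 1 \<Longrightarrow> x * v = 1 \<Longrightarrow> u = (v::'a::comm_monoid_mult)"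
  by (metis mult.assoc mult.commute mult_1)

instantiation period_class :: (field_char_0) "{comm_monoid_mult, inverse}"
begin

lift_definition one_period_class :: "'a period_class" is 1
  by (auto simp: period_class_eq_def one_tensor_def tens_times_tens intro!: exI[of _ 1])

lift_definition times_period_class :: "'a period_class \<Rightarrow> 'a period_class \<Rightarrow> 'a period_class"
  is "(*)"
proof -
  fix a b c d :: "('a, complex) tensor"
  assume "period_class_eq a b" "period_class_eq c d"
  then obtain q r where q: "a dvd 1" "q \<noteq> 0" "b = tens q 1 * a"
      "c dvd 1" "r \<noteq> 0" "d = tens r 1 * c"
    by (auto simp: period_class_eq_def)
  have "b * d = tens (q * r) 1 * (a * c)"
    using tens_times_tens[of q "1::complex" r 1] by (simp add: q ac_simps)
  then show "period_class_eq (a * c) (b * d)"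
    using q by (auto simp: period_class_eq_def is_unit_mult_iff intro!: exI[of _ "q * r"])
qed

lift_definition inverse_period_class :: "'a period_class \<Rightarrow> 'a period_class"
  is "\<lambda>x. THE y. x * y = 1"
proof -
  fix a b :: "('a, complex) tensor"
  assume "period_class_eq a b"
  then obtain q where q: "a dvd 1" "q \<noteq> 0" "b = tens q 1 * a"
    by (auto simp: period_class_eq_def)
  obtain u where u: "a * u = 1" using q(1) by (metis dvdE)
  have bu: "b * (tens (inverse q) 1 * u) = 1"
  proof -
    have "b * (tens (inverse q) 1 * u) = (tens q 1 * tens (inverse q) 1) * (a * u)"
      by (simp add: q(3) ac_simps)
    then show ?thesis using tens_mult_tens_inverse[OF q(2)] u by simp
  qed
  have "(THE y. a * y = 1) = u" using u unit_inverse_unique by blast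
  moreover have "(THE y. b * y = 1) = tens (inverse q) 1 * u"
    using bu unit_inverse_unique by blast
  moreover have "u dvd 1" using u by (metis dvdI mult.commute)
  ultimately show "period_class_eq (THE y. a * y = 1) (THE y. b * y = 1)"
    using q(2) by (auto simp: period_class_eq_def intro!: exI[of _ "inverse q"])
qed

definition divide_period_class :: "'a period_class \<Rightarrow> 'a period_class \<Rightarrow> 'a period_class" where
  "divide_period_class x y = x * inverse y"

instance
proof
  fix a b c :: "'a period_class"
  have refl: "x dvd 1 \<Longrightarrow> period_class_eq x x" for x :: "('a, complex) tensor"
    by (auto simp: period_class_eq_def one_tensor_def[symmetric] intro!: exI[of _ 1])
  have unit: "period_class_eq x x \<Longrightarrow> x dvd 1" for x :: "('a, complex) tensor"
    by (simp add: period_class_eq_def)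
  show "a * b * c = a * (b * c)"
    by transfer (simp add: mult.assoc, intro refl, simp add: is_unit_mult_iff unit)
  show "a * b = b * a"
    by transfer (simp add: mult.commute, intro refl, simp add: is_unit_mult_iff unit)
  show "1 * a = a"
    by transfer simp
qed

end

lemma period_class_right_inverse: "x * inverse x = (1 :: 'e::field_char_0 period_class)"
proof transfer
  fix x :: "('e, complex) tensor" assume "period_class_eq x x"
  then obtain u where u: "x * u = 1" by (metis dvdE period_class_eq_def)
  then have "(THE y. x * y = 1) = u" using unit_inverse_unique by blast
  then show "period_class_eq (x * (THE y. x * y = 1)) 1"
    using u by (auto simp: period_class_eq_def one_tensor_def[symmetric] intro!: exI[of _ 1])
qed

lift_definition period_of_scalar :: "scalar_class \<Rightarrow> 'e::field_char_0 period_class"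
  is "\<lambda>z. tens 1 z"
proof -
  fix a b assume "scalar_class_eq a b"
  then obtain q where q: "a \<noteq> 0" "q \<noteq> 0" "b = of_rat q * a" by (auto simp: scalar_class_eq_def)
  have "tens (1::'e) a * tens 1 (inverse a) = 1"
    using q by (simp add: tens_times_tens one_tensor_def)
  moreover have "tens (1::'e) b = tens (of_rat q) 1 * tens 1 a"
  proof -
    have "vector_space (\<lambda>q (x::'e). of_rat q * x)"
      by unfold_locales (auto simp: algebra_simps of_rat_add of_rat_mult)
    from tens_rat_balanced[OF this, of q 1 a] show ?thesis by (simp add: tens_times_tens q)
  qed
  ultimately show "period_class_eq (tens (1::'e) a) (tens 1 b)"
    using q by (auto simp: period_class_eq_def intro!: exI[of _ "of_rat q"] dvdI[of _ _ "tens 1 (inverse a)"])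
qed


section \<open>The invariant of a number field\<close>

text \<open>
  \<open>delta_CM L\<close> is the invariant of a CM field \<open>L = F(sqrt D)\<close>; the class does not depend on
  the choice of \<open>D\<close>, which is unique up to squares of \<open>F\<close>, or on that of \<open>z\<close>.
\<close>

definition delta_CM :: "'k::field set \<Rightarrow> scalar_class" where
  "delta_CM L = (THE c. \<exists>D r z. totally_negative (max_real_subfield L) D \<and> r\<^sup>2 = D \<and>
     L = adjoin (max_real_subfield L) r \<and>
     z\<^sup>2 = field_norm (max_real_subfield L) D \<and> c = scalar_class z)"

definition delta :: "'k::field itself \<Rightarrow> scalar_class" where
  "delta _ = (let L = max_CM_or_real_subfield :: 'k set in
     if totally_real L then 1 else delta_CM L ^ field_degree L UNIV)"


section \<open>Betti--de Rham systems\<close>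

text \<open>
  The Betti spaces are subspaces of a common ambient space \<open>'b\<close> over \<open>E\<close>, and the de Rham space
  is the type \<open>'d\<close>, a module over the ring \<open>K \<otimes> E\<close>.

  The embedding indexing \<open>betti\<close>, \<open>frob\<close> and \<open>comparison\<close> is only relevant when it lies in
  \<open>embeddings UNIV\<close>, and the argument of the latter two only when it lies in the Betti space or
  its complexification.

  The tensor product of the de Rham space with \<open>\<complex>\<close> over \<open>K\<close> along an embedding is the quotient
  of the one over the rationals by \<open>dR_balance\<close>; the comparison map takes values in the set of
  cosets of that subgroup.
\<close>

record (overloaded)
  ('k::field_char_0, 'e::field_char_0, 'b::ab_group_add, 'd::ab_group_add) bdr =
  weight :: int
  betti_scale :: "'e \<Rightarrow> 'b \<Rightarrow> 'b"
  betti :: "('k \<Rightarrow> complex) \<Rightarrow> 'b set"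
  frob :: "('k \<Rightarrow> complex) \<Rightarrow> 'b \<Rightarrow> 'b"
  dR_scale :: "('k, 'e) tensor \<Rightarrow> 'd \<Rightarrow> 'd"
  filt :: "int \<Rightarrow> 'd set"
  comparison :: "('k \<Rightarrow> complex) \<Rightarrow> ('b, complex) tensor \<Rightarrow> ('d, complex) tensor set"

definition dR_scale_K ::
  "('k::field_char_0, 'e::field_char_0, 'b::ab_group_add, 'd::ab_group_add) bdr \<Rightarrow> 'k \<Rightarrow> 'd \<Rightarrow> 'd"
  where "dR_scale_K M k = dR_scale M (tens k 1)"

definition dR_scale_E ::
  "('k::field_char_0, 'e::field_char_0, 'b::ab_group_add, 'd::ab_group_add) bdr \<Rightarrow> 'e \<Rightarrow> 'd \<Rightarrow> 'd"
  where "dR_scale_E M e = dR_scale M (tens 1 e)"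

definition dR_balance ::
  "('k::field_char_0, 'e::field_char_0, 'b::ab_group_add, 'd::ab_group_add) bdr \<Rightarrow>
     ('k \<Rightarrow> complex) \<Rightarrow> ('d, complex) tensor set" where
  "dR_balance M \<sigma> =
     subgroup_generated_by {tens (dR_scale_K M k x) z - tens x (\<sigma> k * z) | k x z. True}"

definition dR_coset ::
  "('k::field_char_0, 'e::field_char_0, 'b::ab_group_add, 'd::ab_group_add) bdr \<Rightarrow>
     ('k \<Rightarrow> complex) \<Rightarrow> ('d, complex) tensor \<Rightarrow> ('d, complex) tensor set" where
  "dR_coset M \<sigma> y = {y'. y' - y \<in> dR_balance M \<sigma>}"

text \<open>
  The coset of an element lies in the subspace induced by a step of the filtration iff it meets
  the complexification of this step.
\<close>

definition hodge ::
  "('k::field_char_0, 'e::field_char_0, 'b::ab_group_add, 'd::ab_group_add) bdr \<Rightarrow>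
     ('k \<Rightarrow> complex) \<Rightarrow> int \<Rightarrow> int \<Rightarrow> ('b, complex) tensor set" where
  "hodge M \<sigma> p q = {x \<in> complexification (betti M \<sigma>).
     comparison M \<sigma> x \<inter> complexification (filt M p) \<noteq> {} \<and>
     comparison M \<sigma> (tensor_map id cnj x) \<inter> complexification (filt M q) \<noteq> {}}"

definition betti_de_rham_system ::
  "('k::field_char_0, 'e::field_char_0, 'b::ab_group_add, 'd::ab_group_add) bdr \<Rightarrow> bool" where
  "betti_de_rham_system M \<longleftrightarrow>
     vector_space (betti_scale M) \<and>
     (\<forall>\<sigma>\<in>embeddings UNIV. module.subspace (betti_scale M) (betti M \<sigma>) \<and>
        (\<exists>B. finite B \<and> module.span (betti_scale M) B = betti M \<sigma>)) \<and>
     (\<forall>\<sigma>\<in>embeddings UNIV. \<forall>x\<in>betti M \<sigma>.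
        frob M \<sigma> x \<in> betti M (conj_emb \<sigma>) \<and> frob M (conj_emb \<sigma>) (frob M \<sigma> x) = x \<and>
        (\<forall>y\<in>betti M \<sigma>. frob M \<sigma> (x + y) = frob M \<sigma> x + frob M \<sigma> y) \<and>
        (\<forall>e. frob M \<sigma> (betti_scale M e x) = betti_scale M e (frob M \<sigma> x))) \<and>
     Modules.module (dR_scale M) \<and>
     (\<forall>p. module.subspace (dR_scale M) (filt M p)) \<and>
     antimono (filt M) \<and> (\<exists>p. filt M p = UNIV) \<and> (\<exists>p. filt M p = {0}) \<and>
     (\<forall>\<sigma>\<in>embeddings UNIV.
        bij_betw (comparison M \<sigma>) (complexification (betti M \<sigma>)) (range (dR_coset M \<sigma>)) \<and>
        (\<forall>x\<in>complexification (betti M \<sigma>). \<forall>a\<in>comparison M \<sigma> x.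
           (\<forall>y\<in>complexification (betti M \<sigma>). \<forall>b\<in>comparison M \<sigma> y.
              a + b \<in> comparison M \<sigma> (x + y)) \<and>
           (\<forall>t. tensor_scale (dR_scale_E M) t a
                  \<in> comparison M \<sigma> (tensor_scale (betti_scale M) t x))) \<and>
        (\<forall>x\<in>betti M \<sigma>. \<forall>z. tensor_map id cnj ` comparison M \<sigma> (tens x z) =
              comparison M (conj_emb \<sigma>) (tens (frob M \<sigma> x) (cnj z)))) \<and>
     (\<forall>\<sigma>\<in>embeddings UNIV. \<forall>x\<in>complexification (betti M \<sigma>).
        \<exists>!h. finite {p. h p \<noteq> 0} \<and> (\<forall>p. h p \<in> hodge M \<sigma> p (weight M - p)) \<and>
             x = (\<Sum>p | h p \<noteq> 0. h p))"

definition vanishing_middle_hodge_number ::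
  "('k::field_char_0, 'e::field_char_0, 'b::ab_group_add, 'd::ab_group_add) bdr \<Rightarrow> bool" where
  "vanishing_middle_hodge_number M \<longleftrightarrow>
     odd (weight M) \<or> (\<exists>k. weight M = 2 * k \<and> (\<forall>\<sigma>\<in>embeddings UNIV. hodge M \<sigma> k k = {0}))"

text \<open>
  Restriction of scalars to the rationals.  Elements of the direct sum of the Betti spaces are
  functions on the embeddings, extended by zero.  The comparison map sends \<open>x\<close> to the set (a
  singleton, that is, a coset of the trivial subgroup) of those \<open>y\<close> whose component in each
  tensor product along an embedding is the image of the corresponding component of \<open>x\<close>.
\<close>

definition restriction_of_scalars ::
  "('k::field_char_0, 'e::field_char_0, 'b::ab_group_add, 'd::ab_group_add) bdr \<Rightarrow>
     (rat, 'e, ('k \<Rightarrow> complex) \<Rightarrow> 'b, 'd) bdr" where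
  "restriction_of_scalars M = \<lparr>
     weight = weight M,
     betti_scale = (\<lambda>e x \<sigma>. betti_scale M e (x \<sigma>)),
     betti = (\<lambda>_. {x. (\<forall>\<sigma>\<in>embeddings UNIV. x \<sigma> \<in> betti M \<sigma>) \<and>
                      (\<forall>\<sigma>. \<sigma> \<notin> embeddings UNIV \<longrightarrow> x \<sigma> = 0)}),
     frob = (\<lambda>_ x \<sigma>. if \<sigma> \<in> embeddings UNIV
                     then frob M (conj_emb \<sigma>) (x (conj_emb \<sigma>)) else 0),
     dR_scale = (\<lambda>t. dR_scale M (tensor_map of_rat id t)),
     filt = filt M,
     comparison = (\<lambda>_ x. {y. \<forall>\<sigma>\<in>embeddings UNIV.
                      dR_coset M \<sigma> y = comparison M \<sigma> (tensor_map (\<lambda>f. f \<sigma>) id x)}) \<rparr>"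


section \<open>Periods\<close>

text \<open>An ordered basis of the quotient \<open>V / N\<close>, given by representatives in \<open>V\<close>.\<close>

definition basis_mod :: "('e \<Rightarrow> 'v::ab_group_add \<Rightarrow> 'v) \<Rightarrow> 'v set \<Rightarrow> 'v set \<Rightarrow> 'v list \<Rightarrow> bool" where
  "basis_mod s V N vs \<longleftrightarrow> set vs \<subseteq> V \<and>
     (\<forall>x\<in>V. \<exists>!c. length c = length vs \<and> x - (\<Sum>i<length vs. s (c ! i) (vs ! i)) \<in> N)"

text \<open>
  Periods of a system over the rationals, whose only embedding is \<open>of_rat\<close>: the sign \<open>s\<close> is
  \<open>1\<close> or \<open>-1\<close> and selects the eigenspace of the infinite Frobenius.
\<close>

definition eigenspace ::
  "(rat, 'e::field_char_0, 'b::ab_group_add, 'd::ab_group_add) bdr \<Rightarrow> int \<Rightarrow> 'b set" where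
  "eigenspace N s = {x \<in> betti N of_rat. frob N of_rat x = (if s = 1 then x else - x)}"

definition period_matrix ::
  "(rat, 'e::field_char_0, 'b::ab_group_add, 'd::ab_group_add) bdr \<Rightarrow>
     'b list \<Rightarrow> 'd list \<Rightarrow> ('e, complex) tensor mat \<Rightarrow> bool" where
  "period_matrix N bs ds A \<longleftrightarrow> A \<in> carrier_mat (length ds) (length bs) \<and>
     (\<forall>j<length bs. \<exists>y\<in>comparison N of_rat (tens (bs ! j) 1).
        y - (\<Sum>i<length ds. tensor_scale (dR_scale_E N) (A $$ (i, j)) (tens (ds ! i) 1))
          \<in> complexification (filt N (weight N div 2 + 1)))"

definition rational_period ::
  "(rat, 'e::field_char_0, 'b::ab_group_add, 'd::ab_group_add) bdr \<Rightarrow> int \<Rightarrow> 'e period_class" where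
  "rational_period N s = (THE c. \<exists>bs ds A.
     basis_mod (betti_scale N) (eigenspace N s) {0} bs \<and>
     basis_mod (dR_scale_E N) UNIV (filt N (weight N div 2 + 1)) ds \<and>
     length bs = length ds \<and> period_matrix N bs ds A \<and> det A dvd 1 \<and> c = period_class (det A))"

definition c_plus ::
  "('k::field_char_0, 'e::field_char_0, 'b::ab_group_add, 'd::ab_group_add) bdr \<Rightarrow> 'e period_class"
  where "c_plus M = rational_period (restriction_of_scalars M) 1"

definition c_minus ::
  "('k::field_char_0, 'e::field_char_0, 'b::ab_group_add, 'd::ab_group_add) bdr \<Rightarrow> 'e period_class"
  where "c_minus M = rational_period (restriction_of_scalars M) (- 1)"

end

theory Submission
  imports Defs "Jordan_Normal_Form.Schur_Decomposition" "HOL-Computational_Algebra.Field_as_Ring"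
begin

text \<open>
  Let \<open>\<Phi>\<close> be a set of representatives of the pairs of conjugate embeddings.  A basis \<open>u\<close> of the
  Betti spaces for \<open>\<Phi>\<close> gives bases \<open>u \<plusminus> F u\<close> of the two eigenspaces of Frobenius.  If
  \<open>t \<in> K \<otimes> \<complex>\<close> takes opposite values at conjugate embeddings, it maps \<open>u + F u\<close> to \<open>u - F u\<close>
  up to the values \<open>d\<close> of \<open>t\<close> at \<open>\<Phi>\<close>, and it preserves the filtration, so the determinant of \<open>t\<close>
  on \<open>(M\<^sub>d\<^sub>R / F) \<otimes> \<complex>\<close> times \<open>c\<^sup>+\<close> is \<open>c\<^sup>-\<close> times the product of \<open>d\<close>.

  If some nonzero \<open>r \<in> K\<close> is purely imaginary under all embeddings, \<open>K\<close> contains a CM field.  With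
  \<open>t = r\<close> the determinant lies in \<open>E\<close>, and the product of \<open>d\<close> is the \<open>n\<close>-th power of the product
  over \<open>\<Phi> = {\<sigma>. Im (\<sigma> r) > 0}\<close> of \<open>\<sigma> r\<close>, which represents \<open>\<delta>(K)\<close>.

  Otherwise \<open>\<delta>(K) = 1\<close>, and \<open>t\<close> is taken to be 1 on \<open>\<Phi>\<close> and -1 on its conjugate.  The difference
  of the ranks of \<open>M\<^sub>d\<^sub>R / F\<close> at conjugate embeddings is, up to trace duality, an element of \<open>K\<close> with
  purely imaginary conjugates, hence 0.  So \<open>t\<close> is an involution of trace 0 and its determinant is a sign.
\<close>

section \<open>Linear algebra of tensor products\<close>

text \<open>The vanishing middle Hodge number enters through one fact: \<open>FilW\<close> and its
  image under Frobenius are complementary in M_dR \<otimes> C. It makes the period matrices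
  invertible, and it gives the Hodge symmetry of the ranks at conjugate embeddings. The obstacle is
  that K \<otimes> E need not be a field, so M_dR / F need not be free over it, and the ranks of its
  summands may vary with the embedding. For an element of K this is harmless, since it acts
  E-linearly before the extension to C. The twist by signs is not rational over K, and its
  determinant is one and the same sign at all embeddings of E only because the ranks turn out to be
  balanced. A rank is made accessible to K as the trace of an idempotent of K \<otimes> C, that is,
  as a value of the C-linear extension of the trace functional from K to E. Since E \<otimes> C need
  not be a field either, invertibility is shown by explicit inverse matrices, ranks are compared as
  traces, and facts about complex matrices are transferred along the embeddings of E.\<close>

lemma additive_comp: "additive f \<Longrightarrow> additive g \<Longrightarrow> additive (\<lambda>x. f (g x))"
  by (simp add: additive_def)

lemma additive_sum_fun: "(\<And>i. i \<in> A \<Longrightarrow> additive (f i)) \<Longrightarrow> additive (\<lambda>x. \<Sum>i\<in>A. f i x)"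
  by (simp add: additive_def sum.distrib)

lemma additive_diff_fun: "additive f \<Longrightarrow> additive g \<Longrightarrow> additive (\<lambda>x. f x - g x)"
  by (simp add: additive_def)

lemma tens_sum_left: "tens (sum f A) z = (\<Sum>i\<in>A. tens (f i) z)"
  by (rule additive.sum) (simp add: additive_def tens_add_left)

lemma tens_sum_right: "tens x (sum f A) = (\<Sum>i\<in>A. tens x (f i))"
  by (rule additive.sum) (simp add: additive_def tens_add_right)

lemma tens_uminus_left: "tens (- x) z = - tens x z"
  by (rule additive.minus) (simp add: additive_def tens_add_left)

lemma tens_uminus_right: "tens x (- z) = - tens x z"
  by (rule additive.minus) (simp add: additive_def tens_add_right)

lemma tens_diff_left: "tens (x - y) z = tens x z - tens y z"
  by (rule additive.diff) (simp add: additive_def tens_add_left)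

lemma tens_diff_right: "tens x (y - z) = tens x y - tens x z"
  by (rule additive.diff) (simp add: additive_def tens_add_right)

lemma biadditive_tens_map: "additive f \<Longrightarrow> additive g \<Longrightarrow> biadditive (\<lambda>a b. tens (f a) (g b))"
  by (simp add: biadditive_def additive_def tens_add_left tens_add_right)

lemma additive_tensor_lift: "biadditive f \<Longrightarrow> additive (tensor_lift f)"
  by (simp add: additive_def tensor_lift_add)

lemma additive_tensor_map: "additive f \<Longrightarrow> additive g \<Longrightarrow> additive (tensor_map f g)"
  unfolding tensor_map_def by (intro additive_tensor_lift biadditive_tens_map)

lemma tensor_map_tens [simp]:
  "additive f \<Longrightarrow> additive g \<Longrightarrow> tensor_map f g (tens a b) = tens (f a) (g b)"
  unfolding tensor_map_def by (intro tensor_lift_tens biadditive_tens_map)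

lemma additive_id: "additive id" "additive (\<lambda>x. x)"
  by (simp_all add: additive_def)

lemma additive_cnj: "additive cnj"
  by (simp add: additive_def)

lemmas tensor_map_add = additive.add[OF additive_tensor_map]
lemmas tensor_map_zero = additive.zero[OF additive_tensor_map]

lemma tensor_eqI:
  assumes "additive f" "additive g" "\<And>a b. f (tens a b) = g (tens a b)"
  shows "f x = g x"
  by (induction x) (simp_all add: assms additive.zero[OF assms(1)] additive.zero[OF assms(2)]
      additive.add[OF assms(1)] additive.add[OF assms(2)])

lemma tens_1_of_nat: "tens (1 :: 'e::field_char_0) (of_nat n :: complex) = of_nat n"
  by (induction n) (simp_all add: tens_add_right one_tensor_def)

lemma tens_power: "tens a b ^ n = tens (a ^ n) ((b :: 'b::field_char_0) ^ n)"
  by (induction n) (simp_all add: one_tensor_def tens_times_tens)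

lemma tens_1_mult: "tens 1 (x * y) = tens (1::'e::field_char_0) (x :: complex) * tens 1 y"
  by (simp add: tens_times_tens)

lemma tens_of_rat_left: "tens (of_rat q * x :: 'e::field_char_0) (z :: 'c::field_char_0) = tens x (of_rat q * z)"
proof -
  have "vector_space (\<lambda>q (x::'e). of_rat q * x)"
    by unfold_locales (auto simp: algebra_simps of_rat_add of_rat_mult)
  from tens_rat_balanced[OF this] show ?thesis .
qed

lemma module_biadditive: "Modules.module s \<Longrightarrow> biadditive s"
  by (simp add: biadditive_def Modules.module_def)

lemma module_tensor_scale:
  fixes s :: "'e::field_char_0 \<Rightarrow> 'v::ab_group_add \<Rightarrow> 'v"
  assumes "Modules.module s"
  shows "Modules.module (tensor_scale s :: ('e, complex) tensor \<Rightarrow> _)"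
proof
  interpret Modules.module s by fact
  note simps = tensor_scale_simps[OF module_biadditive[OF assms]]
  fix a b :: "('e, complex) tensor" and x y :: "('v, complex) tensor"
  show "tensor_scale s a (x + y) = tensor_scale s a x + tensor_scale s a y"
    "tensor_scale s (a + b) x = tensor_scale s a x + tensor_scale s b x"
    by (simp_all add: simps)
  show "tensor_scale s 1 x = x"
    by (induction x) (simp_all add: simps one_tensor_def)
  show "tensor_scale s a (tensor_scale s b x) = tensor_scale s (a * b) x"
  proof (induction a)
    case zero
    then show ?case by (simp add: simps)
  next
    case (add p q a)
    have "tensor_scale s (tens p q) (tensor_scale s b x) = tensor_scale s (tens p q * b) x"
    proof (induction b)
      case zero
      then show ?case by (simp add: simps)
    next
      case (add p' q' b)
      have "tensor_scale s (tens p q) (tensor_scale s (tens p' q') x)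
          = tensor_scale s (tens p q * tens p' q') x"
        by (induction x) (simp_all add: simps tens_times_tens mult.assoc)
      then show ?case using add by (simp add: simps distrib_left)
    qed
    then show ?case using add by (simp add: simps distrib_right)
  qed
qed

lemma tensor_scale_commute:
  assumes "biadditive s" "biadditive t" "\<And>a b v. s a (t b v) = t b (s a v)"
  shows "tensor_scale s x (tensor_scale t y w) = tensor_scale t y (tensor_scale s x (w :: ('v::ab_group_add, 'c::comm_ring) tensor))"
proof -
  note simps = tensor_scale_simps[OF assms(1)] tensor_scale_simps[OF assms(2)]
  have *: "tensor_scale s (tens a z) (tensor_scale t (tens b z') w)
      = tensor_scale t (tens b z') (tensor_scale s (tens a z) w)" for a z b z'
    by (induction w) (simp_all add: simps assms(3) mult.left_commute)
  have "tensor_scale s (tens a z) (tensor_scale t y w)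
      = tensor_scale t y (tensor_scale s (tens a z) w)" for a z
    by (induction y) (simp_all add: simps *)
  then show ?thesis
    by (induction x) (simp_all add: simps)
qed

lemma tensor_map_scale:
  assumes "biadditive s" "biadditive t" "additive f" "additive g" "additive h"
    and "\<And>a v. f (s a v) = t (h a) (f v)" and "\<And>x y. g (x * y) = g x * g y"
  shows "tensor_map f g (tensor_scale s x w) = tensor_scale t (tensor_map h g x) (tensor_map f g w)"
proof -
  note simps = tensor_scale_simps[OF assms(1)] tensor_scale_simps[OF assms(2)]
    tensor_map_zero tensor_map_add
  have "tensor_map f g (tensor_scale s (tens a z) w)
      = tensor_scale t (tens (h a) (g z)) (tensor_map f g w)" for a z
    by (induction w) (simp_all add: simps assms)
  then show ?thesis
    by (induction x) (simp_all add: simps assms)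
qed

text \<open>The extension by C-linearity. Applied to an E-linear coordinate on V it yields the
  corresponding E \<otimes> C-linear coordinate on V \<otimes> C, which is how the coordinates over
  E \<otimes> C below arise.\<close>

definition linear_ext :: "('v::ab_group_add \<Rightarrow> 'w::ab_group_add) \<Rightarrow> ('v, complex) tensor \<Rightarrow> ('w, complex) tensor" where
  "linear_ext l = tensor_map l id"

lemma additive_linear_ext: "additive l \<Longrightarrow> additive (linear_ext l)"
  unfolding linear_ext_def by (intro additive_tensor_map additive_id)

lemma linear_ext_tens: "additive l \<Longrightarrow> linear_ext l (tens v z) = tens (l v) z"
  by (simp add: linear_ext_def additive_id)

lemma linear_ext_scale:
  fixes s :: "'e::field_char_0 \<Rightarrow> 'v::ab_group_add \<Rightarrow> 'v"
  assumes "biadditive s" "additive l" "\<And>a v. l (s a v) = a * l v"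
  shows "linear_ext l (tensor_scale s t w) = t * linear_ext l w"
proof -
  have "tensor_map id id t = t"
    by (rule tensor_eqI[of "tensor_map id id" id, simplified])
      (simp_all add: additive_tensor_map additive_id)
  then show ?thesis
    using tensor_map_scale[OF assms(1) biadditive_times assms(2) additive_id(1) additive_id(1), of t w] assms(3)
    by (simp add: linear_ext_def times_tensor_def)
qed

lemma complexification_induct [consumes 1, case_names tens zero diff]:
  assumes "x \<in> complexification V"
    and "\<And>v z. v \<in> V \<Longrightarrow> P (tens v z)" "P 0" "\<And>x y. x \<in> complexification V \<Longrightarrow> y \<in> complexification V \<Longrightarrow> P x \<Longrightarrow> P y \<Longrightarrow> P (x - y)"
  shows "P x"
  using assms(1) unfolding complexification_def
  by (induction rule: subgroup_generated_by.induct) (use assms in \<open>auto simp: complexification_def\<close>)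

lemma complexification_0: "0 \<in> complexification V"
  and complexification_diff: "x \<in> complexification V \<Longrightarrow> y \<in> complexification V \<Longrightarrow> x - y \<in> complexification V"
  and complexification_tens: "v \<in> V \<Longrightarrow> tens v z \<in> complexification V"
  unfolding complexification_def by (auto intro: subgroup_generated_by.intros)

lemma complexification_uminus: "x \<in> complexification V \<Longrightarrow> - x \<in> complexification V"
  using complexification_diff[OF complexification_0, of x] by simp

lemma complexification_add: "x \<in> complexification V \<Longrightarrow> y \<in> complexification V \<Longrightarrow> x + y \<in> complexification V"
  using complexification_diff[of x V "- y"] complexification_uminus[of y V] by simp

lemma complexification_sum: "(\<And>i. i \<in> A \<Longrightarrow> f i \<in> complexification V) \<Longrightarrow> sum f A \<in> complexification V"
  by (induction A rule: infinite_finite_induct) (auto intro: complexification_0 complexification_add)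

lemma complexification_mono: "x \<in> complexification V \<Longrightarrow> V \<subseteq> V' \<Longrightarrow> x \<in> complexification V'"
  by (induction rule: complexification_induct) (auto intro: complexification_0 complexification_diff complexification_tens)

lemma complexification_UNIV: "x \<in> complexification UNIV"
  by (induction x) (auto intro: complexification_0 complexification_add complexification_tens)

lemma complexification_singleton_0: "x \<in> complexification {0} \<longleftrightarrow> x = 0"
proof
  show "x \<in> complexification {0} \<Longrightarrow> x = 0"
    by (induction rule: complexification_induct) auto
qed (simp add: complexification_0)

lemma complexification_map:
  assumes "x \<in> complexification V" "additive f" "additive g" "\<And>v. v \<in> V \<Longrightarrow> f v \<in> V'"
  shows "tensor_map f g x \<in> complexification V'"
  using assms(1)
  by (induction rule: complexification_induct)
    (simp_all add: assms complexification_0 complexification_diff complexification_tens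
      tensor_map_zero additive.diff[OF additive_tensor_map])

lemma complexification_scale:
  fixes s :: "'e::field_char_0 \<Rightarrow> 'v::ab_group_add \<Rightarrow> 'v"
  assumes "x \<in> complexification V" "Modules.module s" "\<And>a v. v \<in> V \<Longrightarrow> s a v \<in> V"
  shows "tensor_scale s t x \<in> complexification V"
proof -
  note simps = tensor_scale_simps[OF module_biadditive[OF assms(2)]]
  have ad: "additive (tensor_scale s t)" for t :: "('e, complex) tensor"
    by (simp add: additive_def simps)
  have "tensor_scale s (tens a z) x \<in> complexification V" for a z
    using assms(1)
    by (induction rule: complexification_induct)
      (simp_all add: simps additive.diff[OF ad] complexification_0 complexification_diff complexification_tens assms)
  then show ?thesis
    by (induction t) (simp_all add: simps complexification_0 complexification_add)
qed

lemma linear_ext_vanish: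
  assumes "x \<in> complexification V" "additive l" "\<And>v. v \<in> V \<Longrightarrow> l v = 0"
  shows "linear_ext l x = 0"
  using complexification_map[OF assms(1) assms(2) additive_id(1), of "{0}"] assms(3)
  by (simp add: complexification_singleton_0 linear_ext_def)

text \<open>The defect of the expansion is additive in \<open>x\<close>, and on a pure tensor it is
  the pure tensor of the defect in V. With \<open>Z = {0}\<close> this extends honest coordinates to
  V \<otimes> C; with \<open>Z\<close> a step of the filtration it extends coordinates of a
  quotient.\<close>

lemma coordinates_complexification:
  fixes s :: "'e::field_char_0 \<Rightarrow> 'v::ab_group_add \<Rightarrow> 'v"
  assumes "x \<in> complexification V" "Modules.module s" "\<And>i. i \<in> I \<Longrightarrow> additive (l i)"
    and "\<And>v. v \<in> V \<Longrightarrow> v - (\<Sum>i\<in>I. s (l i v) (u i)) \<in> Z"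
  shows "x - (\<Sum>i\<in>I. tensor_scale s (linear_ext (l i) x) (tens (u i) 1)) \<in> complexification Z"
proof -
  note simps = tensor_scale_simps[OF module_biadditive[OF assms(2)]]
  let ?f = "\<lambda>x. x - (\<Sum>i\<in>I. tensor_scale s (linear_ext (l i) x) (tens (u i) 1))"
  have ad: "additive ?f"
  proof (intro additive_diff_fun additive_id additive_sum_fun)
    fix i assume "i \<in> I"
    then show "additive (\<lambda>x. tensor_scale s (linear_ext (l i) x) (tens (u i) 1))"
      by (intro additive.intro) (simp add: simps additive.add[OF additive_linear_ext] assms(3))
  qed
  show ?thesis
    using assms(1)
  proof (induction rule: complexification_induct)
    case (tens v z)
    have "?f (tens v z) = tens (v - (\<Sum>i\<in>I. s (l i v) (u i))) z"
      by (simp add: linear_ext_tens assms(3) simps tens_diff_left tens_sum_left)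
    then show ?case using assms(4)[OF tens] by (simp add: complexification_tens)
  next
    case zero
    show ?case unfolding additive.zero[OF ad] by (rule complexification_0)
  next
    case (diff x y)
    then show ?case by (simp add: additive.diff[OF ad] complexification_diff)
  qed
qed

section \<open>Embeddings of a number field\<close>

lemma vector_space_rat: "vector_space (\<lambda>q (x::'k::field_char_0). of_rat q * x)"
  by unfold_locales (auto simp: algebra_simps of_rat_add of_rat_mult)

interpretation rat_poly_hom: map_poly_comm_ring_hom "of_rat :: rat \<Rightarrow> 'a::field_char_0" ..

text \<open>The powers of \<open>x\<close> up to the exponent \<open>card B\<close> outnumber the
  spanning set \<open>B\<close>. Two equal powers would already be a polynomial relation, so the
  powers form a set of the full size.\<close>

lemma number_field_annihilating_poly:
  assumes "number_field TYPE('k::field_char_0)"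
  shows "\<exists>p. p \<noteq> 0 \<and> poly (map_poly of_rat p) (x :: 'k) = 0"
proof (rule ccontr)
  interpret Q: vector_space "\<lambda>q (x::'k). of_rat q * x" by (rule vector_space_rat)
  assume "\<not> ?thesis"
  then have none: "p = 0" if "poly (map_poly of_rat p) x = 0" for p :: "rat poly"
    using that by blast
  obtain B :: "'k set" where B: "finite B" "Q.span B = UNIV"
    using assms by (auto simp: number_field_def)
  have inj: "inj_on (\<lambda>i. x ^ i) A" for A
  proof (rule inj_onI)
    fix i j assume "x ^ i = x ^ j"
    then have "monom 1 i - monom 1 j = (0 :: rat poly)"
      by (intro none) (simp add: rat_poly_hom.hom_minus map_poly_monom poly_monom)
    then show "i = j" by (metis coeff_monom eq_iff_diff_eq_0 zero_neq_one)
  qed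
  define A where "A = (\<lambda>i. x ^ i) ` {..card B}"
  have "Q.independent A"
  proof (rule Q.independent_if_scalars_zero)
    fix f y assume s: "(\<Sum>y\<in>A. of_rat (f y) * y) = 0" and y: "y \<in> A"
    define p where "p = (\<Sum>i\<le>card B. monom (f (x ^ i)) i)"
    have "(\<Sum>y\<in>A. of_rat (f y) * y) = (\<Sum>i\<le>card B. of_rat (f (x ^ i)) * x ^ i)"
      unfolding A_def by (simp add: sum.reindex[OF inj])
    also have "\<dots> = poly (map_poly of_rat p) x"
      by (simp add: p_def rat_poly_hom.hom_sum map_poly_monom poly_sum poly_monom)
    finally have "p = 0" using s none by simp
    obtain i where i: "i \<le> card B" "y = x ^ i" using y by (auto simp: A_def)
    have "coeff p i = f y" using i by (simp add: p_def coeff_sum if_distrib sum.delta cong: if_cong)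
    then show "f y = 0" using \<open>p = 0\<close> by simp
  qed (simp add: A_def)
  then have "card A \<le> card B" using Q.independent_span_bound[OF B(1)] B(2) by blast
  moreover have "card A = Suc (card B)" by (simp add: A_def card_image[OF inj])
  ultimately show False by simp
qed

text \<open>An annihilating polynomial of least degree is coprime to its derivative, and the Bezout
  identity survives the passage to C, where it excludes multiple roots.\<close>

lemma number_field_separable_poly:
  assumes "number_field TYPE('k::field_char_0)"
  shows "\<exists>p. p \<noteq> 0 \<and> poly (map_poly of_rat p) (x :: 'k) = 0 \<and> rsquarefree (map_poly of_rat p :: complex poly)"
proof -
  define p where "p = arg_min degree (\<lambda>p::rat poly. p \<noteq> 0 \<and> poly (map_poly of_rat p) x = 0)"
  have p: "p \<noteq> 0" "poly (map_poly of_rat p) x = 0"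
    using arg_min_natI[of "\<lambda>p. p \<noteq> 0 \<and> poly (map_poly of_rat p) x = 0"]
      number_field_annihilating_poly[OF assms, of x]
    unfolding p_def by blast+
  have min: "degree p \<le> degree q" if "q \<noteq> 0" "poly (map_poly of_rat q) x = 0" for q
    using arg_min_nat_le[of "\<lambda>p. p \<noteq> 0 \<and> poly (map_poly of_rat p) x = 0" _ degree] that
    unfolding p_def by blast
  define g where "g = gcd p (pderiv p)"
  have "degree p \<noteq> 0"
  proof
    assume "degree p = 0"
    then obtain c where "p = [:c:]" by (metis degree_eq_zeroE)
    then show False using p by simp
  qed
  then have p': "pderiv p \<noteq> 0" by (simp add: pderiv_eq_0_iff)
  obtain q where q: "p = g * q" unfolding g_def by (metis dvdE gcd_dvd1)
  have "g \<noteq> 0" "q \<noteq> 0" using p q by auto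
  then have deg: "degree p = degree g + degree q" using q by (simp add: degree_mult_eq)
  \<comment> \<open>The common factor \<open>g\<close> has smaller degree than \<open>p\<close>, so
    it does not vanish at \<open>x\<close>. Hence the cofactor \<open>q\<close> does, and minimality
    of \<open>p\<close> leaves degree 0 for \<open>g\<close>.\<close>
  have "degree g \<le> degree (pderiv p)" unfolding g_def using p' by (intro dvd_imp_degree_le) auto
  also have "\<dots> < degree p" using \<open>degree p \<noteq> 0\<close> by (simp add: degree_pderiv)
  finally have "\<not> poly (map_poly of_rat g) x = 0" using min[of g] \<open>g \<noteq> 0\<close> by auto
  moreover have "poly (map_poly of_rat g) x * poly (map_poly of_rat q) x = 0"
    using p(2) by (simp add: q rat_poly_hom.hom_mult)
  ultimately have "degree p \<le> degree q" using min[of q] \<open>q \<noteq> 0\<close> by simp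
  then have "degree g = 0" using deg by simp
  then have "is_unit g" using \<open>g \<noteq> 0\<close> by (simp add: is_unit_iff_degree)
  then have "g = 1" by (metis g_def is_unit_normalize normalize_gcd)
  then obtain a b where "a * p + b * pderiv p = 1"
    using bezout_coefficients_fst_snd[of p "pderiv p"] unfolding g_def by auto
  then have 1: "map_poly of_rat a * map_poly of_rat p + map_poly of_rat b * map_poly of_rat (pderiv p) = (1 :: complex poly)"
    by (metis rat_poly_hom.hom_add rat_poly_hom.hom_mult rat_poly_hom.hom_one)
  have "rsquarefree (map_poly of_rat p :: complex poly)"
    unfolding rsquarefree_roots
  proof (intro allI notI)
    fix z :: complex
    assume "poly (map_poly of_rat p) z = 0 \<and> poly (pderiv (map_poly of_rat p)) z = 0"
    moreover have "pderiv (map_poly of_rat p) = (map_poly of_rat (pderiv p) :: complex poly)"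
      by (simp add: of_rat_hom.map_poly_pderiv)
    ultimately have "poly (map_poly of_rat a * map_poly of_rat p + map_poly of_rat b * map_poly of_rat (pderiv p)) z = 0"
      by simp
    then show False by (simp add: 1)
  qed
  then show ?thesis using p by blast
qed

text \<open>Lagrange interpolation of the constant 1 on \<open>Z\<close>: both sides have degree
  below \<open>card Z\<close> and agree on \<open>Z\<close>.\<close>

lemma lagrange_sum_eq_1:
  fixes Z :: "complex set"
  assumes "finite Z" "Z \<noteq> {}"
  shows "(\<Sum>a\<in>Z. Polynomial.smult (\<Prod>b\<in>Z - {a}. inverse (a - b)) (\<Prod>b\<in>Z - {a}. [:- b, 1:])) = 1"
    (is "?S = 1")
proof -
  have 1: "poly ?S x = poly 1 x" if x: "x \<in> Z" for x
  proof -
    have "(\<Prod>b\<in>Z - {a}. inverse (a - b)) * (\<Prod>b\<in>Z - {a}. x - b) = (if a = x then 1 else 0)" if "a \<in> Z" for a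
    proof (cases "a = x")
      case True
      have "(\<Prod>b\<in>Z - {a}. inverse (a - b)) * (\<Prod>b\<in>Z - {a}. a - b) = (\<Prod>b\<in>Z - {a}. inverse (a - b) * (a - b))"
        by (rule prod.distrib[symmetric])
      also have "\<dots> = 1" by (intro prod.neutral ballI left_inverse) auto
      finally show ?thesis using True by simp
    next
      case False
      then have "(\<Prod>b\<in>Z - {a}. x - b) = 0" using x assms by (intro prod_zero) auto
      then show ?thesis using False by simp
    qed
    then have "(\<Sum>a\<in>Z. (\<Prod>b\<in>Z - {a}. inverse (a - b)) * (\<Prod>b\<in>Z - {a}. x - b)) = (\<Sum>a\<in>Z. if a = x then 1 else 0)"
      by (intro sum.cong) auto
    then show ?thesis using x assms by (simp add: poly_sum poly_prod)
  qed
  have d: "degree (\<Prod>b\<in>Z - {a}. [:- b, 1:]) = card Z - 1" if "a \<in> Z" for a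
    by (subst degree_prod_eq_sum_degree) (use that assms in auto)
  have c: "card Z - 1 < card Z" using assms by (simp add: card_gt_0_iff)
  have 2: "degree ?S < card Z"
    by (intro degree_sum_less le_less_trans[OF degree_smult_le]) (use c d in auto)
  show ?thesis by (rule poly_eqI_degree[of Z, OF 1 2]) (use c in auto)
qed

interpretation tens_1_hom: comm_ring_hom "tens (1 :: 'k::field_char_0) :: complex \<Rightarrow> _"
  by unfold_locales (simp_all add: tens_add_right tens_1_mult one_tensor_def)

lemma tens_1_eq_0_iff: "tens (1 :: 'k::field_char_0) (z :: complex) = 0 \<longleftrightarrow> z = 0"
proof
  assume "tens (1 :: 'k) z = 0"
  then have "tens (1 :: 'k) (z * inverse z) = 0" by (simp add: tens_1_mult)
  then show "z = 0" by (cases "z = 0") (simp_all add: tens_1_1_neq_0)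
qed simp

text \<open>The Lagrange polynomials of the complex roots of a separable annihilating polynomial,
  evaluated at \<open>tens x 1\<close>, are the projections to the eigenspaces of multiplication by
  \<open>x\<close> on K \<otimes> C.\<close>

lemma eigen_decomposition_one:
  assumes "number_field TYPE('k::field_char_0)"
  shows "\<exists>Z P. finite Z \<and> (\<Sum>a\<in>Z. P a) = 1 \<and> (\<forall>a\<in>Z. tens (x::'k) 1 * P a = tens 1 a * (P a :: ('k, complex) tensor))"
proof -
  obtain p where p: "p \<noteq> 0" "poly (map_poly of_rat p) x = 0" "rsquarefree (map_poly of_rat p :: complex poly)"
    using number_field_separable_poly[OF assms] by blast
  define pc :: "complex poly" where "pc = map_poly of_rat p"
  define Z where "Z = {z. poly pc z = 0}"
  define ev where "ev q = poly (map_poly (tens (1::'k)) q) (tens x 1)" for q :: "complex poly"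
  interpret h: map_poly_comm_ring_hom "tens (1 :: 'k) :: complex \<Rightarrow> _" ..
  have ev_mult: "ev (q * q') = ev q * ev q'" and ev_1: "ev 1 = 1" and ev_sum: "ev (sum f A) = (\<Sum>a\<in>A. ev (f a))" for q q' f and A :: "complex set"
    by (simp_all add: ev_def h.hom_mult h.hom_sum poly_sum)
  have pc0: "pc \<noteq> 0" using p by (simp add: pc_def)
  have fin: "finite Z" using pc0 unfolding Z_def by (rule poly_roots_finite)
  have dec: "pc = smult (lead_coeff pc) (\<Prod>a\<in>Z. [:- a, 1:])"
    using complex_poly_decompose_rsquarefree[of pc] p(3) by (simp add: Z_def pc_def)
  have "ev pc = tens (poly (map_poly of_rat p) x) 1"
  proof -
    have "ev pc = (\<Sum>i\<le>degree p. tens 1 (of_rat (coeff p i)) * tens x 1 ^ i)"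
      by (simp add: ev_def poly_altdef pc_def coeff_map_poly degree_map_poly tens_1_eq_0_iff)
    also have "\<dots> = (\<Sum>i\<le>degree p. tens (of_rat (coeff p i) * x ^ i) 1)"
      by (intro sum.cong) (simp_all add: tens_power tens_times_tens tens_of_rat_left)
    also have "\<dots> = tens (poly (map_poly of_rat p) x) 1"
      by (simp add: poly_altdef tens_sum_left coeff_map_poly)
    finally show ?thesis .
  qed
  then have ev0: "ev pc = 0" using p by simp
  have ev_prod: "ev (\<Prod>a\<in>Z. [:- a, 1:]) = 0"
  proof -
    have "(\<Prod>a\<in>Z. [:- a, 1:]) = [:inverse (lead_coeff pc):] * pc"
      using pc0 by (subst (2) dec) simp
    then show ?thesis by (simp only: ev_mult ev0 mult_zero_right)
  qed
  have "Z \<noteq> {}"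
  proof
    assume "Z = {}"
    then show False using ev_prod ev_1 by simp
  qed
  define q where "q a = smult (\<Prod>b\<in>Z - {a}. inverse (a - b)) (\<Prod>b\<in>Z - {a}. [:- b, 1:])" for a
  define P where "P a = ev (q a)" for a
  have "(\<Sum>a\<in>Z. P a) = 1"
    using lagrange_sum_eq_1[OF fin \<open>Z \<noteq> {}\<close>] by (simp add: P_def q_def ev_1 flip: ev_sum)
  moreover have "tens x 1 * P a = tens 1 a * P a" if "a \<in> Z" for a
  proof -
    \<comment> \<open>The missing linear factor completes \<open>q a\<close>, up to a constant, to
      the product over all roots, which annihilates \<open>tens x 1\<close>.\<close>
    have "[:- a, 1:] * q a = [:\<Prod>b\<in>Z - {a}. inverse (a - b):] * (\<Prod>a\<in>Z. [:- a, 1:])"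
      using that fin by (simp add: q_def prod.remove[of Z a "\<lambda>b. [:- b, 1:]"] mult_smult_right del: mult_pCons_left) (simp only: mult_pCons_left[of _ 0] mult_zero_left pCons_0_0 add_0_right)
    then have "ev [:- a, 1:] * P a = 0" by (simp only: P_def ev_mult[symmetric]) (simp only: ev_mult ev_prod mult_zero_right)
    moreover have "ev [:- a, 1:] = tens x 1 - tens 1 a"
      by (simp add: ev_def tens_uminus_right)
    ultimately show ?thesis by (simp add: algebra_simps)
  qed
  ultimately show ?thesis using fin by blast
qed

section \<open>Complex embeddings and the ring K \<otimes> C\<close>

lemma embeddings_UNIV_iff:
  "\<sigma> \<in> embeddings UNIV \<longleftrightarrow> \<sigma> 1 = 1 \<and> (\<forall>x y. \<sigma> (x + y) = \<sigma> x + \<sigma> y \<and> \<sigma> (x * y) = \<sigma> x * \<sigma> y)"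
  by (simp add: embeddings_def)

lemma embedding_hom:
  assumes "\<sigma> \<in> embeddings UNIV"
  shows "\<sigma> 1 = 1" "\<sigma> (x + y) = \<sigma> x + \<sigma> y" "\<sigma> (x * y) = \<sigma> x * \<sigma> y" "additive \<sigma>" "\<sigma> 0 = 0"
    "\<sigma> (- x) = - \<sigma> x" "\<sigma> (x - y) = \<sigma> x - \<sigma> y" "\<sigma> (sum f A) = (\<Sum>i\<in>A. \<sigma> (f i))"
proof -
  show ad: "additive \<sigma>" using assms by (simp add: additive_def embeddings_UNIV_iff)
  show "\<sigma> 1 = 1" "\<sigma> (x + y) = \<sigma> x + \<sigma> y" "\<sigma> (x * y) = \<sigma> x * \<sigma> y"
    using assms by (simp_all add: embeddings_UNIV_iff)
  show "\<sigma> 0 = 0" "\<sigma> (- x) = - \<sigma> x" "\<sigma> (x - y) = \<sigma> x - \<sigma> y" "\<sigma> (sum f A) = (\<Sum>i\<in>A. \<sigma> (f i))"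
    using additive.zero[OF ad] additive.minus[OF ad] additive.diff[OF ad] additive.sum[OF ad] by simp_all
qed

lemma embedding_eq_0_iff:
  assumes "\<sigma> \<in> embeddings UNIV"
  shows "\<sigma> (x :: 'k::field) = 0 \<longleftrightarrow> x = 0"
proof
  assume "\<sigma> x = 0"
  then have "\<sigma> (x * inverse x) = 0" by (simp add: embedding_hom(3)[OF assms])
  then show "x = 0" using embedding_hom(1)[OF assms] by (cases "x = 0") auto
qed (simp add: embedding_hom[OF assms])

lemma embedding_inj: "\<sigma> \<in> embeddings UNIV \<Longrightarrow> \<sigma> (x :: 'k::field) = \<sigma> y \<longleftrightarrow> x = y"
  using embedding_eq_0_iff[of \<sigma> "x - y"] by (simp add: embedding_hom)

lemma embedding_inverse: "\<sigma> \<in> embeddings UNIV \<Longrightarrow> \<sigma> (inverse (x :: 'k::field)) = inverse (\<sigma> x)"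
proof (cases "x = 0")
  case False
  assume s: "\<sigma> \<in> embeddings UNIV"
  have "\<sigma> x * \<sigma> (inverse x) = 1"
    using False embedding_hom(1)[OF s] by (simp flip: embedding_hom(3)[OF s])
  then show ?thesis by (rule inverse_unique[symmetric])
qed (simp add: embedding_hom)

lemma embedding_of_nat: "\<sigma> \<in> embeddings UNIV \<Longrightarrow> \<sigma> (of_nat n :: 'k::field) = of_nat n"
  by (induction n) (simp_all add: embedding_hom)

lemma additive_rat_linear:
  fixes f :: "'k::field_char_0 \<Rightarrow> 'l::field_char_0"
  assumes "additive f"
  shows "f (of_rat q * x) = of_rat q * f x"
proof -
  interpret additive f by fact
  have nat: "f (of_nat n * x) = of_nat n * f x" for n x
    by (induction n) (simp_all add: zero add algebra_simps)
  have int: "f (of_int n * x) = of_int n * f x" for n x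
    by (cases n rule: int_cases2) (simp_all add: nat minus)
  obtain a b where q: "q = of_int a / of_int b" "b \<noteq> 0"
    by (metis Fract_of_int_quotient Rat_cases less_irrefl)
  have "of_int b * (of_rat q * x) = of_int a * x"
    using q by (simp add: of_rat_divide)
  define y where "y = f (of_rat q * x)"
  have *: "of_int b * y = of_int a * f x"
    unfolding y_def int[symmetric] \<open>of_int b * (of_rat q * x) = of_int a * x\<close> ..
  have "(of_rat q :: 'l) = of_int a / of_int b" using q by (simp add: of_rat_divide)
  moreover have "y = of_int a / of_int b * f x" using q(2) * by (simp add: field_simps)
  ultimately have "y = of_rat q * f x" by simp
  then show ?thesis by (simp only: y_def)
qed

lemma embedding_of_rat: "\<sigma> \<in> embeddings UNIV \<Longrightarrow> \<sigma> (of_rat q :: 'k::field_char_0) = of_rat q"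
  using additive_rat_linear[of \<sigma> q 1] by (simp add: embedding_hom)

lemma conj_emb_embedding: "\<sigma> \<in> embeddings UNIV \<Longrightarrow> conj_emb \<sigma> \<in> embeddings UNIV"
  by (simp add: embeddings_UNIV_iff conj_emb_def)

lemma conj_emb_conj_emb [simp]: "conj_emb (conj_emb \<sigma>) = \<sigma>"
  by (simp add: conj_emb_def fun_eq_iff)

lemma conj_emb_apply: "conj_emb \<sigma> x = cnj (\<sigma> x)"
  by (simp add: conj_emb_def)

text \<open>Used in two ways: for an embedding it is the associated ring homomorphism from K
  \<otimes> C to C, and for an additive map with rational values it is the C-linear extension of a
  functional. The same map serves for E \<otimes> C.\<close>

definition eval_C :: "('k::ab_group_add \<Rightarrow> complex) \<Rightarrow> ('k, complex) tensor \<Rightarrow> complex" where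
  "eval_C f = tensor_lift (\<lambda>k z. f k * z)"

lemma eval_C:
  assumes "additive f"
  shows "eval_C f (tens k z) = f k * z" "additive (eval_C f)" "eval_C f (x + y) = eval_C f x + eval_C f y" "eval_C f 0 = 0"
    "eval_C f (sum g A) = (\<Sum>i\<in>A. eval_C f (g i))" "eval_C f (- x) = - eval_C f x"  "eval_C f (x - y) = eval_C f x - eval_C f y"
proof -
  have b: "biadditive (\<lambda>k z. f k * z)" using assms by (simp add: biadditive_def additive_def algebra_simps)
  show "eval_C f (tens k z) = f k * z" by (simp add: eval_C_def tensor_lift_tens[OF b])
  show ad: "additive (eval_C f)" unfolding eval_C_def by (rule additive_tensor_lift[OF b])
  show "eval_C f (x + y) = eval_C f x + eval_C f y" "eval_C f 0 = 0"
    "eval_C f (sum g A) = (\<Sum>i\<in>A. eval_C f (g i))" "eval_C f (- x) = - eval_C f x"  "eval_C f (x - y) = eval_C f x - eval_C f y"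
    by (rule additive.add[OF ad] additive.zero[OF ad] additive.sum[OF ad] additive.minus[OF ad] additive.diff[OF ad])+
qed

lemma eval_C_scale: 
  fixes f :: "'k::field_char_0 \<Rightarrow> complex"
  assumes "additive f"
  shows "eval_C f (tens 1 c * x) = c * eval_C f x"
  by (induction x) (simp_all add: eval_C[OF assms] tens_times_tens distrib_left)

lemma eval_C_mult:
  fixes \<sigma> :: "'k::field_char_0 \<Rightarrow> complex"
  assumes "\<sigma> \<in> embeddings UNIV"
  shows "eval_C \<sigma> (x * y) = eval_C \<sigma> x * eval_C \<sigma> y" "eval_C \<sigma> 1 = 1"
proof -
  note ev = eval_C[OF embedding_hom(4)[OF assms]]
  show "eval_C \<sigma> 1 = 1" unfolding one_tensor_def ev(1) embedding_hom(1)[OF assms] by simp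
  have *: "eval_C \<sigma> (tens a z * y) = eval_C \<sigma> (tens a z) * eval_C \<sigma> y" for a z
  proof (induction y)
    case (add a' z' y)
    then show ?case
      by (simp only: distrib_left tens_times_tens ev(1,3) embedding_hom(3)[OF assms] mult_ac)
  qed (simp only: ev(4) mult_zero_right)
  show "eval_C \<sigma> (x * y) = eval_C \<sigma> x * eval_C \<sigma> y"
  proof (induction x)
    case (add a z x)
    then show ?case by (simp only: distrib_right ev(3) *)
  qed (simp only: ev(4) mult_zero_left)
qed

lemma tens_1_scale_eq_0: "tens 1 c * x = 0 \<Longrightarrow> x = (0 :: ('k::field_char_0, complex) tensor) \<or> c = 0"
proof -
  assume "tens 1 c * x = 0"
  then have "tens 1 (inverse c * c) * x = 0" by (simp only: tens_1_mult mult.assoc mult_zero_right)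
  then show ?thesis by (cases "c = 0") (simp_all flip: one_tensor_def)
qed

lemma eval_C_cnj:
  assumes "additive f" "additive g" "\<And>k. g k = cnj (f k)"
  shows "eval_C f (tensor_map id cnj y) = cnj (eval_C g y)"
proof (rule tensor_eqI[of "\<lambda>y. eval_C f (tensor_map id cnj y)" "\<lambda>y. cnj (eval_C g y)"])
  show "additive (\<lambda>y. eval_C f (tensor_map id cnj y))"
    by (rule additive_comp[OF eval_C(2)[OF assms(1)] additive_tensor_map[OF additive_id(1) additive_cnj]])
  show "additive (\<lambda>y. cnj (eval_C g y))"
    by (rule additive_comp[OF additive_cnj eval_C(2)[OF assms(2)]])
  show "eval_C f (tensor_map id cnj (tens a b)) = cnj (eval_C g (tens a b))" for a b
    by (simp only: tensor_map_tens[OF additive_id(1) additive_cnj] eval_C(1)[OF assms(1)]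
        eval_C(1)[OF assms(2)] assms(3) id_apply complex_cnj_mult complex_cnj_cnj)
qed

text \<open>The simultaneous eigenspaces of a spanning set decompose the unit of \<open>K \<otimes> \<complex>\<close>; each
  nonzero one is the eigenspace of an embedding.\<close>

lemma idempotents_exist:
  assumes "number_field TYPE('k::field_char_0)"
  shows "finite (embeddings (UNIV :: 'k set))"
    and "\<exists>e :: ('k \<Rightarrow> complex) \<Rightarrow> ('k, complex) tensor. (\<Sum>\<sigma>\<in>embeddings UNIV. e \<sigma>) = 1 \<and>
      (\<forall>\<sigma>\<in>embeddings UNIV. \<forall>k. tens k 1 * e \<sigma> = tens 1 (\<sigma> k) * e \<sigma>)"
proof -
  interpret Q: vector_space "\<lambda>q (x::'k). of_rat q * x" by (rule vector_space_rat)
  obtain B :: "'k set" where B: "finite B" "Q.span B = UNIV"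
    using assms by (auto simp: number_field_def)
  obtain Z P where ZP: "\<And>x. finite (Z x)" "\<And>x. (\<Sum>a\<in>Z x. P x a) = 1"
    "\<And>x a. a \<in> Z x \<Longrightarrow> tens x 1 * P x a = tens 1 a * (P x a :: ('k, complex) tensor)"
    using eigen_decomposition_one[OF assms] by metis
  define F where "F = PiE B Z"
  define E where "E f = (\<Prod>b\<in>B. P b (f b))" for f
  have finF: "finite F" unfolding F_def by (intro finite_PiE B ZP)
  have E1: "(\<Sum>f\<in>F. E f) = 1"
    by (simp add: F_def E_def ZP(2) prod_sum_PiE[OF B(1) ZP(1), of P, symmetric])
  have eig: "\<exists>c. tens k 1 * E f = tens 1 c * E f" if "f \<in> F" for f k
  proof -
    have b: "tens b 1 * E f = tens 1 (f b) * E f" if "b \<in> B" for b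
    proof -
      have "E f = P b (f b) * (\<Prod>b\<in>B - {b}. P b (f b))"
        using B(1) that by (simp add: E_def prod.remove)
      moreover have "f b \<in> Z b" using \<open>f \<in> F\<close> that by (auto simp: F_def)
      ultimately show ?thesis using ZP(3)[of "f b" b] by (simp flip: mult.assoc)
    qed
    have "k \<in> Q.span B" using B by simp
    then obtain q where k: "k = (\<Sum>b\<in>B. of_rat (q b) * b)"
      using Q.span_finite[OF B(1)] by auto
    have "tens k 1 * E f = (\<Sum>b\<in>B. tens 1 (of_rat (q b)) * (tens b 1 * E f))"
      by (simp add: k tens_sum_left sum_distrib_right tens_of_rat_left tens_times_tens flip: mult.assoc)
    also have "\<dots> = tens 1 (\<Sum>b\<in>B. of_rat (q b) * f b) * E f"
      by (simp add: b tens_sum_right sum_distrib_right tens_1_mult mult.assoc)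
    finally show ?thesis by blast
  qed
  define s where "s f k = (SOME c. tens k 1 * E f = tens 1 c * E f)" for f k
  have s: "tens k 1 * E f = tens 1 (s f k) * E f" if "f \<in> F" for f k
    unfolding s_def using eig[OF that] by (rule someI_ex)
  have s_eqI: "s f k = c" if "f \<in> F" "E f \<noteq> 0" "tens k 1 * E f = tens 1 c * E f" for f k c
  proof -
    have "tens 1 (s f k - c) * E f = 0" using s[OF that(1), of k] that(3) by (simp add: tens_diff_right left_diff_distrib)
    then show ?thesis using tens_1_scale_eq_0 that(2) by fastforce
  qed
  have s_emb: "s f \<in> embeddings UNIV" if "f \<in> F" "E f \<noteq> 0" for f
    unfolding embeddings_UNIV_iff
  proof (intro conjI allI)
    show "s f 1 = 1" by (intro s_eqI that) simp
    fix x y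
    show "s f (x + y) = s f x + s f y"
      by (intro s_eqI that) (simp add: tens_add_left tens_add_right distrib_right s[OF that(1)])
    have "tens (x * y) 1 * E f = tens x 1 * (tens y 1 * E f)" by (simp add: tens_times_tens flip: mult.assoc)
    also have "\<dots> = tens 1 (s f y) * (tens x 1 * E f)" unfolding s[OF that(1), of y] by (simp only: mult_ac)
    also have "\<dots> = tens 1 (s f x * s f y) * E f" unfolding s[OF that(1), of x] by (simp only: tens_1_mult mult_ac)
    finally show "s f (x * y) = s f x * s f y" by (intro s_eqI that)
  qed
  \<comment> \<open>Each embedding occurs: it maps the sum of all \<open>E f\<close> to 1, hence
    some \<open>E f\<close> to a nonzero number, and there it must agree with the
    eigenvalues.\<close>
  have emb_s: "\<exists>f\<in>{f\<in>F. E f \<noteq> 0}. \<tau> = s f" if t: "\<tau> \<in> embeddings UNIV" for \<tau>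
  proof -
    note ev = eval_C[OF embedding_hom(4)[OF t]] eval_C_mult[OF t]
    have "(\<Sum>f\<in>F. eval_C \<tau> (E f)) = 1" by (simp add: ev E1 flip: ev(5))
    then obtain f where f: "f \<in> F" "eval_C \<tau> (E f) \<noteq> 0"
      by (metis sum.neutral zero_neq_one)
    have "\<tau> k = s f k" for k
    proof -
      have "eval_C \<tau> (tens k 1 * E f) = eval_C \<tau> (tens 1 (s f k) * E f)" by (simp only: s[OF f(1), of k])
      then have "\<tau> k * eval_C \<tau> (E f) = s f k * eval_C \<tau> (E f)"
        by (simp only: eval_C_mult(1)[OF t] ev(1) embedding_hom(1)[OF t] mult_1_left mult_1_right)
      then show ?thesis using f(2) by simp
    qed
    moreover have "E f \<noteq> 0" using f(2) ev(4) by metis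
    ultimately show ?thesis using f(1) by blast
  qed
  show fin: "finite (embeddings (UNIV :: 'k set))"
    by (rule finite_subset[of _ "s ` F"]) (use emb_s finF in blast)+
  \<comment> \<open>Summing over a fibre of \<open>s\<close> makes it irrelevant whether
    \<open>s\<close> is injective.\<close>
  define e where "e \<sigma> = (\<Sum>f | f \<in> F \<and> E f \<noteq> 0 \<and> s f = \<sigma>. E f)" for \<sigma>
  have "(\<Sum>\<sigma>\<in>embeddings UNIV. e \<sigma>) = (\<Sum>\<sigma>\<in>embeddings UNIV. \<Sum>f | f \<in> {f \<in> F. E f \<noteq> 0} \<and> s f = \<sigma>. E f)"
    unfolding e_def by (intro sum.cong refl) auto
  also have "\<dots> = (\<Sum>f | f \<in> F \<and> E f \<noteq> 0. E f)"
    by (rule sum.group) (use finF fin s_emb in auto)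
  also have "\<dots> = 1" unfolding E1[symmetric] by (rule sum.mono_neutral_left) (auto simp: finF)
  finally have "(\<Sum>\<sigma>\<in>embeddings UNIV. e \<sigma>) = 1" .
  moreover have "tens k 1 * e \<sigma> = tens 1 (\<sigma> k) * e \<sigma>" for \<sigma> k
    unfolding e_def sum_distrib_left 
  proof (rule sum.cong[OF refl])
    fix f assume "f \<in> {f. f \<in> F \<and> E f \<noteq> 0 \<and> s f = \<sigma>}"
    then show "tens k 1 * E f = tens 1 (\<sigma> k) * E f" using s[of f k] by blast
  qed
  ultimately show "\<exists>e :: ('k \<Rightarrow> complex) \<Rightarrow> ('k, complex) tensor. (\<Sum>\<sigma>\<in>embeddings UNIV. e \<sigma>) = 1 \<and>
      (\<forall>\<sigma>\<in>embeddings UNIV. \<forall>k. tens k 1 * e \<sigma> = tens 1 (\<sigma> k) * e \<sigma>)" by blast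
qed

definition idem :: "('k::field_char_0 \<Rightarrow> complex) \<Rightarrow> ('k, complex) tensor" where
  "idem = (SOME e. (\<Sum>\<sigma>\<in>embeddings UNIV. e \<sigma>) = 1 \<and>
      (\<forall>\<sigma>\<in>embeddings UNIV. \<forall>k. tens k 1 * e \<sigma> = tens 1 (\<sigma> k) * e \<sigma>))"

context
  assumes nf: "number_field TYPE('k::field_char_0)"
begin

lemma sum_idem: "(\<Sum>\<sigma>\<in>embeddings UNIV. idem (\<sigma> :: 'k \<Rightarrow> complex)) = 1"
  and tens_idem: "\<sigma> \<in> embeddings UNIV \<Longrightarrow> tens k 1 * idem (\<sigma> :: 'k \<Rightarrow> complex) = tens 1 (\<sigma> k) * idem \<sigma>"
  using someI_ex[OF idempotents_exist(2)[OF nf]] unfolding idem_def[symmetric] by blast+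

lemma mult_idem:
  assumes "\<sigma> \<in> embeddings UNIV"
  shows "y * idem (\<sigma> :: 'k \<Rightarrow> complex) = tens 1 (eval_C \<sigma> y) * idem \<sigma>"
proof (induction y)
  case zero
  then show ?case by (simp add: eval_C[OF embedding_hom(4)[OF assms]])
next
  case (add a z x)
  have "tens a z * idem \<sigma> = tens 1 z * (tens a 1 * idem \<sigma>)" by (simp add: tens_times_tens flip: mult.assoc)
  also have "\<dots> = tens 1 (\<sigma> a * z) * idem \<sigma>" unfolding tens_idem[OF assms] by (simp only: tens_1_mult mult_ac)
  finally show ?case using add
    by (simp only: eval_C[OF embedding_hom(4)[OF assms]] distrib_right tens_add_right)
qed

lemma eval_idem:
  assumes "\<sigma> \<in> embeddings UNIV" "\<tau> \<in> embeddings UNIV"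
  shows "eval_C \<tau> (idem (\<sigma> :: 'k \<Rightarrow> complex)) = (if \<tau> = \<sigma> then 1 else 0)"
proof -
  note ev = eval_C[OF embedding_hom(4)] eval_C_mult
  have 0: "eval_C \<tau> (idem \<sigma>) = 0" if "\<sigma> \<in> embeddings UNIV" and ne: "\<tau> \<noteq> \<sigma>" for \<sigma> :: "'k \<Rightarrow> complex"
  proof -
    obtain k where k: "\<tau> k \<noteq> \<sigma> k" using ne by (auto simp: fun_eq_iff)
    have "eval_C \<tau> (tens k 1 * idem \<sigma>) = eval_C \<tau> (tens 1 (\<sigma> k) * idem \<sigma>)" by (simp add: tens_idem that)
    then show ?thesis using k by (simp add: ev assms(2) embedding_hom[OF assms(2)])
  qed
  have "1 = eval_C \<tau> (\<Sum>\<sigma>\<in>embeddings UNIV. idem \<sigma>)" by (simp add: sum_idem ev assms)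
  also have "\<dots> = (\<Sum>\<sigma>\<in>embeddings UNIV. if \<sigma> = \<tau> then eval_C \<tau> (idem \<tau>) else 0)"
    using 0 by (auto simp: ev assms intro!: sum.cong)
  finally have "eval_C \<tau> (idem \<tau>) = 1" using assms idempotents_exist(1)[OF nf] by simp
  then show ?thesis using 0[OF assms(1)] by auto
qed

lemma idem_mult_idem:
  assumes "\<sigma> \<in> embeddings UNIV" "\<tau> \<in> embeddings UNIV"
  shows "idem (\<sigma> :: 'k \<Rightarrow> complex) * idem \<tau> = (if \<tau> = \<sigma> then idem \<sigma> else 0)"
  using mult_idem[OF assms(2), of "idem \<sigma>"] by (auto simp: eval_idem assms simp flip: one_tensor_def)

lemma expand_idem: "y = (\<Sum>\<sigma>\<in>embeddings UNIV. tens 1 (eval_C \<sigma> y) * idem (\<sigma> :: 'k \<Rightarrow> complex))"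
proof -
  have "y = y * (\<Sum>\<sigma>\<in>embeddings UNIV. idem \<sigma>)" by (simp add: sum_idem)
  also have "\<dots> = (\<Sum>\<sigma>\<in>embeddings UNIV. tens 1 (eval_C \<sigma> y) * idem \<sigma>)"
    by (simp only: sum_distrib_left) (intro sum.cong refl mult_idem)
  finally show ?thesis .
qed

text \<open>K \<otimes> C is the product of copies of C indexed by the embeddings, so identities can
  be checked in each copy. It is applied to E as well.\<close>

lemma tensor_eqI_eval_C: "(\<And>\<sigma> :: 'k \<Rightarrow> complex. \<sigma> \<in> embeddings UNIV \<Longrightarrow> eval_C \<sigma> x = eval_C \<sigma> y) \<Longrightarrow> x = y"
  by (subst expand_idem[of x], subst expand_idem[of y]) simp

text \<open>Evaluation at \<open>\<tau>\<close> after conjugation of the second factor is the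
  conjugate of evaluation at \<open>conj_emb \<tau>\<close>, so conjugation permutes the
  idempotents.\<close>

lemma cnj_idem:
  assumes "\<sigma> \<in> embeddings UNIV"
  shows "tensor_map id cnj (idem (\<sigma> :: 'k \<Rightarrow> complex)) = idem (conj_emb \<sigma>)"
proof (rule tensor_eqI_eval_C)
  fix \<tau> :: "'k \<Rightarrow> complex" assume t: "\<tau> \<in> embeddings UNIV"
  note ct = conj_emb_embedding[OF t]
  have "eval_C \<tau> (tensor_map id cnj y) = cnj (eval_C (conj_emb \<tau>) y)" for y :: "('k, complex) tensor"
    by (intro eval_C_cnj embedding_hom t ct conj_emb_apply)
  then have "eval_C \<tau> (tensor_map id cnj (idem \<sigma>)) = (if conj_emb \<tau> = \<sigma> then 1 else 0)"
    by (simp add: eval_idem assms ct)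
  moreover have "conj_emb \<tau> = \<sigma> \<longleftrightarrow> \<tau> = conj_emb \<sigma>" by auto
  ultimately show "eval_C \<tau> (tensor_map id cnj (idem \<sigma>)) = eval_C \<tau> (idem (conj_emb \<sigma>))"
    by (simp add: eval_idem assms t conj_emb_embedding)
qed

lemma embeddings_nonempty: "embeddings (UNIV :: 'k set) \<noteq> {}"
  using sum_idem by auto

end

text \<open>The coordinates belong to an extension of \<open>B\<close> to a basis of the whole
  space. This makes them additive everywhere and not only on the span of \<open>B\<close>, as the
  maps induced on tensor products require.\<close>

lemma (in vector_space) coordinates_exist:
  assumes "independent B" "finite B"
  obtains l where "\<And>b. additive (l b)" "\<And>b a x. l b (scale a x) = a * l b x"
    "\<And>b b'. b' \<in> B \<Longrightarrow> l b b' = (if b' = b then 1 else 0)"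
    "\<And>x. x \<in> span B \<Longrightarrow> x = (\<Sum>b\<in>B. scale (l b x) b)"
proof
  define B' where "B' = extend_basis B"
  have B': "B \<subseteq> B'" "independent B'" "span B' = UNIV"
    using assms(1) by (simp_all add: B'_def extend_basis_superset independent_extend_basis span_extend_basis)
  let ?l = "\<lambda>b x. representation B' x b"
  show "additive (?l b)" for b by (simp add: additive_def representation_add[OF B'(2)] B'(3))
  show "?l b (scale a x) = a * ?l b x" for a b x by (simp add: representation_scale[OF B'(2)] B'(3))
  show "?l b b' = (if b' = b then 1 else 0)" if "b' \<in> B" for b b'
    using that B' representation_basis[OF B'(2), of b'] by auto
  show "x = (\<Sum>b\<in>B. scale (?l b x) b)" if "x \<in> span B" for x
  proof -
    have "?l b x = representation B x b" for b
      using representation_extend[OF B'(2) that B'(1)] by simp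
    then show ?thesis
      by (simp add: sum_representation_eq[OF assms(1) that assms(2) subset_refl])
  qed
qed

lemma (in vector_space) subspace_coordinates_exist:
  assumes "subspace V" "finite S" "V \<subseteq> span S"
  obtains B l where "finite B" "card B = dim V" "B \<subseteq> V" "\<And>b. additive (l b)" "\<And>b a x. l b (scale a x) = a * l b x"
    "\<And>b b'. b' \<in> B \<Longrightarrow> l b b' = (if b' = b then 1 else 0)"
    "\<And>x. x \<in> V \<Longrightarrow> x = (\<Sum>b\<in>B. scale (l b x) b)"
proof -
  obtain B where B: "B \<subseteq> V" "independent B" "V \<subseteq> span B" "card B = dim V"
    using basis_exists[of V] by metis
  have "finite B" using independent_span_bound[OF assms(2) B(2)] B(1) assms(3) by blast
  obtain l where l: "\<And>b. additive (l b)" "\<And>b a x. l b (scale a x) = a * l b x"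
    "\<And>b b'. b' \<in> B \<Longrightarrow> l b b' = (if b' = b then 1 else 0)"
    "\<And>x. x \<in> span B \<Longrightarrow> x = (\<Sum>b\<in>B. scale (l b x) b)"
    by (rule coordinates_exist[OF B(2) \<open>finite B\<close>]) (rule that)
  show ?thesis by (rule that[OF \<open>finite B\<close> B(4) B(1) l(1-3)]) (use l(4) B(3) in blast)+
qed

section \<open>Subfields of a number field\<close>

lemma is_subfield:
  assumes "is_subfield F"
  shows "0 \<in> F" "1 \<in> F" "x \<in> F \<Longrightarrow> y \<in> F \<Longrightarrow> x + y \<in> F" "x \<in> F \<Longrightarrow> y \<in> F \<Longrightarrow> x * y \<in> F"
    "x \<in> F \<Longrightarrow> - x \<in> F" "x \<in> F \<Longrightarrow> inverse x \<in> F" "x \<in> F \<Longrightarrow> y \<in> F \<Longrightarrow> x - y \<in> F" "x \<in> F \<Longrightarrow> y \<in> F \<Longrightarrow> x / y \<in> F"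
    "(\<And>i. i \<in> A \<Longrightarrow> f i \<in> F) \<Longrightarrow> sum f A \<in> F"
proof -
  show c: "0 \<in> F" "1 \<in> F" "x \<in> F \<Longrightarrow> y \<in> F \<Longrightarrow> x + y \<in> F" "x \<in> F \<Longrightarrow> y \<in> F \<Longrightarrow> x * y \<in> F"
    "x \<in> F \<Longrightarrow> - x \<in> F" "x \<in> F \<Longrightarrow> inverse x \<in> F" for x y
    using assms unfolding is_subfield_def by blast+
  show "x \<in> F \<Longrightarrow> y \<in> F \<Longrightarrow> x - y \<in> F" using c(3)[of x "- y"] c(5)[of y] by simp
  show "x \<in> F \<Longrightarrow> y \<in> F \<Longrightarrow> x / y \<in> F" using c(4)[of x "inverse y"] c(6)[of y] by (simp add: divide_inverse)
  show "(\<And>i. i \<in> A \<Longrightarrow> f i \<in> F) \<Longrightarrow> sum f A \<in> F"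
    by (induction A rule: infinite_finite_induct) (use c in auto)
qed

lemma subfield_UNIV: "is_subfield UNIV"
  by (simp add: is_subfield_def)

lemma of_rat_in_subfield:
  assumes "is_subfield (F :: 'k::field_char_0 set)"
  shows "of_rat q \<in> F"
proof -
  have nat: "of_nat n \<in> F" for n by (induction n) (simp_all add: is_subfield[OF assms])
  have int: "of_int n \<in> F" for n by (cases n rule: int_cases2) (simp_all add: nat is_subfield[OF assms])
  obtain a b where "q = of_int a / of_int b" "b \<noteq> 0"
    by (metis Fract_of_int_quotient Rat_cases less_irrefl)
  then show ?thesis using is_subfield(8)[OF assms int int] by (simp add: of_rat_divide)
qed

text \<open>A spanning set of least size over \<open>F\<close> has unique coefficients. Some finite
  spanning set exists because a rational basis of \<open>L\<close> also spans over
  \<open>F\<close>.\<close>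

lemma field_basis_exists:
  assumes nf: "number_field TYPE('k::field_char_0)" and F: "is_subfield (F :: 'k set)" and L: "is_subfield L" "F \<subseteq> L"
  shows "\<exists>B. field_basis F L B"
proof -
  interpret Q: vector_space "\<lambda>q (x::'k). of_rat q * x" by (rule vector_space_rat)
  define spans where "spans B \<longleftrightarrow> finite B \<and> B \<subseteq> L \<and> (\<forall>x\<in>L. \<exists>c\<in>B \<rightarrow>\<^sub>E F. x = (\<Sum>b\<in>B. c b * b))" for B
  obtain S :: "'k set" where S: "finite S" "Q.span S = UNIV"
    using nf by (auto simp: number_field_def)
  have sub: "Q.subspace L"
    unfolding Q.subspace_def
    by (intro conjI ballI allI is_subfield(1,3,4)[OF L(1)] of_rat_in_subfield[OF L(1)])
  have span: "L \<subseteq> Q.span S" by (simp add: S(2))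
  obtain B l where B: "finite B" "card B = Q.dim L" "B \<subseteq> L" "\<And>b. additive (l b)"
    "\<And>b a x. l b (of_rat a * x) = a * l b x" "\<And>b b'. b' \<in> B \<Longrightarrow> l b b' = (if b' = b then 1 else 0)"
    "\<And>x. x \<in> L \<Longrightarrow> x = (\<Sum>b\<in>B. of_rat (l b x) * b)"
    by (rule Q.subspace_coordinates_exist[OF sub S(1) span]) (rule that)
  have "spans B"
    unfolding spans_def
  proof (intro conjI B(1,3) ballI)
    fix x assume "x \<in> L"
    then have "x = (\<Sum>b\<in>B. (\<lambda>b\<in>B. of_rat (l b x)) b * b)" by (rule trans[OF B(7)]) simp
    then show "\<exists>c\<in>B \<rightarrow>\<^sub>E F. x = (\<Sum>b\<in>B. c b * b)"
      by (intro bexI[of _ "\<lambda>b\<in>B. of_rat (l b x)"]) (auto intro: of_rat_in_subfield[OF F])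
  qed
  define B where "B = arg_min card spans"
  have B: "spans B" and min: "\<And>B'. spans B' \<Longrightarrow> card B \<le> card B'"
    using arg_min_natI[of spans, OF \<open>spans _\<close>] arg_min_nat_le[of spans _ card] unfolding B_def by blast+
  then have fin: "finite B" and "B \<subseteq> L" by (auto simp: spans_def)
  have "c = c'" if c: "c \<in> B \<rightarrow>\<^sub>E F" "c' \<in> B \<rightarrow>\<^sub>E F" and eq: "(\<Sum>b\<in>B. c b * b) = (\<Sum>b\<in>B. c' b * b)" for c c'
  proof (rule ccontr)
    assume "c \<noteq> c'"
    then obtain b0 where b0: "b0 \<in> B" "c b0 \<noteq> c' b0" using c PiE_ext by metis
    define d where "d b = (c b - c' b) / (c' b0 - c b0)" for b
    have cF: "c b \<in> F" "c' b \<in> F" if "b \<in> B" for b using c that by auto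
    have dF: "d b \<in> F" if "b \<in> B" for b
      unfolding d_def by (intro is_subfield(7,8)[OF F] cF that b0)
    have "(\<Sum>b\<in>B. (c b - c' b) * b) = 0" using eq by (simp add: left_diff_distrib sum_subtractf)
    then have "(\<Sum>b\<in>B - {b0}. (c b - c' b) * b) = (c' b0 - c b0) * b0"
      using b0 fin by (simp add: sum.remove algebra_simps)
    then have b0_eq: "b0 = (\<Sum>b\<in>B - {b0}. d b * b)"
      using b0 by (simp add: d_def field_simps flip: sum_divide_distrib)
    have "spans (B - {b0})"
      unfolding spans_def
    proof (intro conjI ballI)
      fix x assume "x \<in> L"
      then obtain a where a: "a \<in> B \<rightarrow>\<^sub>E F" "x = (\<Sum>b\<in>B. a b * b)" using B by (auto simp: spans_def)
      let ?a = "\<lambda>b\<in>B - {b0}. a b + a b0 * d b"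
      have "x = a b0 * (\<Sum>b\<in>B - {b0}. d b * b) + (\<Sum>b\<in>B - {b0}. a b * b)"
        using a(2) b0 fin by (simp add: sum.remove flip: b0_eq)
      also have "\<dots> = (\<Sum>b\<in>B - {b0}. ?a b * b)" by (simp add: sum_distrib_left algebra_simps sum.distrib)
      finally show "\<exists>c\<in>B - {b0} \<rightarrow>\<^sub>E F. x = (\<Sum>b\<in>B - {b0}. c b * b)"
        using a(1) b0 dF by (intro bexI[of _ ?a]) (auto intro!: is_subfield(3,4)[OF F])
    qed (use fin \<open>B \<subseteq> L\<close> in auto)
    from min[OF this] show False using card_Diff1_less[OF fin b0(1)] by simp
  qed
  note unique = this
  have "field_basis F L B"
    unfolding field_basis_def
  proof (intro conjI fin \<open>B \<subseteq> L\<close> ballI)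
    fix x assume "x \<in> L"
    then obtain c where "c \<in> B \<rightarrow>\<^sub>E F \<and> x = (\<Sum>b\<in>B. c b * b)" using B by (auto simp: spans_def)
    then show "\<exists>!c. c \<in> B \<rightarrow>\<^sub>E F \<and> x = (\<Sum>b\<in>B. c b * b)"
      by (intro ex1I[of _ c]) (auto intro: unique)
  qed
  then show ?thesis ..
qed

lemma field_basis_coordinates:
  assumes F: "is_subfield F" and L: "is_subfield L" "F \<subseteq> L" and B: "field_basis F L B"
  obtains l where "\<And>b x. x \<in> L \<Longrightarrow> b \<in> B \<Longrightarrow> l b x \<in> F" "\<And>x. x \<in> L \<Longrightarrow> x = (\<Sum>b\<in>B. l b x * b)"
    "\<And>b x y. x \<in> L \<Longrightarrow> y \<in> L \<Longrightarrow> b \<in> B \<Longrightarrow> l b (x + y) = l b x + l b y"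
    "\<And>b a x. x \<in> L \<Longrightarrow> a \<in> F \<Longrightarrow> b \<in> B \<Longrightarrow> l b (a * x) = a * l b x"
    "\<And>b b'. b \<in> B \<Longrightarrow> b' \<in> B \<Longrightarrow> l b b' = (if b' = b then 1 else 0)"
proof
  define c where "c x = (THE c. c \<in> B \<rightarrow>\<^sub>E F \<and> x = (\<Sum>b\<in>B. c b * b))" for x
  have B': "B \<subseteq> L" "finite B" using B by (auto simp: field_basis_def)
  have c: "c x \<in> B \<rightarrow>\<^sub>E F" "x = (\<Sum>b\<in>B. c x b * b)" if "x \<in> L" for x
    using theI'[of "\<lambda>c. c \<in> B \<rightarrow>\<^sub>E F \<and> x = (\<Sum>b\<in>B. c b * b)"] B that
    unfolding c_def field_basis_def by blast+
  have eqI: "c x b = c' b" if "x \<in> L" "\<And>b. b \<in> B \<Longrightarrow> c' b \<in> F" "x = (\<Sum>b\<in>B. c' b * b)" "b \<in> B" for x c' b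
  proof -
    have "c x = restrict c' B"
      unfolding c_def using B that(1-3) unfolding field_basis_def by (intro the1_equality) auto
    then show ?thesis using that(4) by simp
  qed
  show F': "c x b \<in> F" if "x \<in> L" "b \<in> B" for b x using c(1)[OF that(1)] that(2) by auto
  show "x = (\<Sum>b\<in>B. c x b * b)" if "x \<in> L" for x using c(2)[OF that] .
  show "c (x + y) b = c x b + c y b" if "x \<in> L" "y \<in> L" "b \<in> B" for b x y
    using that c(2)[of x] c(2)[of y]
    by (intro eqI is_subfield(3)[OF F] is_subfield(3)[OF L(1)] F') (simp_all add: distrib_right sum.distrib)
  show "c (a * x) b = a * c x b" if "x \<in> L" "a \<in> F" "b \<in> B" for b a x
    using that c(2)[of x] L(2)
    by (intro eqI is_subfield(4)[OF F] is_subfield(4)[OF L(1)] F') (auto simp: mult.assoc simp flip: sum_distrib_left)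
  show "c b' b = (if b' = b then 1 else 0)" if "b \<in> B" "b' \<in> B" for b b'
    using that B' by (intro eqI) (auto simp: is_subfield[OF F] if_distrib[of "\<lambda>x. x * _"] cong: if_cong)
qed

lemma embeddings_hom_on:
  assumes "\<rho> \<in> embeddings F"
  shows "\<rho> 1 = 1" "x \<in> F \<Longrightarrow> y \<in> F \<Longrightarrow> \<rho> (x + y) = \<rho> x + \<rho> y" "x \<in> F \<Longrightarrow> y \<in> F \<Longrightarrow> \<rho> (x * y) = \<rho> x * \<rho> y"
  using assms by (auto simp: embeddings_def)

lemma restrict_embedding: "\<sigma> \<in> embeddings UNIV \<Longrightarrow> is_subfield F \<Longrightarrow> restrict \<sigma> F \<in> embeddings F"
  by (simp add: embeddings_def is_subfield(2,3,4))

context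
  assumes nf: "number_field TYPE('k::field_char_0)"
begin

text \<open>Some coordinate of 1 over \<open>L\<close> is nonzero; divided by its value at 1 it
  becomes an \<open>L\<close>-linear retraction onto \<open>L\<close>. Composition with it turns an
  embedding of \<open>L\<close>, which is defined only there, into a functional on all of K.\<close>

lemma subfield_projection_exists:
  assumes "is_subfield (L :: 'k set)"
  obtains p where "additive p" "\<And>x. p x \<in> L" "\<And>a x. a \<in> L \<Longrightarrow> p (a * x) = a * p x" "p 1 = 1"
proof -
  obtain B where B: "field_basis L UNIV B"
    using field_basis_exists[OF nf assms subfield_UNIV subset_UNIV] by blast
  obtain l where l0: "\<And>b x. x \<in> UNIV \<Longrightarrow> b \<in> B \<Longrightarrow> l b x \<in> L" "\<And>x. x \<in> UNIV \<Longrightarrow> x = (\<Sum>b\<in>B. l b x * b)"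
    "\<And>b x y. x \<in> UNIV \<Longrightarrow> y \<in> UNIV \<Longrightarrow> b \<in> B \<Longrightarrow> l b (x + y) = l b x + l b y"
    "\<And>b a x. x \<in> UNIV \<Longrightarrow> a \<in> L \<Longrightarrow> b \<in> B \<Longrightarrow> l b (a * x) = a * l b x"
    by (rule field_basis_coordinates[OF assms subfield_UNIV subset_UNIV B]) (rule that)
  note l = l0[OF UNIV_I] l0(3)[OF UNIV_I UNIV_I]
  have "\<exists>b\<in>B. l b 1 \<noteq> 0"
  proof (rule ccontr)
    assume "\<not> ?thesis"
    then have "(\<Sum>b\<in>B. l b 1 * b) = 0" by (intro sum.neutral) auto
    then show False using l(2)[of 1] by (simp only: zero_neq_one[symmetric])
  qed
  then obtain b where b: "b \<in> B" "l b 1 \<noteq> 0" by blast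
  show ?thesis
    by (rule that[of "\<lambda>x. l b x / l b 1"])
      (use b in \<open>simp_all add: additive_def add_divide_distrib is_subfield(8)[OF assms] l(1) l(4) l(5)\<close>)
qed

text \<open>Multiplication by \<open>a\<close> in \<open>F\<close> scales the value both by
  \<open>\<rho> a\<close> and by \<open>\<sigma> a\<close>, and some \<open>a\<close> separates the
  two.\<close>

lemma eval_C_idem_semilinear:
  assumes "is_subfield F" "\<rho> \<in> embeddings F" "additive g" "\<And>a x. a \<in> F \<Longrightarrow> g (a * x) = \<rho> a * g x"
    and s: "\<sigma> \<in> embeddings UNIV" "restrict \<sigma> F \<noteq> \<rho>"
  shows "eval_C g (idem (\<sigma> :: 'k \<Rightarrow> complex)) = 0"
proof -
  have "\<rho> \<in> extensional F" using assms(2) by (simp add: embeddings_def)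
  then obtain a where a: "a \<in> F" "\<sigma> a \<noteq> \<rho> a"
    using s(2) by (metis extensionalityI restrict_apply' restrict_extensional)
  have "eval_C g (tens a 1 * y) = \<rho> a * eval_C g y" for y
    by (induction y) (simp_all add: eval_C[OF assms(3)] tens_times_tens distrib_left assms(4)[OF a(1)])
  then have "\<rho> a * eval_C g (idem \<sigma>) = \<sigma> a * eval_C g (idem \<sigma>)"
    by (metis tens_idem[OF nf s(1)] eval_C_scale[OF assms(3)])
  then show ?thesis using a(2) by simp
qed

lemma embedding_proj:
  assumes "is_subfield L" "\<rho> \<in> embeddings L"
    and p: "additive p" "\<And>x. p x \<in> L" "\<And>a x. a \<in> L \<Longrightarrow> p (a * x) = a * p x"
  shows "additive (\<lambda>k. \<rho> (p k))" "\<And>a x. a \<in> L \<Longrightarrow> \<rho> (p (a * x)) = \<rho> a * \<rho> (p x)"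
  using p(2) by (simp_all add: additive_def additive.add[OF p(1)] p(3) embeddings_hom_on(2,3)[OF assms(2)])

text \<open>Apply the functional \<rho> after \<open>p\<close> to the decomposition of 1 into
  idempotents: only the extensions of \<rho> contribute. The value 1 shows that extensions exist,
  and it is the unit with which they are counted in \<open>card_extensions\<close>.\<close>

lemma sum_extensions_proj:
  assumes "is_subfield L" "\<rho> \<in> embeddings L"
    and p: "additive p" "\<And>x. p x \<in> L" "\<And>a x. a \<in> L \<Longrightarrow> p (a * x) = a * p x" "p 1 = 1"
  shows "(\<Sum>\<sigma> | \<sigma> \<in> embeddings UNIV \<and> restrict \<sigma> L = \<rho>. eval_C (\<lambda>k. \<rho> (p k)) (idem (\<sigma> :: 'k \<Rightarrow> complex))) = 1"
proof -
  note g = embedding_proj[OF assms(1,2) p(1-3)]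
  have "(\<Sum>\<sigma> | \<sigma> \<in> embeddings UNIV \<and> restrict \<sigma> L = \<rho>. eval_C (\<lambda>k. \<rho> (p k)) (idem \<sigma>))
      = (\<Sum>\<sigma>\<in>embeddings UNIV. eval_C (\<lambda>k. \<rho> (p k)) (idem \<sigma>))"
  proof (rule sum.mono_neutral_left[OF idempotents_exist(1)[OF nf]])
    show "\<forall>\<sigma>\<in>embeddings UNIV - {\<sigma> \<in> embeddings UNIV. restrict \<sigma> L = \<rho>}. eval_C (\<lambda>k. \<rho> (p k)) (idem \<sigma>) = 0"
      using eval_C_idem_semilinear[OF assms(1,2) g] by blast
  qed blast
  also have "\<dots> = eval_C (\<lambda>k. \<rho> (p k)) (\<Sum>\<sigma>\<in>embeddings UNIV. idem \<sigma>)"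
    by (simp only: eval_C(5)[OF g(1)])
  also have "\<dots> = eval_C (\<lambda>k. \<rho> (p k)) (tens 1 1)"
    by (simp only: sum_idem[OF nf] one_tensor_def)
  also have "\<dots> = \<rho> (p 1)"
    by (simp only: eval_C(1)[OF g(1)] mult_1_right)
  finally show ?thesis using p(4) embeddings_hom_on(1)[OF assms(2)] by simp
qed

lemma embedding_extends:
  assumes "is_subfield (L :: 'k set)" "\<rho> \<in> embeddings L"
  obtains \<sigma> where "\<sigma> \<in> embeddings UNIV" "restrict \<sigma> L = \<rho>"
proof -
  obtain p where p: "additive p" "\<And>x. p x \<in> L" "\<And>a x. a \<in> L \<Longrightarrow> p (a * x) = a * p x" "p 1 = 1"
    using subfield_projection_exists[OF assms(1)] by blast
  have "{\<sigma>. \<sigma> \<in> embeddings UNIV \<and> restrict \<sigma> L = \<rho>} \<noteq> {}"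
    using sum_extensions_proj[OF assms p] by (metis sum.empty zero_neq_one)
  then show ?thesis using that by blast
qed

lemma embeddings_subfield_eq: "is_subfield (L :: 'k set) \<Longrightarrow> embeddings L = (\<lambda>\<sigma>. restrict \<sigma> L) ` embeddings UNIV"
  using embedding_extends restrict_embedding by blast

lemma finite_embeddings: "is_subfield (L :: 'k set) \<Longrightarrow> finite (embeddings L)"
  by (simp add: embeddings_subfield_eq idempotents_exist(1)[OF nf])

text \<open>One double sum is evaluated twice, over \<open>b\<close> in \<open>B\<close> and over
  the embeddings \<sigma> of K above \<rho>, with terms \<open>\<sigma> b\<close> times the
  \<open>b\<close>-th coordinate functional at \<open>idem \<sigma>\<close>. For fixed
  \<open>b\<close> the sum over \<sigma> is 1. For fixed \<sigma> the sum over \<open>b\<close>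
  reconstructs \<sigma> on \<open>L\<close>, and the embeddings with the same restriction to
  \<open>L\<close> contribute 1 in total.\<close>

lemma card_extensions:
  assumes F: "is_subfield (F :: 'k set)" and L: "is_subfield L" "F \<subseteq> L" and B: "field_basis F L B" and rho: "\<rho> \<in> embeddings F"
  shows "card {\<tau> \<in> embeddings L. restrict \<tau> F = \<rho>} = card B"
proof -
  obtain p where p: "additive p" "\<And>x. p x \<in> L" "\<And>a x. a \<in> L \<Longrightarrow> p (a * x) = a * p x" "p 1 = 1"
    using subfield_projection_exists[OF L(1)] by blast
  obtain l where l: "\<And>b x. x \<in> L \<Longrightarrow> b \<in> B \<Longrightarrow> l b x \<in> F" "\<And>x. x \<in> L \<Longrightarrow> x = (\<Sum>b\<in>B. l b x * b)"
    "\<And>b x y. x \<in> L \<Longrightarrow> y \<in> L \<Longrightarrow> b \<in> B \<Longrightarrow> l b (x + y) = l b x + l b y"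
    "\<And>b a x. x \<in> L \<Longrightarrow> a \<in> F \<Longrightarrow> b \<in> B \<Longrightarrow> l b (a * x) = a * l b x"
    "\<And>b b'. b \<in> B \<Longrightarrow> b' \<in> B \<Longrightarrow> l b b' = (if b' = b then 1 else 0)"
    by (rule field_basis_coordinates[OF F L B]) (rule that)
  have B': "B \<subseteq> L" "finite B" using B by (auto simp: field_basis_def)
  note finE = idempotents_exist(1)[OF nf]
  define g where "g b k = \<rho> (l b (p k))" for b k
  have g: "additive (g b)" "\<And>a x. a \<in> F \<Longrightarrow> g b (a * x) = \<rho> a * g b x" if "b \<in> B" for b
    using that L(2) embeddings_hom_on[OF rho] l(1,3,4) p
    by (auto simp: g_def additive_def subset_iff)
  have pb: "p b = b" if "b \<in> L" for b using p(3)[OF that, of 1] p(4) by simp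
  have gb: "(\<Sum>\<sigma>\<in>embeddings UNIV. \<sigma> b * eval_C (g b) (idem \<sigma>)) = 1" if b: "b \<in> B" for b
  proof -
    note ev = eval_C[OF g(1)[OF b]]
    have "(\<Sum>\<sigma>\<in>embeddings UNIV. \<sigma> b * eval_C (g b) (idem \<sigma>))
        = (\<Sum>\<sigma>\<in>embeddings UNIV. eval_C (g b) (tens b 1 * idem \<sigma>))"
      by (intro sum.cong refl) (simp only: tens_idem[OF nf] eval_C_scale[OF g(1)[OF b]])
    also have "\<dots> = eval_C (g b) (tens b 1 * (\<Sum>\<sigma>\<in>embeddings UNIV. idem \<sigma>))"
      by (simp only: ev(5) sum_distrib_left)
    also have "\<dots> = g b b" by (simp add: sum_idem[OF nf] ev(1))
    finally show ?thesis using b B' by (simp add: g_def pb subset_iff l(5) embeddings_hom_on(1)[OF rho])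
  qed
  let ?E = "{\<sigma> \<in> embeddings UNIV. restrict \<sigma> F = \<rho>}"
  let ?T = "{\<tau> \<in> embeddings L. restrict \<tau> F = \<rho>}"
  have "of_nat (card B) = (\<Sum>b\<in>B. \<Sum>\<sigma>\<in>embeddings UNIV. \<sigma> b * eval_C (g b) (idem \<sigma>))"
    by (simp add: gb)
  also have "\<dots> = (\<Sum>b\<in>B. \<Sum>\<sigma>\<in>?E. \<sigma> b * eval_C (g b) (idem \<sigma>))"
    using eval_C_idem_semilinear[OF F rho g]
    by (intro sum.cong refl sum.mono_neutral_right finE) auto
  also have "\<dots> = (\<Sum>\<sigma>\<in>?E. \<Sum>b\<in>B. \<sigma> b * eval_C (g b) (idem \<sigma>))"
    by (rule sum.swap)
  also have "\<dots> = (\<Sum>\<sigma>\<in>?E. eval_C (\<lambda>k. restrict \<sigma> L (p k)) (idem \<sigma>))"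
  proof (rule sum.cong[OF refl])
    fix \<sigma> assume s: "\<sigma> \<in> ?E"
    then have s': "\<sigma> \<in> embeddings UNIV" and sF: "\<And>a. a \<in> F \<Longrightarrow> \<sigma> a = \<rho> a" by auto
    have add: "additive (\<lambda>k. restrict \<sigma> L (p k))"
      by (rule embedding_proj(1)[OF L(1) restrict_embedding[OF s' L(1)] p(1-3)])
    have "(\<Sum>b\<in>B. \<sigma> b * eval_C (g b) y) = eval_C (\<lambda>k. restrict \<sigma> L (p k)) y" for y
    proof (rule tensor_eqI[of "\<lambda>y. \<Sum>b\<in>B. \<sigma> b * eval_C (g b) y"])
      show "additive (\<lambda>y. \<Sum>b\<in>B. \<sigma> b * eval_C (g b) y)"
        by (intro additive_sum_fun additive.intro) (simp add: eval_C[OF g(1)] distrib_left)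
      show "additive (eval_C (\<lambda>k. restrict \<sigma> L (p k)))" by (rule eval_C(2)[OF add])
      fix k z
      have "\<sigma> (p k) = (\<Sum>b\<in>B. \<sigma> (l b (p k)) * \<sigma> b)"
        by (subst l(2)[OF p(2)[of k]]) (simp only: embedding_hom(8,3)[OF s'])
      also have "\<dots> = (\<Sum>b\<in>B. g b k * \<sigma> b)"
        unfolding g_def by (intro sum.cong refl) (simp only: sF[OF l(1)[OF p(2)]])
      finally have "\<sigma> (p k) = (\<Sum>b\<in>B. g b k * \<sigma> b)" .
      moreover have "eval_C (\<lambda>k. restrict \<sigma> L (p k)) (tens k z) = \<sigma> (p k) * z"
        unfolding eval_C(1)[OF add] using p(2) by simp
      moreover have "(\<Sum>b\<in>B. \<sigma> b * eval_C (g b) (tens k z)) = (\<Sum>b\<in>B. g b k * \<sigma> b) * z"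
        unfolding sum_distrib_right
        by (intro sum.cong refl) (simp add: eval_C(1)[OF g(1)] mult_ac)
      ultimately show "(\<Sum>b\<in>B. \<sigma> b * eval_C (g b) (tens k z)) = eval_C (\<lambda>k. restrict \<sigma> L (p k)) (tens k z)"
        by simp
    qed
    then show "(\<Sum>b\<in>B. \<sigma> b * eval_C (g b) (idem \<sigma>)) = eval_C (\<lambda>k. restrict \<sigma> L (p k)) (idem \<sigma>)" .
  qed
  also have "\<dots> = (\<Sum>\<tau>\<in>?T. \<Sum>\<sigma> | \<sigma> \<in> ?E \<and> restrict \<sigma> L = \<tau>. eval_C (\<lambda>k. restrict \<sigma> L (p k)) (idem \<sigma>))"
    by (rule sum.group[symmetric])
      (use finE finite_embeddings[OF L(1)] L in \<open>auto simp: restrict_embedding Int_absorb1\<close>)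
  also have "\<dots> = (\<Sum>\<tau>\<in>?T. \<Sum>\<sigma> | \<sigma> \<in> embeddings UNIV \<and> restrict \<sigma> L = \<tau>. eval_C (\<lambda>k. \<tau> (p k)) (idem \<sigma>))"
    by (intro sum.cong refl) (use L(2) in \<open>auto simp: Int_absorb1\<close>)
  also have "\<dots> = (\<Sum>\<tau>\<in>?T. 1)"
    by (intro sum.cong refl sum_extensions_proj L p) auto
  finally have "of_nat (card B) = (of_nat (card ?T) :: complex)" by simp
  then show ?thesis by (simp only: of_nat_eq_iff)
qed

text \<open>The number of extensions of one fixed embedding does not mention a basis, so all bases
  have the same size and the definite description is meaningful.\<close>

lemma field_degree_eq_card:
  assumes "is_subfield (F :: 'k set)" "is_subfield L" "F \<subseteq> L" "field_basis F L B"
  shows "field_degree F L = card B"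
proof -
  obtain \<sigma> :: "'k \<Rightarrow> complex" where "\<sigma> \<in> embeddings UNIV" using embeddings_nonempty[OF nf] by blast
  note r = restrict_embedding[OF this assms(1)]
  show ?thesis
    unfolding field_degree_def
  proof (rule the_equality)
    show "\<exists>B'. field_basis F L B' \<and> card B' = card B" using assms(4) by blast
    fix n assume "\<exists>B'. field_basis F L B' \<and> card B' = n"
    then obtain B' where "field_basis F L B'" "card B' = n" by blast
    then show "n = card B"
      using card_extensions[OF assms(1-3) assms(4) r] card_extensions[OF assms(1-3) \<open>field_basis F L B'\<close> r] by simp
  qed
qed

lemma field_degree_eq_extensions:
  assumes "is_subfield (F :: 'k set)" "is_subfield L" "F \<subseteq> L" "\<rho> \<in> embeddings F"
  shows "card {\<tau> \<in> embeddings L. restrict \<tau> F = \<rho>} = field_degree F L"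
proof -
  obtain B where B: "field_basis F L B" using field_basis_exists[OF nf assms(1-3)] by blast
  show ?thesis unfolding field_degree_eq_card[OF assms(1-3) B] by (rule card_extensions[OF assms(1-3) B assms(4)])
qed

end

section \<open>Matrices indexed by lists\<close>

text \<open>Cardinalities are compared below as elements of E \<otimes> C, so the natural numbers
  have to inject there.\<close>

instance tensor :: (field_char_0, field_char_0) ring_char_0
proof
  have "of_nat n = tens (1 :: 'a) (of_nat n :: 'b)" for n
    by (induction n) (simp_all add: tens_add_right one_tensor_def)
  moreover have "z = 0" if "tens (1 :: 'a) (z :: 'b) = 0" for z
  proof (rule ccontr)
    assume "z \<noteq> 0"
    then have "tens (1 :: 'a) z * tens 1 (inverse z) = 1" by (simp add: tens_times_tens one_tensor_def)
    then show False using that by simp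
  qed
  ultimately show "inj (of_nat :: nat \<Rightarrow> ('a, 'b) tensor)"
    by (intro injI) (metis eq_iff_diff_eq_0 of_nat_eq_iff tens_diff_right)
qed

text \<open>Entries are indexed by basis elements rather than by positions. For distinct lists,
  products become sums over the underlying sets, and the order of the lists affects only
  determinants.\<close>

definition imat :: "'i list \<Rightarrow> 'j list \<Rightarrow> ('i \<Rightarrow> 'j \<Rightarrow> 'a) \<Rightarrow> 'a mat" where
  "imat is js f = mat (length is) (length js) (\<lambda>(i, j). f (is ! i) (js ! j))"

lemma imat_carrier [simp]: "imat is js f \<in> carrier_mat (length is) (length js)"
  by (simp add: imat_def)

lemma dim_imat [simp]: "dim_row (imat is js f) = length is" "dim_col (imat is js f) = length js"
  by (simp_all add: imat_def)

lemma imat_cong: "(\<And>i j. i \<in> set is \<Longrightarrow> j \<in> set js \<Longrightarrow> f i j = g i j) \<Longrightarrow> imat is js f = imat is js g"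
  by (auto simp: imat_def intro!: eq_matI)

lemma sum_nth_distinct:
  assumes "distinct js"
  shows "(\<Sum>k<length js. f (js ! k)) = sum f (set js)"
  using sum.reindex_bij_betw[OF bij_betw_nth[OF assms refl refl], of f] by simp

lemma prod_nth_distinct:
  assumes "distinct js"
  shows "(\<Prod>k<length js. f (js ! k)) = prod f (set js)"
  using prod.reindex_bij_betw[OF bij_betw_nth[OF assms refl refl], of f] by simp

lemma imat_mult:
  assumes "distinct js"
  shows "imat is js f * imat js ks g = imat is ks (\<lambda>i k. \<Sum>j\<in>set js. f i j * (g j k :: 'a::comm_ring_1))"
  unfolding imat_def
  by (intro eq_matI) (simp_all add: scalar_prod_def atLeast0LessThan sum_nth_distinct[OF assms, symmetric])

lemma imat_one:
  assumes "distinct is"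
  shows "imat is is (\<lambda>i j. if i = j then 1 else 0) = 1\<^sub>m (length is)"
  unfolding imat_def using assms by (intro eq_matI) (auto simp: nth_eq_iff_index_eq)

lemma det_imat_diag:
  assumes "distinct is"
  shows "det (imat is is (\<lambda>i j. if i = j then d i else 0)) = (\<Prod>i\<in>set is. d i :: 'a::comm_ring_1)"
proof -
  let ?D = "imat is is (\<lambda>i j. if i = j then d i else 0)"
  have "det ?D = prod_list (diag_mat ?D)"
    using assms by (intro det_upper_triangular[of _ "length is"]) (auto simp: imat_def nth_eq_iff_index_eq)
  also have "\<dots> = (\<Prod>k<length is. d (is ! k))"
    unfolding prod_list_diag_prod by (simp add: atLeast0LessThan imat_def)
  finally show ?thesis by (simp add: prod_nth_distinct[OF assms])
qed

text \<open>The traces of the two products \<open>f g\<close> and \<open>g f\<close> agree, and with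
  these diagonals they are the two cardinalities. This stands in for invariance of rank over a ring
  that need not be a field.\<close>

lemma length_eq_if_inverse:
  fixes f g :: "_ \<Rightarrow> _ \<Rightarrow> 'a :: {comm_ring_1, ring_char_0}"
  assumes "finite I" "finite J"
    and "\<And>i. i \<in> I \<Longrightarrow> (\<Sum>j\<in>J. f i j * g j i) = 1" "\<And>j. j \<in> J \<Longrightarrow> (\<Sum>i\<in>I. g j i * f i j) = 1"
  shows "card I = card J"
proof -
  have "of_nat (card I) = (\<Sum>i\<in>I. \<Sum>j\<in>J. f i j * g j i)" using assms(3) by simp
  also have "\<dots> = (\<Sum>j\<in>J. \<Sum>i\<in>I. g j i * f i j)" by (subst sum.swap) (simp add: mult.commute)
  also have "\<dots> = (of_nat (card J) :: 'a)" using assms(4) by simp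
  finally show ?thesis by simp
qed

lemma det_inverse_imat:
  fixes f g :: "_ \<Rightarrow> _ \<Rightarrow> 'a :: comm_ring_1"
  assumes "distinct is" "distinct js" "length is = length js"
    and "\<And>i i'. i \<in> set is \<Longrightarrow> i' \<in> set is \<Longrightarrow> (\<Sum>j\<in>set js. f i j * g j i') = (if i = i' then 1 else 0)"
  shows "det (imat is js f) * det (imat js is g) = 1"
proof -
  have "imat is js f * imat js is g = 1\<^sub>m (length is)"
    unfolding imat_mult[OF assms(2)] imat_one[OF assms(1), symmetric] by (intro imat_cong assms(4))
  then have "det (imat is js f * imat js is g) = 1" by simp
  moreover have "det (imat is js f * imat js is g) = det (imat is js f) * det (imat js is g)"
    using assms(3) imat_carrier[of "is" js f] imat_carrier[of js "is" g] by (intro det_mult) auto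
  ultimately show ?thesis by simp
qed

text \<open>The product is the determinant of the rational matrix \<open>m\<close>, because
  \<open>m\<close> is conjugate to the diagonal matrix of the \<open>d i\<close> through
  \<open>P\<close> and its inverse \<open>Q\<close>.\<close>

lemma prod_rational_if_diagonalizes:
  fixes P :: "'i \<Rightarrow> 'j \<Rightarrow> complex"
  assumes fin: "finite I" "finite J"
    and PQ: "\<And>i i'. i \<in> I \<Longrightarrow> i' \<in> I \<Longrightarrow> (\<Sum>j\<in>J. P i j * Q j i') = (if i = i' then 1 else 0)"
    and QP: "\<And>j. j \<in> J \<Longrightarrow> (\<Sum>i\<in>I. Q j i * P i j) = 1"
    and M: "\<And>j j'. j \<in> J \<Longrightarrow> j' \<in> J \<Longrightarrow> (\<Sum>i\<in>I. Q j i * (d i * P i j')) = of_rat (m j j')"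
  shows "\<exists>q. prod d I = of_rat q"
proof -
  obtain "is" js where l: "set is = I" "distinct is" "set js = J" "distinct js"
    using fin finite_distinct_list by metis
  have "card I = card J" by (rule length_eq_if_inverse[of I J P Q, OF fin _ QP]) (simp_all add: PQ)
  then have len: "length is = length js" using l by (metis distinct_card)
  let ?P = "imat is js P" and ?Q = "imat js is Q" and ?D = "imat is is (\<lambda>i j. if i = j then d i else 0)"
  have 1: "det ?P * det ?Q = 1"
    by (rule det_inverse_imat[OF l(2,4) len]) (simp add: l PQ)
  have "?Q * (?D * ?P) = imat js js (\<lambda>j j'. of_rat (m j j'))"
    unfolding imat_mult[OF l(2)]
    by (intro imat_cong) (simp add: l if_distrib[of "\<lambda>x. x * _"] sum.delta fin M cong: if_cong)
  also have "\<dots> = map_mat of_rat (imat js js m)" by (auto simp: imat_def intro!: eq_matI)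
  finally have "det (?Q * (?D * ?P)) = of_rat (det (imat js js m))" by (simp add: of_rat_hom.hom_det)
  moreover have "det (?Q * (?D * ?P)) = det ?Q * (det ?D * det ?P)"
  proof -
    have c: "?Q \<in> carrier_mat (length is) (length is)" "?P \<in> carrier_mat (length is) (length is)"
      "?D \<in> carrier_mat (length is) (length is)"
      using len by (simp_all add: imat_def)
    show ?thesis
      by (simp only: det_mult[OF c(1) mult_carrier_mat[OF c(3,2)]] det_mult[OF c(3,2)])
  qed
  moreover have "det ?D = prod d I" using det_imat_diag[OF l(2), of d] l(1) by simp
  ultimately show ?thesis using 1 by (auto simp: mult_ac)
qed

section \<open>Traces and norms\<close>

context
  assumes nf: "number_field TYPE('k::field_char_0)"
begin

text \<open>The element \<open>a\<close> represents the functional with respect to the trace form.\<close>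

lemma trace_duality:
  fixes f :: "'k \<Rightarrow> rat"
  assumes f: "additive f"
  obtains a :: 'k where "\<And>\<sigma>. \<sigma> \<in> embeddings UNIV \<Longrightarrow> \<sigma> a = eval_C (\<lambda>k. of_rat (f k)) (idem \<sigma>)"
proof -
  interpret Q: vector_space "\<lambda>q (x::'k). of_rat q * x" by (rule vector_space_rat)
  obtain S :: "'k set" where S: "finite S" "Q.span S = UNIV"
    using nf by (auto simp: number_field_def)
  have span: "UNIV \<subseteq> Q.span S" by (simp add: S(2))
  obtain B :: "'k set" and l where B: "finite B" "card B = Q.dim (UNIV :: 'k set)" "B \<subseteq> UNIV" "\<And>b. additive (l b)"
    "\<And>b a x. l b (of_rat a * x) = a * l b x" "\<And>b b'. b' \<in> B \<Longrightarrow> l b b' = (if b' = b then 1 else 0)"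
    "\<And>x. x \<in> UNIV \<Longrightarrow> x = (\<Sum>b\<in>B. of_rat (l b x) * b)"
    by (rule Q.subspace_coordinates_exist[OF Q.subspace_UNIV S(1) span]) (rule that)
  note expand = B(7)[OF UNIV_I]
  define Tr where "Tr x = (\<Sum>b\<in>B. l b (x * b))" for x
  have Tr: "additive Tr" "Tr (of_rat q * x) = q * Tr x" for q x
    by (simp_all add: Tr_def additive_def distrib_right additive.add[OF B(4)] sum.distrib mult.assoc B(5) sum_distrib_left)
  have addC: "additive (\<lambda>k. of_rat (g k) :: complex)" if "additive g" for g :: "'k \<Rightarrow> rat"
    using that by (simp add: additive_def of_rat_add)
  have Tr_scale: "Tr (y * (of_rat q * x)) = q * Tr (y * x)" for q x y
    by (subst mult.left_commute) (rule Tr(2))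
  have Tr1: "Tr 1 \<noteq> 0"
  proof -
    have "B \<noteq> {}" using expand[of 1] by auto
    then show ?thesis using B(1) by (simp add: Tr_def B(6))
  qed
  \<comment> \<open>The trace of an idempotent is the dimension of its summand in K \<otimes> C,
    which is 1. The two expansions below express the trace and evaluation at \<sigma> by the same
    coordinates.\<close>
  have Tr_idem: "eval_C (\<lambda>k. of_rat (Tr k)) (idem \<sigma>) = 1" if s: "\<sigma> \<in> embeddings UNIV" for \<sigma>
  proof -
    note ev = eval_C[OF addC[OF B(4)]]
    have 1: "eval_C (\<lambda>k. of_rat (Tr k)) y = (\<Sum>b\<in>B. eval_C (\<lambda>k. of_rat (l b k)) (tens b 1 * y))" for y
    proof (rule tensor_eqI[of "eval_C (\<lambda>k. of_rat (Tr k))"])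
      show "additive (eval_C (\<lambda>k. complex_of_rat (Tr k)))" by (rule eval_C(2)[OF addC[OF Tr(1)]])
      show "additive (\<lambda>y. \<Sum>b\<in>B. eval_C (\<lambda>k. of_rat (l b k)) (tens b 1 * y))"
        by (intro additive_sum_fun additive.intro) (simp only: distrib_left ev(3))
      show "eval_C (\<lambda>k. of_rat (Tr k)) (tens a z) = (\<Sum>b\<in>B. eval_C (\<lambda>k. of_rat (l b k)) (tens b 1 * tens a z))" for a z
        by (simp only: eval_C(1)[OF addC[OF Tr(1)]] tens_times_tens ev(1))
          (simp only: Tr_def of_rat_sum sum_distrib_left mult_ac mult_1_left)
    qed
    have 2: "eval_C \<sigma> y = (\<Sum>b\<in>B. \<sigma> b * eval_C (\<lambda>k. of_rat (l b k)) y)" for y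
    proof (rule tensor_eqI[of "eval_C \<sigma>"])
      show "additive (eval_C \<sigma>)" by (rule eval_C(2)[OF embedding_hom(4)[OF s]])
      show "additive (\<lambda>y. \<Sum>b\<in>B. \<sigma> b * eval_C (\<lambda>k. of_rat (l b k)) y)"
        by (intro additive_sum_fun additive.intro) (simp only: distrib_left ev(3))
      show "eval_C \<sigma> (tens a z) = (\<Sum>b\<in>B. \<sigma> b * eval_C (\<lambda>k. of_rat (l b k)) (tens a z))" for a z
      proof -
        have "\<sigma> a = (\<Sum>b\<in>B. of_rat (l b a) * \<sigma> b)"
          by (subst expand[of a]) (simp only: embedding_hom(8,3)[OF s] embedding_of_rat[OF s])
        then show ?thesis
          unfolding eval_C(1)[OF embedding_hom(4)[OF s]] ev(1)
          by (simp only: sum_distrib_right) (simp only: mult_ac)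
      qed
    qed
    show ?thesis
      unfolding 1 tens_idem[OF nf s] eval_C_scale[OF addC[OF B(4)]]
      using 2[of "idem \<sigma>"] eval_idem[OF nf s s] by simp
  qed
  \<comment> \<open>\<open>L a\<close> encodes the functional sending \<open>x\<close> to
    \<open>Tr (a * x)\<close> by its values on the basis. Injectivity of \<open>L\<close> is
    nondegeneracy of the trace form, and surjectivity follows by dimension.\<close>
  define L where "L a = (\<Sum>b\<in>B. of_rat (Tr (a * b)) * b)" for a
  have l_sum: "l b (\<Sum>b\<in>B. of_rat (c b) * b) = c b" if "b \<in> B" for b c
    using that B(1) by (simp add: additive.sum[OF B(4)] B(5,6) if_distrib[of "\<lambda>x. _ * x"] cong: if_cong)
  have indep: "Q.independent B"
  proof (rule Q.independent_if_scalars_zero[OF B(1)])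
    fix c x assume "(\<Sum>x\<in>B. of_rat (c x) * x) = 0" "x \<in> B"
    then show "c x = 0" using l_sum[of x c] additive.zero[OF B(4)] by simp
  qed
  have "Q.span B = UNIV"
  proof -
    have "x \<in> Q.span B" for x
      by (subst expand[of x]) (intro Q.span_sum Q.span_scale Q.span_base)
    then show ?thesis by blast
  qed
  interpret Q: finite_dimensional_vector_space "\<lambda>q (x::'k). of_rat q * x" B
    by unfold_locales (use B(1) indep \<open>Q.span B = UNIV\<close> in auto)
  have "Vector_Spaces.linear (\<lambda>q (x::'k). of_rat q * x) (\<lambda>q x. of_rat q * x) L"
    unfolding Vector_Spaces.linear_iff
  proof (intro conjI allI vector_space_rat)
    show "L (x + y) = L x + L y" for x y
      by (simp only: L_def distrib_right additive.add[OF Tr(1)] of_rat_add sum.distrib)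
    show "L (of_rat q * x) = of_rat q * L x" for q x
      by (simp only: L_def mult.assoc Tr(2) of_rat_mult sum_distrib_left)
  qed
  moreover have "inj L"
  proof -
    have "a = 0" if "L a = 0" for a
    proof (rule ccontr)
      assume "a \<noteq> 0"
      have "Tr (a * b) = 0" if "b \<in> B" for b
        using l_sum[OF that, of "\<lambda>b. Tr (a * b)"] \<open>L a = 0\<close> additive.zero[OF B(4)] by (simp add: L_def)
      then have "Tr (a * x) = 0" for x
        by (subst expand[of x]) (simp add: sum_distrib_left additive.sum[OF Tr(1)] Tr_scale)
      from this[of "inverse a"] show False using Tr1 \<open>a \<noteq> 0\<close> by simp
    qed
    moreover have "L (a - b) = L a - L b" for a b
      by (simp add: L_def left_diff_distrib additive.diff[OF Tr(1)] of_rat_diff sum_subtractf)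
    ultimately show ?thesis by (intro injI) (metis eq_iff_diff_eq_0)
  qed
  ultimately have "surj L" by (rule Q.linear_inj_imp_surj)
  then obtain a where a: "L a = (\<Sum>b\<in>B. of_rat (f b) * b)" by (metis surjD)
  have ab: "Tr (a * b) = f b" if "b \<in> B" for b
    using l_sum[OF that, of "\<lambda>b. Tr (a * b)"] l_sum[OF that, of f] a by (simp add: L_def)
  have fx: "f x = Tr (a * x)" for x
  proof -
    have "f x = (\<Sum>b\<in>B. l b x * f b)"
      using additive_rat_linear[OF f] by (subst expand[of x]) (simp add: additive.sum[OF f])
    also have "\<dots> = Tr (a * (\<Sum>b\<in>B. of_rat (l b x) * b))"
      by (simp add: sum_distrib_left additive.sum[OF Tr(1)] Tr_scale ab)
    finally show ?thesis by (simp only: expand[of x, symmetric])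
  qed
  have "\<sigma> a = eval_C (\<lambda>k. of_rat (f k)) (idem \<sigma>)" if s: "\<sigma> \<in> embeddings UNIV" for \<sigma>
  proof -
    have "eval_C (\<lambda>k. of_rat (f k)) y = eval_C (\<lambda>k. of_rat (Tr k)) (tens a 1 * y)" for y
    proof (rule tensor_eqI[of "eval_C (\<lambda>k. of_rat (f k))"])
      show "additive (eval_C (\<lambda>k. complex_of_rat (f k)))" by (rule eval_C(2)[OF addC[OF f]])
      show "additive (\<lambda>y. eval_C (\<lambda>k. of_rat (Tr k)) (tens a 1 * y))"
        by (intro additive.intro) (simp only: distrib_left eval_C(3)[OF addC[OF Tr(1)]])
      show "eval_C (\<lambda>k. of_rat (f k)) (tens k z) = eval_C (\<lambda>k. of_rat (Tr k)) (tens a 1 * tens k z)" for k z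
        unfolding tens_times_tens eval_C(1)[OF addC[OF Tr(1)]] eval_C(1)[OF addC[OF f]]
        by (simp only: fx[of k] mult_1_left)
    qed
    then show ?thesis
      by (simp only: tens_idem[OF nf s] eval_C_scale[OF addC[OF Tr(1)]] Tr_idem[OF s] mult_1_right)
  qed
  then show ?thesis by (rule that)
qed

text \<open>The embeddings of \<open>F\<close> diagonalize multiplication by \<open>x\<close>, which
  has rational entries in a rational basis of \<open>F\<close>. The norm is therefore a rational
  determinant.\<close>

lemma field_norm_rational:
  assumes F: "is_subfield (F :: 'k set)" and x: "x \<in> F"
  shows "\<exists>q. field_norm F x = of_rat q"
proof -
  interpret Q: vector_space "\<lambda>q (x::'k). of_rat q * x" by (rule vector_space_rat)
  obtain S :: "'k set" where S: "finite S" "Q.span S = UNIV"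
    using nf by (auto simp: number_field_def)
  have span: "F \<subseteq> Q.span S" by (simp add: S(2))
  have sub: "Q.subspace F"
    unfolding Q.subspace_def
    by (intro conjI ballI allI is_subfield(1,3,4)[OF F] of_rat_in_subfield[OF F])
  obtain B :: "'k set" and l where B: "finite B" "card B = Q.dim F" "B \<subseteq> F" "\<And>b. additive (l b)"
    "\<And>b a x. l b (of_rat a * x) = a * l b x" "\<And>b b'. b' \<in> B \<Longrightarrow> l b b' = (if b' = b then 1 else 0)"
    "\<And>x. x \<in> F \<Longrightarrow> x = (\<Sum>b\<in>B. of_rat (l b x) * b)"
    by (rule Q.subspace_coordinates_exist[OF sub S(1) span]) (rule that)
  obtain p where p: "additive p" "\<And>x. p x \<in> F" "\<And>a x. a \<in> F \<Longrightarrow> p (a * x) = a * p x" "p 1 = 1"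
    using subfield_projection_exists[OF nf F] by blast
  have pF: "p y = y" if "y \<in> F" for y using p(3)[OF that, of 1] p(4) by simp
  define g where "g b k = complex_of_rat (l b (p k))" for b k
  have g: "additive (g b)" for b
    by (simp add: g_def additive_def additive.add[OF p(1)] additive.add[OF B(4)] of_rat_add)
  note ev = eval_C[OF g]
  note finE = idempotents_exist(1)[OF nf]
  \<comment> \<open>This is the inverse of the matrix of conjugates \<open>\<rho> b\<close>. The
    idempotent of \<rho> in F \<otimes> C is represented in K \<otimes> C by the sum of the
    idempotents of all extensions of \<rho>.\<close>
  define Q where "Q b \<rho> = (\<Sum>\<sigma> | \<sigma> \<in> embeddings UNIV \<and> restrict \<sigma> F = \<rho>. eval_C (g b) (idem \<sigma>))" for b \<rho>
  have group: "(\<Sum>\<rho>\<in>embeddings F. Q b \<rho> * \<rho> y) = g b y" if "y \<in> F" for b y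
  proof -
    have "(\<Sum>\<rho>\<in>embeddings F. Q b \<rho> * \<rho> y)
        = (\<Sum>\<rho>\<in>embeddings F. \<Sum>\<sigma> | \<sigma> \<in> embeddings UNIV \<and> restrict \<sigma> F = \<rho>. eval_C (g b) (tens y 1 * idem \<sigma>))"
      unfolding Q_def sum_distrib_right
    proof (intro sum.cong refl)
      fix \<rho> \<sigma> assume "\<sigma> \<in> {\<sigma> \<in> embeddings UNIV. restrict \<sigma> F = \<rho>}"
      then have s: "\<sigma> \<in> embeddings UNIV" and "\<rho> y = \<sigma> y" using that by auto
      then show "eval_C (g b) (idem \<sigma>) * \<rho> y = eval_C (g b) (tens y 1 * idem \<sigma>)"
        unfolding tens_idem[OF nf s] eval_C_scale[OF g] by (simp add: mult.commute)
    qed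
    also have "\<dots> = (\<Sum>\<sigma>\<in>embeddings UNIV. eval_C (g b) (tens y 1 * idem \<sigma>))"
      by (rule sum.group) (use finE finite_embeddings[OF nf F] restrict_embedding[OF _ F] in auto)
    also have "\<dots> = eval_C (g b) (tens y 1 * (\<Sum>\<sigma>\<in>embeddings UNIV. idem \<sigma>))"
      by (simp only: ev(5) sum_distrib_left)
    also have "\<dots> = g b y" unfolding sum_idem[OF nf] mult_1_right ev(1) ..
    finally show ?thesis .
  qed
  have "\<exists>q. prod (\<lambda>\<rho>. \<rho> x) (embeddings F) = of_rat q"
  proof (rule prod_rational_if_diagonalizes[OF finite_embeddings[OF nf F] B(1)])
    fix \<rho> \<rho>' assume r: "\<rho> \<in> embeddings F" and "\<rho>' \<in> embeddings F"
    note add = embedding_proj[OF nf F r p(1-3)]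
    have "(\<Sum>b\<in>B. \<rho> b * Q b \<rho>') = (\<Sum>\<sigma> | \<sigma> \<in> embeddings UNIV \<and> restrict \<sigma> F = \<rho>'. \<Sum>b\<in>B. \<rho> b * eval_C (g b) (idem \<sigma>))"
      unfolding Q_def sum_distrib_left by (rule sum.swap)
    also have "\<dots> = (\<Sum>\<sigma> | \<sigma> \<in> embeddings UNIV \<and> restrict \<sigma> F = \<rho>'. eval_C (\<lambda>k. \<rho> (p k)) (idem \<sigma>))"
    proof (rule sum.cong[OF refl])
      fix \<sigma> :: "'k \<Rightarrow> complex"
      have "(\<Sum>b\<in>B. \<rho> b * eval_C (g b) y) = eval_C (\<lambda>k. \<rho> (p k)) y" for y
      proof (rule tensor_eqI[of "\<lambda>y. \<Sum>b\<in>B. \<rho> b * eval_C (g b) y"])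
        show "additive (\<lambda>y. \<Sum>b\<in>B. \<rho> b * eval_C (g b) y)"
          by (intro additive_sum_fun additive.intro) (simp only: distrib_left ev(3))
        show "additive (eval_C (\<lambda>k. \<rho> (p k)))" by (rule eval_C(2)[OF add(1)])
        fix k z
        obtain \<tau> where t: "\<tau> \<in> embeddings UNIV" "restrict \<tau> F = \<rho>" using embedding_extends[OF nf F r] by blast
        then have tr: "\<rho> y = \<tau> y" if "y \<in> F" for y using that by auto
        have "\<tau> (p k) = (\<Sum>b\<in>B. of_rat (l b (p k)) * \<tau> b)"
          by (subst B(7)[OF p(2)[of k]]) (simp only: embedding_hom(8,3)[OF t(1)] embedding_of_rat[OF t(1)])
        also have "\<dots> = (\<Sum>b\<in>B. g b k * \<rho> b)"
          using B(3) tr by (intro sum.cong refl) (auto simp: g_def)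
        finally have "\<rho> (p k) = (\<Sum>b\<in>B. g b k * \<rho> b)" using tr[OF p(2)] by simp
        moreover have "eval_C (\<lambda>k. \<rho> (p k)) (tens k z) = \<rho> (p k) * z"
          by (rule eval_C(1)[OF add(1)])
        moreover have "(\<Sum>b\<in>B. \<rho> b * eval_C (g b) (tens k z)) = (\<Sum>b\<in>B. g b k * \<rho> b) * z"
          unfolding ev(1) sum_distrib_right by (simp only: mult_ac)
        ultimately show "(\<Sum>b\<in>B. \<rho> b * eval_C (g b) (tens k z)) = eval_C (\<lambda>k. \<rho> (p k)) (tens k z)"
          by (simp only:)
      qed
      then show "(\<Sum>b\<in>B. \<rho> b * eval_C (g b) (idem \<sigma>)) = eval_C (\<lambda>k. \<rho> (p k)) (idem \<sigma>)" .
    qed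
    also have "\<dots> = (if \<rho> = \<rho>' then 1 else 0)"
    proof (cases "\<rho> = \<rho>'")
      case True
      then show ?thesis using sum_extensions_proj[OF nf F r p] by simp
    next
      case False
      then show ?thesis using eval_C_idem_semilinear[OF nf F r add] by (auto intro!: sum.neutral)
    qed
    finally show "(\<Sum>b\<in>B. \<rho> b * Q b \<rho>') = (if \<rho> = \<rho>' then 1 else 0)" .
  next
    fix b assume "b \<in> B"
    then show "(\<Sum>\<rho>\<in>embeddings F. Q b \<rho> * \<rho> b) = 1"
      using group[of b b] B(3) by (auto simp: g_def pF B(6) subset_iff)
  next
    fix b b' assume b: "b \<in> B" "b' \<in> B"
    then have bF: "b' \<in> F" using B(3) by auto
    have "(\<Sum>\<rho>\<in>embeddings F. Q b \<rho> * (\<rho> x * \<rho> b')) = (\<Sum>\<rho>\<in>embeddings F. Q b \<rho> * \<rho> (x * b'))"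
      by (intro sum.cong refl) (simp add: embeddings_hom_on(3) x bF)
    also have "\<dots> = g b (x * b')" by (rule group[OF is_subfield(4)[OF F x bF]])
    finally show "(\<Sum>\<rho>\<in>embeddings F. Q b \<rho> * (\<rho> x * \<rho> b')) = of_rat (l b (p (x * b')))"
      by (simp add: g_def)
  qed
  then show ?thesis by (simp add: field_norm_def)
qed

end

section \<open>The maximal CM or totally real subfield\<close>

text \<open>For a number field this is the largest totally real subfield. Embeddings of K suffice
  for the test, because those of a subfield extend to K.\<close>

definition real_elements :: "'k::field set" where
  "real_elements = {x. \<forall>\<sigma>\<in>embeddings UNIV. \<sigma> x \<in> \<real>}"

text \<open>In a number field such an element exists exactly if there is a CM subfield
  (\<open>CM_field_purely_imaginary\<close> and \<open>CM_field_CM_subfield\<close>). It decides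
  between the two cases of the theorem.\<close>

definition purely_imaginary :: "'k::field \<Rightarrow> bool" where
  "purely_imaginary r \<longleftrightarrow> r \<noteq> 0 \<and> (\<forall>\<sigma>\<in>embeddings UNIV. Re (\<sigma> r) = 0)"

lemma real_elements_subfield: "is_subfield (real_elements :: 'k::field set)"
  unfolding is_subfield_def real_elements_def
  by (auto simp: embedding_hom embedding_inverse)

lemma scalar_class_eqI: "scalar_class_eq x y \<Longrightarrow> scalar_class x = scalar_class y"
  by (rule Quotient3_rel_abs[OF Quotient3_scalar_class])

lemma scalar_class_eq_refl: "z \<noteq> 0 \<Longrightarrow> scalar_class_eq z z"
  by (auto simp: scalar_class_eq_def intro!: exI[of _ 1])

lemma scalar_class_uminus: "z \<noteq> 0 \<Longrightarrow> scalar_class (- z) = scalar_class z"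
  by (rule scalar_class_eqI[symmetric]) (auto simp: scalar_class_eq_def intro!: exI[of _ "-1"])

lemma scalar_class_mult:
  assumes "x \<noteq> 0" "y \<noteq> 0"
  shows "scalar_class x * scalar_class y = scalar_class (x * y)"
proof -
  have rep: "scalar_class_eq (rep_scalar_class (scalar_class z)) z" if "z \<noteq> 0" for z
    by (rule Quotient3_rep_abs[OF Quotient3_scalar_class scalar_class_eq_refl[OF that]])
  obtain p q where "p \<noteq> 0" "x = of_rat p * rep_scalar_class (scalar_class x)"
    "q \<noteq> 0" "y = of_rat q * rep_scalar_class (scalar_class y)"
    using rep[OF assms(1)] rep[OF assms(2)] unfolding scalar_class_eq_def by blast
  then have "x * y = of_rat (p * q) * (rep_scalar_class (scalar_class x) * rep_scalar_class (scalar_class y))" "p * q \<noteq> 0"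
    by (simp_all add: of_rat_mult) (metis mult.assoc mult.left_commute)
  then have "scalar_class_eq (rep_scalar_class (scalar_class x) * rep_scalar_class (scalar_class y)) (x * y)"
    using assms unfolding scalar_class_eq_def by (metis mult_zero_right no_zero_divisors)
  then show ?thesis
    by (simp add: times_scalar_class_def scalar_class_eqI)
qed

lemma scalar_class_1: "scalar_class 1 = 1"
  by (simp add: one_scalar_class_def)

lemma scalar_class_power: "z \<noteq> 0 \<Longrightarrow> scalar_class z ^ n = scalar_class (z ^ n)"
  by (induction n) (simp_all add: scalar_class_1 scalar_class_mult)

lemma field_norm_mult: "x \<in> F \<Longrightarrow> y \<in> F \<Longrightarrow> field_norm F (x * y) = field_norm F x * field_norm F y"
  unfolding field_norm_def prod.distrib[symmetric] by (rule prod.cong[OF refl]) (rule embeddings_hom_on(3))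

context
  assumes nf: "number_field TYPE('k::field_char_0)"
begin

lemma totally_real_iff: "is_subfield (F :: 'k set) \<Longrightarrow> totally_real F \<longleftrightarrow> F \<subseteq> real_elements"
  unfolding totally_real_def real_elements_def embeddings_subfield_eq[OF nf] by auto

lemma totally_imaginary_iff:
  "is_subfield (F :: 'k set) \<Longrightarrow> totally_imaginary F \<longleftrightarrow> (\<forall>\<sigma>\<in>embeddings UNIV. \<not> \<sigma> ` F \<subseteq> \<real>)"
  unfolding totally_imaginary_def embeddings_subfield_eq[OF nf] by (auto simp: image_subset_iff)

lemma purely_imaginary_ratio:
  assumes "purely_imaginary (r :: 'k)" "purely_imaginary r'"
  shows "r' / r \<in> real_elements"
  using assms by (auto simp: purely_imaginary_def real_elements_def divide_inverse embedding_hom embedding_inverse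
      complex_is_Real_iff)

lemma purely_imaginaryI_square:
  assumes "r \<noteq> 0" "\<And>\<sigma>. \<sigma> \<in> embeddings UNIV \<Longrightarrow> \<sigma> (r\<^sup>2) \<in> \<real> \<and> \<sigma> r \<notin> \<real>"
  shows "purely_imaginary (r :: 'k)"
  unfolding purely_imaginary_def
proof (intro conjI assms(1) ballI)
  fix \<sigma> :: "'k \<Rightarrow> complex" assume s: "\<sigma> \<in> embeddings UNIV"
  have "Im ((\<sigma> r)\<^sup>2) = 0"
    using assms(2)[OF s] by (auto simp: complex_is_Real_iff power2_eq_square embedding_hom[OF s])
  then have "Re (\<sigma> r) = 0 \<or> Im (\<sigma> r) = 0" by (auto simp: power2_eq_square)
  then show "Re (\<sigma> r) = 0" using assms(2)[OF s] by (auto simp: complex_is_Real_iff)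
qed

lemma purely_imaginary_square:
  assumes "purely_imaginary (r :: 'k)" "\<sigma> \<in> embeddings UNIV"
  shows "\<sigma> (r\<^sup>2) \<in> \<real>" "Re (\<sigma> (r\<^sup>2)) < 0" "\<sigma> r \<notin> \<real>" "conj_emb \<sigma> r = - \<sigma> r"
proof -
  have 1: "Re (\<sigma> r) = 0" "\<sigma> r \<noteq> 0"
    using assms by (auto simp: purely_imaginary_def embedding_eq_0_iff)
  then have 2: "Im (\<sigma> r) \<noteq> 0" by (auto simp: complex_eq_iff)
  have 3: "\<sigma> (r\<^sup>2) = \<sigma> r * \<sigma> r" by (simp add: power2_eq_square embedding_hom[OF assms(2)])
  show "\<sigma> (r\<^sup>2) \<in> \<real>" unfolding 3 by (simp add: complex_is_Real_iff 1)
  show "Re (\<sigma> (r\<^sup>2)) < 0" unfolding 3 using 1 2 by (simp add: not_square_less_zero[of "Im (\<sigma> r)"] mult_less_0_iff zero_less_mult_iff) (metis linorder_neq_iff)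
  show "\<sigma> r \<notin> \<real>" using 2 by (simp add: complex_is_Real_iff)
  show "conj_emb \<sigma> r = - \<sigma> r" using 1 by (simp add: conj_emb_def complex_eq_iff)
qed

text \<open>Complete the square: a generator \<open>y\<close> of \<open>L\<close> over its totally
  real subfield \<open>F\<close> is shifted by an element of \<open>F\<close> so that its square
  lies in \<open>F\<close>. The shifted generator \<open>r\<close> is real under no embedding,
  because \<open>L\<close> is totally imaginary, so it is purely imaginary.\<close>

lemma CM_field_purely_imaginary:
  assumes "CM_field (L :: 'k set)"
  obtains r where "purely_imaginary r" "\<And>x. x \<in> L \<Longrightarrow> \<exists>a\<in>real_elements. \<exists>b\<in>real_elements. x = a + b * r"
proof -
  obtain F where L: "is_subfield L" "totally_imaginary L" and F: "is_subfield F" "F \<subseteq> L" "totally_real F" "field_degree F L = 2"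
    using assms by (auto simp: CM_field_def)
  have FR: "F \<subseteq> real_elements" using F totally_real_iff by blast
  have imag: "\<not> \<sigma> ` L \<subseteq> \<real>" if "\<sigma> \<in> embeddings UNIV" for \<sigma>
    using L totally_imaginary_iff that by blast
  obtain B where B: "field_basis F L B" using field_basis_exists[OF nf F(1) L(1) F(2)] by blast
  then have "card B = 2" using field_degree_eq_card[OF nf F(1) L(1) F(2)] F(4) by simp
  then obtain b1 b2 where b: "B = {b1, b2}" "b1 \<noteq> b2" by (metis card_2_iff)
  have ex: "\<exists>p\<in>F. \<exists>q\<in>F. x = p * b1 + q * b2" if "x \<in> L" for x
    using B that b unfolding field_basis_def by (fastforce dest!: ex1_implies_ex bspec[of L _ x])
  obtain \<sigma> :: "'k \<Rightarrow> complex" where s: "\<sigma> \<in> embeddings UNIV" using embeddings_nonempty[OF nf] by blast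
  have "\<exists>y\<in>L. y \<notin> F" using imag[OF s] FR s by (auto simp: real_elements_def)
  then obtain y where y: "y \<in> L" "y \<notin> F" by blast
  obtain p q where pq: "p \<in> F" "q \<in> F" "1 = p * b1 + q * b2" using ex[OF is_subfield(2)[OF L(1)]] by blast
  obtain u v where uv: "u \<in> F" "v \<in> F" "y = u * b1 + v * b2" using ex[OF y(1)] by blast
  note Fs = is_subfield[OF F(1)]
  \<comment> \<open>The determinant of the coordinates of 1 and \<open>y\<close>. It is nonzero
    because \<open>y\<close> lies outside \<open>F\<close>, so 1 and \<open>y\<close> span
    \<open>L\<close> in place of the given basis.\<close>
  define d where "d = p * v - q * u"
  have "d \<noteq> 0"
  proof
    assume "d = 0"
    then have pv: "p * v = q * u" by (simp add: d_def)
    have "p * y = u * (p * b1) + (p * v) * b2" by (simp add: uv(3) algebra_simps)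
    also have "\<dots> = u * (p * b1 + q * b2)" unfolding pv by (simp add: algebra_simps)
    finally have 1: "p * y = u" by (simp flip: pq(3))
    have "q * y = (q * u) * b1 + v * (q * b2)" by (simp add: uv(3) algebra_simps)
    also have "\<dots> = v * (p * b1 + q * b2)" unfolding pv[symmetric] by (simp add: algebra_simps)
    finally have 2: "q * y = v" by (simp flip: pq(3))
    have "p \<noteq> 0 \<Longrightarrow> y = u / p" "q \<noteq> 0 \<Longrightarrow> y = v / q"
      using 1 2 by (auto simp: eq_divide_eq mult.commute)
    moreover have "p \<noteq> 0 \<or> q \<noteq> 0" using pq(3) by auto
    ultimately show False using y(2) Fs(8)[OF uv(1) pq(1)] Fs(8)[OF uv(2) pq(2)] by auto
  qed
  have d: "d \<in> F" unfolding d_def by (intro Fs pq uv)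
  have "d * b1 = v * (p * b1 + q * b2) - q * y" "d * b2 = p * y - u * (p * b1 + q * b2)"
    by (simp_all add: d_def uv(3) algebra_simps)
  then have "d * b1 = v - q * y" "d * b2 = p * y - u" by (simp_all flip: pq(3))
  then have b1: "b1 = v / d - q / d * y" and b2: "b2 = - (u / d) + p / d * y"
    using \<open>d \<noteq> 0\<close> by (simp_all add: eq_divide_eq mult.commute flip: diff_divide_distrib)
  have span: "\<exists>a\<in>F. \<exists>c\<in>F. x = a + c * y" if xL: "x \<in> L" for x
  proof -
    obtain s t where st: "s \<in> F" "t \<in> F" "x = s * b1 + t * b2" using ex[OF xL] by blast
    have "x = (s * (v / d) - t * (u / d)) + (t * (p / d) - s * (q / d)) * y"
    proof -
      have "x = s * (v / d - q / d * y) + t * (- (u / d) + p / d * y)" using st(3) by (simp only: b1[symmetric] b2[symmetric])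
      then show ?thesis by (simp add: algebra_simps)
    qed
    moreover have "s * (v / d) - t * (u / d) \<in> F" "t * (p / d) - s * (q / d) \<in> F"
      by (intro Fs st uv pq d)+
    ultimately show ?thesis by blast
  qed
  obtain a c where ac: "a \<in> F" "c \<in> F" "y * y = a + c * y" using span[OF is_subfield(4)[OF L(1) y(1) y(1)]] by blast
  \<comment> \<open>Half the linear coefficient of the quadratic equation of
    \<open>y\<close>.\<close>
  define h where "h = c / (1 + 1)"
  have h: "h \<in> F" unfolding h_def by (intro Fs ac)
  have ch: "c = h + h" by (simp add: h_def field_simps)
  define r where "r = y - h"
  have "r\<^sup>2 = y * y - (h + h) * y + h * h" by (simp add: r_def power2_eq_square algebra_simps)
  then have r2: "r\<^sup>2 = a + h * h" using ac(3) by (simp add: ch)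
  have r2F: "r\<^sup>2 \<in> F" unfolding r2 by (intro Fs ac h)
  have "purely_imaginary r"
  proof (rule purely_imaginaryI_square)
    show "r \<noteq> 0" using y h by (auto simp: r_def)
    fix \<sigma> :: "'k \<Rightarrow> complex" assume s: "\<sigma> \<in> embeddings UNIV"
    have Freal: "\<sigma> x \<in> \<real>" if "x \<in> F" for x using FR that s by (auto simp: real_elements_def)
    have "\<sigma> r \<notin> \<real>"
    proof
      assume "\<sigma> r \<in> \<real>"
      moreover have "y = r + h" by (simp add: r_def)
      ultimately have y': "\<sigma> y \<in> \<real>" using Freal[OF h] by (simp add: embedding_hom[OF s])
      have "\<sigma> x \<in> \<real>" if xL: "x \<in> L" for x
      proof -
        obtain a c where "a \<in> F" "c \<in> F" "x = a + c * y" using span[OF xL] by blast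
        then show ?thesis using y' Freal by (simp add: embedding_hom[OF s])
      qed
      then show False using imag[OF s] by blast
    qed
    then show "\<sigma> (r\<^sup>2) \<in> \<real> \<and> \<sigma> r \<notin> \<real>" using Freal[OF r2F] by simp
  qed
  moreover have "\<exists>a\<in>real_elements. \<exists>b\<in>real_elements. x = a + b * r" if xL: "x \<in> L" for x
  proof -
    obtain a c where "a \<in> F" "c \<in> F" "x = a + c * y" using span[OF xL] by blast
    moreover have "a + c * y = (a + c * h) + c * r" by (simp add: r_def algebra_simps)
    moreover have "a + c * h \<in> F" using \<open>a \<in> F\<close> \<open>c \<in> F\<close> by (intro Fs h)
    ultimately show ?thesis using FR by blast
  qed
  ultimately show ?thesis by (rule that)
qed

text \<open>A CM subfield would provide a purely imaginary element, so only totally real subfields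
  compete, and \<open>real_elements\<close> is the greatest of them.\<close>

lemma max_CM_or_real_subfield_real:
  assumes "\<nexists>r :: 'k. purely_imaginary r"
  shows "delta TYPE('k) = 1"
proof -
  have "max_CM_or_real_subfield = (real_elements :: 'k set)"
    unfolding max_CM_or_real_subfield_def
  proof (rule Greatest_equality)
    show "is_subfield (real_elements :: 'k set) \<and> (CM_field (real_elements :: 'k set) \<or> totally_real (real_elements :: 'k set))"
      using totally_real_iff real_elements_subfield by blast
    fix L :: "'k set" assume "is_subfield L \<and> (CM_field L \<or> totally_real L)"
    then show "L \<subseteq> real_elements" using totally_real_iff assms CM_field_purely_imaginary by metis
  qed
  then show ?thesis using totally_real_iff[OF real_elements_subfield] by (simp add: delta_def)
qed

context
  fixes r :: 'k
  assumes r: "purely_imaginary r"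
begin

text \<open>The field generated by \<open>r\<close> over the real elements. Since the ratio of two
  purely imaginary elements is real, another choice of \<open>r\<close> gives the same field; this
  is why it contains every CM subfield (\<open>subset_CM_subfield\<close>).\<close>

definition CM_subfield :: "'k set" where
  "CM_subfield = {x. \<exists>a\<in>real_elements. \<exists>b\<in>real_elements. x = a + b * r}"

lemma r_square: "r * r \<in> real_elements"
  using purely_imaginary_square(1)[OF r] by (auto simp: real_elements_def power2_eq_square)

lemma r_not_real: "r \<notin> real_elements"
  using purely_imaginary_square(3)[OF r] embeddings_nonempty[OF nf] by (auto simp: real_elements_def)

lemma CM_subfield: "is_subfield CM_subfield"
proof -
  note Ks = is_subfield[OF real_elements_subfield[where 'k = 'k]]
  have inv: "inverse (a + b * r) \<in> CM_subfield" if ab: "a \<in> real_elements" "b \<in> real_elements" for a b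
  proof (cases "a + b * r = 0")
    case True
    then have "inverse (a + b * r) = 0 + 0 * r" by simp
    then show ?thesis using Ks(1) unfolding CM_subfield_def by blast
  next
    case False
    obtain \<sigma> :: "'k \<Rightarrow> complex" where s: "\<sigma> \<in> embeddings UNIV" using embeddings_nonempty[OF nf] by blast
    have real: "cnj (\<sigma> x) = \<sigma> x" if "x \<in> real_elements" for x
      using that s by (auto simp: real_elements_def Reals_cnj_iff)
    \<comment> \<open>Complex conjugation exchanges the images of \<open>a + b * r\<close> and
      \<open>a - b * r\<close>, so the second is nonzero as well, and with it the relative norm
      \<open>N\<close>.\<close>
    have "\<sigma> (a - b * r) = cnj (\<sigma> (a + b * r))"
      using purely_imaginary_square(4)[OF r s] by (simp add: conj_emb_def embedding_hom[OF s] real ab)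
    then have nz: "a - b * r \<noteq> 0" using False by (auto simp: embedding_eq_0_iff[OF s] simp flip: embedding_eq_0_iff[OF s])
    define N where "N = a * a - b * b * (r * r)"
    have N: "N \<in> real_elements" unfolding N_def by (intro Ks ab r_square)
    have N': "N = (a + b * r) * (a - b * r)" by (simp add: N_def algebra_simps)
    then have "inverse (a + b * r) = (a - b * r) / N" using nz by (simp add: N' divide_inverse)
    then have "inverse (a + b * r) = a / N + (- b / N) * r" by (simp add: diff_divide_distrib)
    moreover have "a / N \<in> real_elements" "- b / N \<in> real_elements" by (intro Ks ab N)+
    ultimately show ?thesis unfolding CM_subfield_def by blast
  qed
  show ?thesis
    unfolding is_subfield_def
  proof (intro conjI ballI)
    have "0 = 0 + 0 * r" "1 = 1 + 0 * r" by simp_all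
    then show "0 \<in> CM_subfield" "1 \<in> CM_subfield" using Ks(1,2) unfolding CM_subfield_def by blast+
    fix x assume "x \<in> CM_subfield"
    then obtain a b where x: "a \<in> real_elements" "b \<in> real_elements" "x = a + b * r" by (auto simp: CM_subfield_def)
    show "inverse x \<in> CM_subfield" using inv x by simp
    have "- x = - a + (- b) * r" using x by simp
    then show "- x \<in> CM_subfield" using Ks(5) x(1,2) unfolding CM_subfield_def by blast
    fix y assume "y \<in> CM_subfield"
    then obtain c d where y: "c \<in> real_elements" "d \<in> real_elements" "y = c + d * r" by (auto simp: CM_subfield_def)
    have "x + y = (a + c) + (b + d) * r" using x y by (simp add: algebra_simps)
    then show "x + y \<in> CM_subfield" using Ks(3) x(1,2) y(1,2) unfolding CM_subfield_def by blast
    have "x * y = (a * c + b * d * (r * r)) + (a * d + b * c) * r" using x y by (simp add: algebra_simps)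
    moreover have "a * c + b * d * (r * r) \<in> real_elements" "a * d + b * c \<in> real_elements"
      by (intro Ks x(1,2) y(1,2) r_square)+
    ultimately show "x * y \<in> CM_subfield" unfolding CM_subfield_def by blast
  qed
qed

lemma real_elements_subset_CM: "real_elements \<subseteq> CM_subfield" and r_in_CM: "r \<in> CM_subfield"
proof -
  note Ks = is_subfield(1,2)[OF real_elements_subfield[where 'k = 'k]]
  have "x = x + 0 * r" for x by simp
  then show "real_elements \<subseteq> CM_subfield" using Ks(1) unfolding CM_subfield_def by blast
  have "r = 0 + 1 * r" by simp
  then show "r \<in> CM_subfield" using Ks unfolding CM_subfield_def by blast
qed

lemma subset_CM_subfield:
  assumes "purely_imaginary r'" "\<And>x. x \<in> L \<Longrightarrow> \<exists>a\<in>real_elements. \<exists>b\<in>real_elements. x = a + b * r'"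
  shows "L \<subseteq> CM_subfield"
proof
  note Ks = is_subfield[OF real_elements_subfield[where 'k = 'k]]
  fix x assume "x \<in> L"
  then obtain a b where x: "a \<in> real_elements" "b \<in> real_elements" "x = a + b * r'" using assms(2) by blast
  have "x = a + (b * (r' / r)) * r" using x r by (simp add: purely_imaginary_def)
  moreover have "b * (r' / r) \<in> real_elements" by (intro Ks x purely_imaginary_ratio r assms(1))
  ultimately show "x \<in> CM_subfield" using x(1) unfolding CM_subfield_def by blast
qed

lemma CM_subfield_not_real: "\<sigma> \<in> embeddings UNIV \<Longrightarrow> \<not> \<sigma> ` CM_subfield \<subseteq> \<real>"
  using r_in_CM purely_imaginary_square(3)[OF r] by blast

lemma CM_field_CM_subfield: "CM_field CM_subfield"
  unfolding CM_field_def
proof (intro conjI CM_subfield exI[of _ real_elements] real_elements_subfield real_elements_subset_CM)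
  show "totally_imaginary CM_subfield"
    using CM_subfield_not_real totally_imaginary_iff[OF CM_subfield] by blast
  show "totally_real (real_elements :: 'k set)" using totally_real_iff[OF real_elements_subfield] by blast
  note Ks = is_subfield[OF real_elements_subfield[where 'k = 'k]]
  have r1: "r \<noteq> 1" using r_not_real Ks(2) by auto
  have "field_basis real_elements CM_subfield {1, r}"
    unfolding field_basis_def
  proof (intro conjI ballI)
    show "{1, r} \<subseteq> CM_subfield" using r_in_CM is_subfield(2)[OF CM_subfield] by auto
    fix x assume "x \<in> CM_subfield"
    then obtain a b where x: "a \<in> real_elements" "b \<in> real_elements" "x = a + b * r" by (auto simp: CM_subfield_def)
    show "\<exists>!c. c \<in> {1, r} \<rightarrow>\<^sub>E real_elements \<and> x = (\<Sum>b\<in>{1, r}. c b * b)"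
    proof (rule ex1I[of _ "\<lambda>y\<in>{1, r}. if y = 1 then a else b"])
      fix c assume c: "c \<in> {1, r} \<rightarrow>\<^sub>E real_elements \<and> x = (\<Sum>b\<in>{1, r}. c b * b)"
      then have cr: "c 1 \<in> real_elements" "c r \<in> real_elements" by auto
      have eq: "c 1 + c r * r = a + b * r" using c x(3) r1 by simp
      have "c r = b"
      proof (rule ccontr)
        assume "c r \<noteq> b"
        then have "r = (a - c 1) / (c r - b)" using eq by (simp add: field_simps)
        then show False using r_not_real Ks(8)[OF Ks(7)[OF x(1) cr(1)] Ks(7)[OF cr(2) x(2)]] by simp
      qed
      then have "c 1 = a" using eq by simp
      show "c = (\<lambda>y\<in>{1, r}. if y = 1 then a else b)"
        by (rule PiE_ext[of _ "{1, r}" "\<lambda>_. real_elements"])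
          (use c x \<open>c r = b\<close> \<open>c 1 = a\<close> r1 in auto)
    qed (use x r1 in auto)
  qed simp
  then show "field_degree real_elements CM_subfield = 2"
    using field_degree_eq_card[OF nf real_elements_subfield CM_subfield real_elements_subset_CM] r1 by simp
qed

lemma max_CM_or_real_subfield_CM: "max_CM_or_real_subfield = CM_subfield"
  unfolding max_CM_or_real_subfield_def
proof (rule Greatest_equality)
  show "is_subfield CM_subfield \<and> (CM_field CM_subfield \<or> totally_real CM_subfield)"
    using CM_subfield CM_field_CM_subfield by blast
  fix L :: "'k set" assume L: "is_subfield L \<and> (CM_field L \<or> totally_real L)"
  show "L \<subseteq> CM_subfield"
  proof (cases "CM_field L")
    case True
    then show ?thesis using CM_field_purely_imaginary subset_CM_subfield by metis
  next
    case False
    then show ?thesis using L totally_real_iff real_elements_subset_CM by blast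
  qed
qed

lemma max_real_subfield_CM: "max_real_subfield CM_subfield = real_elements"
  unfolding max_real_subfield_def
proof (rule Greatest_equality)
  show "is_subfield (real_elements :: 'k set) \<and> real_elements \<subseteq> CM_subfield \<and> totally_real (real_elements :: 'k set)"
    using real_elements_subset_CM totally_real_iff real_elements_subfield by blast
qed (use totally_real_iff in blast)

lemma totally_negative_r: "totally_negative real_elements (r\<^sup>2)"
  unfolding totally_negative_def embeddings_subfield_eq[OF nf real_elements_subfield]
  using purely_imaginary_square[OF r] r_square by (auto simp: power2_eq_square)

lemma field_norm_r_nonzero: "field_norm real_elements (r\<^sup>2) \<noteq> 0"
  using totally_negative_r finite_embeddings[OF nf real_elements_subfield]
  by (fastforce simp: field_norm_def totally_negative_def)

text \<open>Independence of all choices. Two admissible square roots differ by a factor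
  \<open>k\<close> among the real elements, so the norms of their squares differ by the square of
  the norm of \<open>k\<close>, and the complex square roots of these by a rational number up to
  sign.\<close>

lemma delta_CM_subfield:
  assumes z: "z\<^sup>2 = field_norm real_elements (r\<^sup>2)"
  shows "delta_CM CM_subfield = scalar_class z"
  unfolding delta_CM_def max_real_subfield_CM
proof (rule the_equality)
  have "adjoin real_elements r = CM_subfield"
  proof
    show "adjoin real_elements r \<subseteq> CM_subfield"
      unfolding adjoin_def using CM_subfield real_elements_subset_CM r_in_CM by blast
    show "CM_subfield \<subseteq> adjoin real_elements r"
    proof
      fix x assume "x \<in> CM_subfield"
      then obtain a b where x: "a \<in> real_elements" "b \<in> real_elements" "x = a + b * r" by (auto simp: CM_subfield_def)
      show "x \<in> adjoin real_elements r"
        unfolding adjoin_def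
      proof (rule InterI)
        fix L assume "L \<in> {L. is_subfield L \<and> real_elements \<subseteq> L \<and> r \<in> L}"
        then have L: "is_subfield L" "a \<in> L" "b \<in> L" "r \<in> L" using x by auto
        show "x \<in> L" unfolding x(3) by (intro is_subfield(3,4)[OF L(1)] L)
      qed
    qed
  qed
  then show "\<exists>D ra za. totally_negative real_elements D \<and> ra\<^sup>2 = D \<and> CM_subfield = adjoin real_elements ra \<and>
      za\<^sup>2 = field_norm real_elements D \<and> scalar_class z = scalar_class za"
    using totally_negative_r z by metis
next
  fix c assume "\<exists>D ra za. totally_negative real_elements D \<and> ra\<^sup>2 = D \<and> CM_subfield = adjoin real_elements ra \<and>
      za\<^sup>2 = field_norm real_elements D \<and> c = scalar_class za"
  then obtain D r' z' where D: "totally_negative real_elements D" "r'\<^sup>2 = D"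
    "CM_subfield = adjoin real_elements r'" "z'\<^sup>2 = field_norm real_elements D" and c: "c = scalar_class z'"
    by (elim exE conjE) (rule that)
  then have neg: "totally_negative real_elements (r'\<^sup>2)" and z': "z'\<^sup>2 = field_norm real_elements (r'\<^sup>2)"
    by simp_all
  have neg': "\<sigma> (r'\<^sup>2) \<in> \<real>" "Re (\<sigma> (r'\<^sup>2)) < 0" "r'\<^sup>2 \<in> real_elements" if "\<sigma> \<in> embeddings UNIV" for \<sigma>
    using neg that unfolding totally_negative_def embeddings_subfield_eq[OF nf real_elements_subfield] by auto
  have "purely_imaginary r'"
  proof (rule purely_imaginaryI_square)
    show "r' \<noteq> 0" using neg' embeddings_nonempty[OF nf] by (auto simp: embedding_hom)
    fix \<sigma> :: "'k \<Rightarrow> complex" assume s: "\<sigma> \<in> embeddings UNIV"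
    have "\<sigma> r' \<notin> \<real>"
    proof
      assume "\<sigma> r' \<in> \<real>"
      then obtain t where "\<sigma> r' = of_real t" by (auto elim: Reals_cases)
      then have "Re (\<sigma> (r'\<^sup>2)) = t * t" by (simp add: power2_eq_square embedding_hom[OF s])
      then show False using neg'(2)[OF s] by (simp add: not_square_less_zero)
    qed
    then show "\<sigma> (r'\<^sup>2) \<in> \<real> \<and> \<sigma> r' \<notin> \<real>" using neg'(1)[OF s] by simp
  qed
  define k where "k = r' / r"
  have k: "k \<in> real_elements" "k \<noteq> 0"
    using purely_imaginary_ratio[OF r \<open>purely_imaginary r'\<close>] r \<open>purely_imaginary r'\<close> by (auto simp: k_def purely_imaginary_def)
  have "r'\<^sup>2 = (k * k) * r\<^sup>2" using r by (simp add: k_def purely_imaginary_def power2_eq_square)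
  then have N: "z'\<^sup>2 = (field_norm real_elements k * z)\<^sup>2"
    using k(1) r_square is_subfield(4)[OF real_elements_subfield k(1) k(1)]
    by (simp add: z' z field_norm_mult power_mult_distrib) (simp add: power2_eq_square field_norm_mult)
  obtain q where q: "field_norm real_elements k = of_rat q"
    using field_norm_rational[OF nf real_elements_subfield k(1)] by blast
  have z0: "z \<noteq> 0" using z field_norm_r_nonzero by auto
  have "z' \<noteq> 0"
  proof
    assume "z' = 0"
    then have "field_norm real_elements (r'\<^sup>2) = 0" using z' by simp
    then show False
      using neg finite_embeddings[OF nf real_elements_subfield]
      by (fastforce simp: field_norm_def totally_negative_def)
  qed
  then have "q \<noteq> 0" using N q by auto
  have "z' = of_rat q * z \<or> z' = of_rat (- q) * z"
    using N unfolding q power2_eq_iff by (simp add: of_rat_minus)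
  then have "scalar_class_eq z z'" using z0 \<open>q \<noteq> 0\<close> unfolding scalar_class_eq_def by (metis neg_equal_0_iff_equal)
  then show "c = scalar_class z" unfolding c by (rule scalar_class_eqI[symmetric])
qed

text \<open>The squares are compared; a sign does not change the class. Each embedding of the real
  elements has exactly \<open>m\<close> extensions to K with \<open>Im (\<sigma> r) > 0\<close>,
  where \<open>m\<close> is the degree of K over \<open>CM_subfield\<close>, since the inequality
  fixes the extension to \<open>CM_subfield\<close>. Grouping by restriction turns the square of the
  product into the \<open>m\<close>-th power of the norm.\<close>

lemma delta_CM_eq_prod:
  "delta TYPE('k) = scalar_class (\<Prod>\<sigma> | \<sigma> \<in> embeddings UNIV \<and> Im (\<sigma> r) > 0. \<sigma> r)"
proof -
  define m where "m = field_degree CM_subfield (UNIV :: 'k set)"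
  define z where "z = csqrt (field_norm real_elements (r\<^sup>2))"
  have z: "z\<^sup>2 = field_norm real_elements (r\<^sup>2)" by (simp add: z_def)
  have z0: "z \<noteq> 0" using z field_norm_r_nonzero by auto
  have "\<not> totally_real CM_subfield"
    using totally_real_iff[OF CM_subfield] r_in_CM r_not_real by blast
  then have d: "delta TYPE('k) = scalar_class (z ^ m)"
    using scalar_class_power[OF z0] by (simp add: delta_def max_CM_or_real_subfield_CM delta_CM_subfield[OF z] m_def)
  let ?\<Phi> = "{\<sigma>. \<sigma> \<in> embeddings UNIV \<and> Im (\<sigma> r) > 0}"
  have fin: "finite ?\<Phi>" using idempotents_exist(1)[OF nf] by simp
  have card: "card {\<sigma> \<in> ?\<Phi>. restrict \<sigma> real_elements = \<rho>} = m" if rho: "\<rho> \<in> embeddings (real_elements :: 'k set)" for \<rho>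
  proof -
    obtain \<sigma>1 where s1: "\<sigma>1 \<in> embeddings UNIV" "restrict \<sigma>1 real_elements = \<rho>"
      using embedding_extends[OF nf real_elements_subfield rho] by blast
    obtain \<sigma>0 where s0: "\<sigma>0 \<in> embeddings UNIV" "restrict \<sigma>0 real_elements = \<rho>" "Im (\<sigma>0 r) > 0"
    proof (cases "Im (\<sigma>1 r) > 0")
      case True
      then show ?thesis using that s1 by blast
    next
      case False
      have "Im (\<sigma>1 r) \<noteq> 0" using purely_imaginary_square(3)[OF r s1(1)] by (simp add: complex_is_Real_iff)
      then have "Im (conj_emb \<sigma>1 r) > 0" using False by (simp add: conj_emb_def)
      moreover have "restrict (conj_emb \<sigma>1) real_elements = \<rho>"
        unfolding s1(2)[symmetric]
        by (rule restrict_ext) (use s1(1) in \<open>auto simp: conj_emb_def real_elements_def Reals_cnj_iff\<close>)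
      ultimately show ?thesis using that conj_emb_embedding[OF s1(1)] by blast
    qed
    have "{\<sigma> \<in> ?\<Phi>. restrict \<sigma> real_elements = \<rho>} = {\<sigma> \<in> embeddings UNIV. restrict \<sigma> CM_subfield = restrict \<sigma>0 CM_subfield}"
    proof (intro equalityI subsetI)
      fix \<sigma> assume "\<sigma> \<in> {\<sigma> \<in> ?\<Phi>. restrict \<sigma> real_elements = \<rho>}"
      then have s: "\<sigma> \<in> embeddings UNIV" "Im (\<sigma> r) > 0" and eq: "restrict \<sigma> real_elements = restrict \<sigma>0 real_elements"
        using s0 by auto
      have eq': "\<sigma> x = \<sigma>0 x" if "x \<in> real_elements" for x using fun_cong[OF eq, of x] that by simp
      \<comment> \<open>As \<open>r * r\<close> is among the real elements, the two values of
        \<open>r\<close> agree up to sign, and the sign is determined by the positive imaginary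
        parts.\<close>
      have "\<sigma> (r * r) = \<sigma>0 (r * r)" by (rule eq'[OF r_square])
      then have "(\<sigma> r)\<^sup>2 = (\<sigma>0 r)\<^sup>2" by (simp add: power2_eq_square embedding_hom[OF s(1)] embedding_hom[OF s0(1)])
      then have "\<sigma> r = \<sigma>0 r" using s(2) s0(3) unfolding power2_eq_iff by auto
      then have "\<sigma> x = \<sigma>0 x" if "x \<in> CM_subfield" for x
        using that eq' by (auto simp: CM_subfield_def embedding_hom[OF s(1)] embedding_hom[OF s0(1)])
      then show "\<sigma> \<in> {\<sigma> \<in> embeddings UNIV. restrict \<sigma> CM_subfield = restrict \<sigma>0 CM_subfield}" using s by auto
    next
      fix \<sigma> assume "\<sigma> \<in> {\<sigma> \<in> embeddings UNIV. restrict \<sigma> CM_subfield = restrict \<sigma>0 CM_subfield}"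
      then have s: "\<sigma> \<in> embeddings UNIV" and eq: "restrict \<sigma> CM_subfield = restrict \<sigma>0 CM_subfield" by auto
      have eq': "\<sigma> x = \<sigma>0 x" if "x \<in> CM_subfield" for x using fun_cong[OF eq, of x] that by simp
      have "restrict \<sigma> real_elements = \<rho>"
        unfolding s0(2)[symmetric] using eq' real_elements_subset_CM by (intro restrict_ext) auto
      then show "\<sigma> \<in> {\<sigma> \<in> ?\<Phi>. restrict \<sigma> real_elements = \<rho>}" using s s0(3) eq'[OF r_in_CM] by simp
    qed
    then show ?thesis
      using field_degree_eq_extensions[OF nf CM_subfield subfield_UNIV subset_UNIV restrict_embedding[OF s0(1) CM_subfield]]
      by (simp add: m_def)
  qed
  have "(\<Prod>\<sigma>\<in>?\<Phi>. \<sigma> r)\<^sup>2 = (\<Prod>\<sigma>\<in>?\<Phi>. \<sigma> (r\<^sup>2))"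
    by (simp add: power2_eq_square embedding_hom prod.distrib)
  also have "\<dots> = (\<Prod>\<rho>\<in>embeddings real_elements. \<Prod>\<sigma> | \<sigma> \<in> ?\<Phi> \<and> restrict \<sigma> real_elements = \<rho>. \<sigma> (r\<^sup>2))"
    by (rule prod.group[symmetric])
      (use fin finite_embeddings[OF nf real_elements_subfield] restrict_embedding[OF _ real_elements_subfield] in auto)
  also have "\<dots> = (\<Prod>\<rho>\<in>embeddings real_elements. \<Prod>\<sigma> | \<sigma> \<in> ?\<Phi> \<and> restrict \<sigma> real_elements = \<rho>. \<rho> (r\<^sup>2))"
    using r_square by (intro prod.cong refl) (auto simp: power2_eq_square)
  also have "\<dots> = (\<Prod>\<rho>\<in>embeddings real_elements. \<rho> (r\<^sup>2) ^ m)"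
    by (intro prod.cong refl) (simp add: card[simplified])
  also have "\<dots> = field_norm real_elements (r\<^sup>2) ^ m"
    by (simp add: field_norm_def prod_power_distrib)
  also have "\<dots> = (z ^ m)\<^sup>2"
    unfolding z[symmetric] by (simp add: mult.commute flip: power_mult)
  finally have "(\<Prod>\<sigma>\<in>?\<Phi>. \<sigma> r) = z ^ m \<or> (\<Prod>\<sigma>\<in>?\<Phi>. \<sigma> r) = - (z ^ m)" by (simp only: power2_eq_iff)
  then show ?thesis using z0 by (auto simp: d scalar_class_uminus)
qed

end

end

section \<open>The comparison isomorphism of a Betti--de Rham system\<close>

abbreviation conj_tensor :: "('v::ab_group_add, complex) tensor \<Rightarrow> ('v, complex) tensor" where
  "conj_tensor \<equiv> tensor_map id cnj"

lemma additive_conj_tensor: "additive conj_tensor"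
  by (rule additive_tensor_map[OF additive_id(1) additive_cnj])

lemma conj_tensor_tens: "conj_tensor (tens v z) = tens v (cnj z)"
  unfolding tensor_map_tens[OF additive_id(1) additive_cnj] id_apply ..

lemma conj_tensor_conj_tensor: "conj_tensor (conj_tensor x) = x"
  by (rule tensor_eqI[of "\<lambda>x. conj_tensor (conj_tensor x)" "\<lambda>x. x"])
    (simp_all only: additive_comp[OF additive_conj_tensor additive_conj_tensor] additive_id conj_tensor_tens complex_cnj_cnj)

lemma conj_tensor_scale:
  assumes "biadditive s"
  shows "conj_tensor (tensor_scale s t x) = tensor_scale s (conj_tensor t) (conj_tensor x)"
  by (rule tensor_map_scale[OF assms assms additive_id(1) additive_cnj additive_id(1)]) simp_all

lemma conj_tensor_complexification: "x \<in> complexification V \<Longrightarrow> conj_tensor x \<in> complexification V"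
  by (rule complexification_map[OF _ additive_id(1) additive_cnj]) simp_all

locale bdr_over =
  fixes M :: "('k::field_char_0, 'e::field_char_0, 'b::ab_group_add, 'd::ab_group_add) bdr"
  assumes nf: "number_field TYPE('k)" and bdr: "betti_de_rham_system M"
begin

abbreviation "Emb \<equiv> embeddings (UNIV :: 'k set)"
abbreviation "CB \<sigma> \<equiv> complexification (betti M \<sigma>)"
abbreviation "RB \<equiv> tensor_scale (betti_scale M) :: ('e, complex) tensor \<Rightarrow> ('b, complex) tensor \<Rightarrow> ('b, complex) tensor"
abbreviation "RD \<equiv> tensor_scale (dR_scale_E M) :: ('e, complex) tensor \<Rightarrow> ('d, complex) tensor \<Rightarrow> ('d, complex) tensor"
abbreviation "KD \<equiv> tensor_scale (dR_scale_K M) :: ('k, complex) tensor \<Rightarrow> ('d, complex) tensor \<Rightarrow> ('d, complex) tensor"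

lemma betti_vector_space: "vector_space (betti_scale M)"
  using bdr unfolding betti_de_rham_system_def by (elim conjE)

lemma betti_subspace: "\<sigma> \<in> Emb \<Longrightarrow> Modules.module.subspace (betti_scale M) (betti M \<sigma>)"
  by (rule bdr[unfolded betti_de_rham_system_def, THEN conjunct2, THEN conjunct1, THEN bspec, THEN conjunct1])

lemma betti_finite: "\<sigma> \<in> Emb \<Longrightarrow> \<exists>B. finite B \<and> Modules.module.span (betti_scale M) B = betti M \<sigma>"
  by (rule bdr[unfolded betti_de_rham_system_def, THEN conjunct2, THEN conjunct1, THEN bspec, THEN conjunct2])

lemma frob_betti:
  assumes "\<sigma> \<in> Emb" "x \<in> betti M \<sigma>"
  shows "frob M \<sigma> x \<in> betti M (conj_emb \<sigma>)" "frob M (conj_emb \<sigma>) (frob M \<sigma> x) = x"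
    "y \<in> betti M \<sigma> \<Longrightarrow> frob M \<sigma> (x + y) = frob M \<sigma> x + frob M \<sigma> y"
    "frob M \<sigma> (betti_scale M e x) = betti_scale M e (frob M \<sigma> x)"
  using bdr[unfolded betti_de_rham_system_def, THEN conjunct2, THEN conjunct2, THEN conjunct1, THEN bspec, THEN bspec, OF assms]
  by simp_all

lemma dR_module: "Modules.module (dR_scale M)"
  using bdr unfolding betti_de_rham_system_def by (elim conjE)

lemma filt_subspace: "Modules.module.subspace (dR_scale M) (filt M p)"
  using bdr unfolding betti_de_rham_system_def by (elim conjE) (rule spec)

lemma filt_antimono: "p \<le> q \<Longrightarrow> filt M q \<subseteq> filt M p"
  using bdr unfolding betti_de_rham_system_def by (elim conjE) (rule antimonoD)

lemmas comparison_facts =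
  bdr[unfolded betti_de_rham_system_def, THEN conjunct2, THEN conjunct2, THEN conjunct2, THEN conjunct2,
    THEN conjunct2, THEN conjunct2, THEN conjunct2, THEN conjunct2, THEN conjunct1, THEN bspec]

lemma comparison_bij: "\<sigma> \<in> Emb \<Longrightarrow> bij_betw (comparison M \<sigma>) (CB \<sigma>) (range (dR_coset M \<sigma>))"
  by (rule comparison_facts[THEN conjunct1])

lemma comparison_add:
  "\<sigma> \<in> Emb \<Longrightarrow> x \<in> CB \<sigma> \<Longrightarrow> a \<in> comparison M \<sigma> x \<Longrightarrow> y \<in> CB \<sigma> \<Longrightarrow> b \<in> comparison M \<sigma> y \<Longrightarrow>
    a + b \<in> comparison M \<sigma> (x + y)"
  by (rule comparison_facts[THEN conjunct2, THEN conjunct1, THEN bspec, THEN bspec, THEN conjunct1, THEN bspec, THEN bspec])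

lemma comparison_scale:
  "\<sigma> \<in> Emb \<Longrightarrow> x \<in> CB \<sigma> \<Longrightarrow> a \<in> comparison M \<sigma> x \<Longrightarrow> RD t a \<in> comparison M \<sigma> (RB t x)"
  by (rule comparison_facts[THEN conjunct2, THEN conjunct1, THEN bspec, THEN bspec, THEN conjunct2, THEN spec])

lemma comparison_conj:
  "\<sigma> \<in> Emb \<Longrightarrow> x \<in> betti M \<sigma> \<Longrightarrow>
    conj_tensor ` comparison M \<sigma> (tens x z) = comparison M (conj_emb \<sigma>) (tens (frob M \<sigma> x) (cnj z))"
  by (rule comparison_facts[THEN conjunct2, THEN conjunct2, THEN bspec, THEN spec])

lemma hodge_decomposition:
  "\<sigma> \<in> Emb \<Longrightarrow> x \<in> CB \<sigma> \<Longrightarrow>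
    \<exists>!h. finite {p. h p \<noteq> 0} \<and> (\<forall>p. h p \<in> hodge M \<sigma> p (weight M - p)) \<and> x = (\<Sum>p | h p \<noteq> 0. h p)"
  by (rule bdr[unfolded betti_de_rham_system_def, THEN conjunct2, THEN conjunct2, THEN conjunct2, THEN conjunct2,
        THEN conjunct2, THEN conjunct2, THEN conjunct2, THEN conjunct2, THEN conjunct2, THEN bspec, THEN bspec])

lemma modules:
  "Modules.module (betti_scale M)" "Modules.module (dR_scale_K M)" "Modules.module (dR_scale_E M)"
proof -
  show "Modules.module (betti_scale M)" using betti_vector_space by (simp add: module_iff_vector_space)
  interpret D: Modules.module "dR_scale M" by (rule dR_module)
  show "Modules.module (dR_scale_K M)"
    by unfold_locales (simp_all add: dR_scale_K_def D.scale_right_distrib D.scale_left_distrib tens_add_left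
        tens_times_tens flip: one_tensor_def)
  show "Modules.module (dR_scale_E M)"
    by unfold_locales (simp_all add: dR_scale_E_def D.scale_right_distrib D.scale_left_distrib tens_add_right
        tens_times_tens flip: one_tensor_def)
qed

lemma dR_vector_space: "vector_space (dR_scale_E M)"
  using modules(3) by (simp add: module_iff_vector_space)

lemmas biadd = modules[THEN module_biadditive]

lemma dR_scales_commute: "dR_scale_K M a (dR_scale_E M b v) = dR_scale_E M b (dR_scale_K M a v)"
proof -
  interpret D: Modules.module "dR_scale M" by (rule dR_module)
  show ?thesis by (simp add: dR_scale_K_def dR_scale_E_def tens_times_tens)
qed

sublocale RB: Modules.module RB by (rule module_tensor_scale[OF modules(1)])
sublocale KD: Modules.module KD by (rule module_tensor_scale[OF modules(2)])
sublocale RD: Modules.module RD by (rule module_tensor_scale[OF modules(3)])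

declare RB.scale_scale [simp del] KD.scale_scale [simp del] RD.scale_scale [simp del]

lemma KD_RD: "KD u (RD t y) = RD t (KD u y)"
  by (rule tensor_scale_commute[OF biadd(2,3) dR_scales_commute])

lemma KD_tens: "KD (tens k 1) (tens v z) = tens (dR_scale_K M k v) z"
  unfolding tensor_scale_simps(1)[OF biadd(2)] by simp

lemma KD_tens_1: "KD (tens 1 c) (tens v z) = tens v (c * z)"
proof -
  interpret K: Modules.module "dR_scale_K M" by (rule modules)
  show ?thesis by (simp add: tensor_scale_simps[OF biadd(2)])
qed

lemma additive_KD: "additive (KD u)" and additive_RD: "additive (RD t)" and additive_RB: "additive (RB t)"
  by (simp_all add: additive_def KD.scale_right_distrib RD.scale_right_distrib RB.scale_right_distrib)

lemma sum_KD_idem: "(\<Sum>\<sigma>\<in>Emb. KD (idem \<sigma>) y) = y"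
  unfolding KD.scale_sum_left[symmetric] sum_idem[OF nf] by (rule KD.scale_one)

lemma KD_idem_idem:
  "\<sigma> \<in> Emb \<Longrightarrow> \<tau> \<in> Emb \<Longrightarrow> KD (idem \<sigma>) (KD (idem \<tau>) y) = (if \<sigma> = \<tau> then KD (idem \<sigma>) y else 0)"
  unfolding KD.scale_scale idem_mult_idem[OF nf] by simp

text \<open>The tensor product over K along \<sigma> thus becomes the summand of M_dR \<otimes> C
  cut out by \<open>idem \<sigma>\<close>. On this summand \<open>k\<close> acts as
  \<open>\<sigma> k\<close>, which kills the generators; conversely, the components of
  \<open>y\<close> at all other embeddings are shown to be balanced.\<close>

lemma dR_balance_iff:
  assumes s: "\<sigma> \<in> Emb"
  shows "y \<in> dR_balance M \<sigma> \<longleftrightarrow> KD (idem \<sigma>) y = 0"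
proof
  have gen: "tens (dR_scale_K M k x) z - tens x (\<sigma> k * z) = KD (tens k 1 - tens 1 (\<sigma> k)) (tens x z)" for k x z
    unfolding KD.scale_left_diff_distrib KD_tens KD_tens_1 ..
  assume "y \<in> dR_balance M \<sigma>"
  then show "KD (idem \<sigma>) y = 0"
    unfolding dR_balance_def
  proof (induction rule: subgroup_generated_by.induct)
    case (1 x)
    then obtain k v z where x: "x = KD (tens k 1 - tens 1 (\<sigma> k)) (tens v z)" unfolding gen by blast
    have "idem \<sigma> * (tens k 1 - tens 1 (\<sigma> k)) = 0"
      using tens_idem[OF nf s, of k] by (simp add: right_diff_distrib mult.commute)
    then show ?case unfolding x KD.scale_scale by simp
  next
    case 2
    show ?case by (rule KD.scale_zero_right)
  next
    case (3 x y)
    then show ?case by (simp add: KD.scale_right_diff_distrib)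
  qed
next
  note sg = subgroup_generated_by.intros[where S = "{tens (dR_scale_K M k x) z - tens x (\<sigma> k * z) | k x z. True}", folded dR_balance_def]
  have uminus: "- a \<in> dR_balance M \<sigma>" if "a \<in> dR_balance M \<sigma>" for a
    using sg(3)[OF sg(2) that] by simp
  have add: "a + b \<in> dR_balance M \<sigma>" if "a \<in> dR_balance M \<sigma>" "b \<in> dR_balance M \<sigma>" for a b
    using sg(3)[OF that(1) uminus[OF that(2)]] by simp
  have sum: "sum f A \<in> dR_balance M \<sigma>" if "\<And>i. i \<in> A \<Longrightarrow> f i \<in> dR_balance M \<sigma>" for f and A :: "('k \<Rightarrow> complex) set"
    using that by (induction A rule: infinite_finite_induct) (auto intro: sg(2) add)
  have gen: "KD (tens k 1 - tens 1 (\<sigma> k)) w \<in> dR_balance M \<sigma>" for k w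
  proof (induction w)
    case zero
    then show ?case using sg(2) by simp
  next
    case (add v z w)
    have "KD (tens k 1 - tens 1 (\<sigma> k)) (tens v z) = tens (dR_scale_K M k v) z - tens v (\<sigma> k * z)"
      unfolding KD.scale_left_diff_distrib KD_tens KD_tens_1 ..
    then have "KD (tens k 1 - tens 1 (\<sigma> k)) (tens v z) \<in> dR_balance M \<sigma>" using sg(1) by blast
    then show ?case unfolding KD.scale_right_distrib using add by (rule \<open>\<And>a b. _ \<Longrightarrow> _ \<Longrightarrow> a + b \<in> _\<close>)
  qed
  assume 0: "KD (idem \<sigma>) y = 0"
  have "KD (idem \<tau>) y \<in> dR_balance M \<sigma>" if t: "\<tau> \<in> Emb" for \<tau>
  proof (cases "\<tau> = \<sigma>")
    case True
    then show ?thesis using 0 sg(2) by simp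
  next
    case False
    then obtain k where k: "\<tau> k \<noteq> \<sigma> k" by (auto simp: fun_eq_iff)
    \<comment> \<open>On the summand of \<tau> the element
      \<open>tens k 1 - tens 1 (\<sigma> k)\<close> acts as the nonzero number
      \<open>\<tau> k - \<sigma> k\<close>; dividing by it exhibits the component as a balanced
      element.\<close>
    let ?c = "tens 1 (inverse (\<tau> k - \<sigma> k)) :: ('k, complex) tensor"
    have "(tens k 1 - tens 1 (\<sigma> k)) * (?c * idem \<tau>) = ?c * (tens k 1 * idem \<tau> - tens 1 (\<sigma> k) * idem \<tau>)"
      by (simp only: left_diff_distrib right_diff_distrib mult_ac)
    also have "\<dots> = ?c * (tens 1 (\<tau> k - \<sigma> k) * idem \<tau>)"
      by (simp only: tens_idem[OF nf t] tens_diff_right left_diff_distrib)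
    also have "\<dots> = tens 1 (inverse (\<tau> k - \<sigma> k) * (\<tau> k - \<sigma> k)) * idem \<tau>"
      by (simp only: tens_1_mult mult.assoc)
    also have "\<dots> = idem \<tau>" using k by (simp flip: one_tensor_def)
    finally have "KD (tens k 1 - tens 1 (\<sigma> k)) (KD (?c * idem \<tau>) y) = KD (idem \<tau>) y"
      by (simp only: KD.scale_scale)
    then show ?thesis using gen[of k "KD (?c * idem \<tau>) y"] by simp
  qed
  then have "(\<Sum>\<tau>\<in>Emb. KD (idem \<tau>) y) \<in> dR_balance M \<sigma>" by (rule sum)
  then show "y \<in> dR_balance M \<sigma>" by (simp only: sum_KD_idem)
qed

lemma dR_coset_eq: "\<sigma> \<in> Emb \<Longrightarrow> dR_coset M \<sigma> y = {y'. KD (idem \<sigma>) y' = KD (idem \<sigma>) y}"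
  by (simp add: dR_coset_def dR_balance_iff KD.scale_right_diff_distrib)

text \<open>The comparison map with values in the summand \<open>e\<^sub>\<sigma> (M\<^sub>d\<^sub>R \<otimes> \<complex>)\<close> in place of a quotient.\<close>

definition cmp :: "('k \<Rightarrow> complex) \<Rightarrow> ('b, complex) tensor \<Rightarrow> ('d, complex) tensor" where
  "cmp \<sigma> x = KD (idem \<sigma>) (SOME y. y \<in> comparison M \<sigma> x)"

lemma comparison_eq:
  assumes "\<sigma> \<in> Emb" "x \<in> CB \<sigma>"
  shows "comparison M \<sigma> x = {y. KD (idem \<sigma>) y = cmp \<sigma> x}"
proof -
  have "comparison M \<sigma> x \<in> range (dR_coset M \<sigma>)"
    using comparison_bij[OF assms(1)] assms(2) by (rule bij_betw_apply)
  then obtain y where y: "comparison M \<sigma> x = {y'. KD (idem \<sigma>) y' = KD (idem \<sigma>) y}"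
    using dR_coset_eq[OF assms(1)] by blast
  then have "y \<in> comparison M \<sigma> x" by blast
  then have "(SOME y. y \<in> comparison M \<sigma> x) \<in> comparison M \<sigma> x" by (rule someI)
  then have "cmp \<sigma> x = KD (idem \<sigma>) y" unfolding cmp_def using y by blast
  then show ?thesis using y by simp
qed

lemma cmp_eq_iff: "\<sigma> \<in> Emb \<Longrightarrow> x \<in> CB \<sigma> \<Longrightarrow> y \<in> comparison M \<sigma> x \<longleftrightarrow> KD (idem \<sigma>) y = cmp \<sigma> x"
  by (simp add: comparison_eq)

lemma idem_cmp:
  assumes "\<sigma> \<in> Emb" "\<tau> \<in> Emb"
  shows "KD (idem \<tau>) (cmp \<sigma> x) = (if \<tau> = \<sigma> then cmp \<sigma> x else 0)"
  unfolding cmp_def KD_idem_idem[OF assms(2,1)] by simp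

lemma idem_cmp_same: "\<sigma> \<in> Emb \<Longrightarrow> KD (idem \<sigma>) (cmp \<sigma> x) = cmp \<sigma> x"
  by (simp add: idem_cmp)

lemma cmp_in_comparison: "\<sigma> \<in> Emb \<Longrightarrow> x \<in> CB \<sigma> \<Longrightarrow> cmp \<sigma> x \<in> comparison M \<sigma> x"
  by (simp add: comparison_eq idem_cmp)

lemma cmp_add:
  assumes "\<sigma> \<in> Emb" "x \<in> CB \<sigma>" "y \<in> CB \<sigma>"
  shows "cmp \<sigma> (x + y) = cmp \<sigma> x + cmp \<sigma> y"
  using comparison_add[OF assms(1,2) cmp_in_comparison[OF assms(1,2)] assms(3) cmp_in_comparison[OF assms(1,3)]]
  by (simp add: cmp_eq_iff[OF assms(1)] complexification_add assms KD.scale_right_distrib idem_cmp)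

lemma CB_scale:
  assumes "\<sigma> \<in> Emb" "x \<in> CB \<sigma>"
  shows "RB t x \<in> CB \<sigma>"
proof -
  interpret B: vector_space "betti_scale M" by (rule betti_vector_space)
  show ?thesis by (rule complexification_scale[OF assms(2) modules(1)]) (rule B.subspace_scale[OF betti_subspace[OF assms(1)]])
qed

lemma cmp_scale:
  assumes "\<sigma> \<in> Emb" "x \<in> CB \<sigma>"
  shows "cmp \<sigma> (RB t x) = RD t (cmp \<sigma> x)"
  using comparison_scale[OF assms cmp_in_comparison[OF assms], of t]
  by (simp add: cmp_eq_iff[OF assms(1)] CB_scale assms KD_RD idem_cmp)

lemma cmp_0: "\<sigma> \<in> Emb \<Longrightarrow> cmp \<sigma> 0 = 0"
  using cmp_add[of \<sigma> 0 0] by (simp add: complexification_0)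

lemma cmp_sum:
  assumes "\<sigma> \<in> Emb" "\<And>i. i \<in> A \<Longrightarrow> f i \<in> CB \<sigma>"
  shows "cmp \<sigma> (sum f A) = (\<Sum>i\<in>A. cmp \<sigma> (f i))"
  using assms(2)
  by (induction A rule: infinite_finite_induct) (simp_all add: cmp_0 cmp_add assms(1) complexification_sum)

lemma cmp_diff: "\<sigma> \<in> Emb \<Longrightarrow> x \<in> CB \<sigma> \<Longrightarrow> y \<in> CB \<sigma> \<Longrightarrow> cmp \<sigma> (x - y) = cmp \<sigma> x - cmp \<sigma> y"
  using cmp_add[of \<sigma> "x - y" y] by (simp add: complexification_diff)

lemma cmp_inj:
  assumes "\<sigma> \<in> Emb" "x \<in> CB \<sigma>" "y \<in> CB \<sigma>" "cmp \<sigma> x = cmp \<sigma> y"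
  shows "x = y"
proof (rule inj_onD[OF bij_betw_imp_inj_on[OF comparison_bij[OF assms(1)]] _ assms(2,3)])
  show "comparison M \<sigma> x = comparison M \<sigma> y"
    by (simp only: comparison_eq[OF assms(1,2)] comparison_eq[OF assms(1,3)] assms(4))
qed

text \<open>The inverse of the comparison at \<sigma>, preceded by the projection to the summand of
  \<sigma>, so that it is defined and additive on all of M_dR \<otimes> C.\<close>

definition cinv :: "('k \<Rightarrow> complex) \<Rightarrow> ('d, complex) tensor \<Rightarrow> ('b, complex) tensor" where
  "cinv \<sigma> y = (THE x. x \<in> CB \<sigma> \<and> cmp \<sigma> x = KD (idem \<sigma>) y)"

lemma cinv:
  assumes "\<sigma> \<in> Emb"
  shows "cinv \<sigma> y \<in> CB \<sigma>" "cmp \<sigma> (cinv \<sigma> y) = KD (idem \<sigma>) y"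
proof -
  have "dR_coset M \<sigma> y \<in> comparison M \<sigma> ` CB \<sigma>"
    using bij_betw_imp_surj_on[OF comparison_bij[OF assms]] by blast
  then obtain x where x: "x \<in> CB \<sigma>" "dR_coset M \<sigma> y = comparison M \<sigma> x" by blast
  moreover have "y \<in> dR_coset M \<sigma> y" by (simp add: dR_coset_eq assms)
  ultimately have "cmp \<sigma> x = KD (idem \<sigma>) y"
    using cmp_eq_iff[OF assms x(1), of y] by simp
  then have "x \<in> CB \<sigma> \<and> cmp \<sigma> x = KD (idem \<sigma>) y" using x by simp
  then have "cinv \<sigma> y \<in> CB \<sigma> \<and> cmp \<sigma> (cinv \<sigma> y) = KD (idem \<sigma>) y"
    unfolding cinv_def
  proof (rule theI)
    show "x' = x" if "x' \<in> CB \<sigma> \<and> cmp \<sigma> x' = KD (idem \<sigma>) y" for x'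
      using that \<open>cmp \<sigma> x = KD (idem \<sigma>) y\<close> by (intro cmp_inj[OF assms _ x(1)]) simp_all
  qed
  then show "cinv \<sigma> y \<in> CB \<sigma>" "cmp \<sigma> (cinv \<sigma> y) = KD (idem \<sigma>) y" by blast+
qed

lemma cinv_eqI:
  assumes "\<sigma> \<in> Emb" "x \<in> CB \<sigma>" "cmp \<sigma> x = KD (idem \<sigma>) y"
  shows "cinv \<sigma> y = x"
  by (rule cmp_inj[OF assms(1) cinv(1)[OF assms(1)] assms(2)]) (simp only: cinv(2)[OF assms(1)] assms(3))

lemma cinv_cmp: "\<sigma> \<in> Emb \<Longrightarrow> x \<in> CB \<sigma> \<Longrightarrow> cinv \<sigma> (cmp \<sigma> x) = x"
  by (rule cinv_eqI) (simp_all only: idem_cmp_same)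

lemma additive_cinv: "\<sigma> \<in> Emb \<Longrightarrow> additive (cinv \<sigma>)"
  by (rule additive.intro, rule cinv_eqI)
    (simp_all only: cinv complexification_add cmp_add[OF _ cinv(1) cinv(1)] KD.scale_right_distrib)

lemma cinv_scale: "\<sigma> \<in> Emb \<Longrightarrow> cinv \<sigma> (RD t y) = RB t (cinv \<sigma> y)"
  by (rule cinv_eqI) (simp_all only: CB_scale[OF _ cinv(1)] cmp_scale[OF _ cinv(1)] cinv(2) KD_RD)

lemma cinv_KD_idem:
  assumes "\<sigma> \<in> Emb" "\<tau> \<in> Emb"
  shows "cinv \<sigma> (KD (idem \<tau>) y) = (if \<sigma> = \<tau> then cinv \<sigma> y else 0)"
  using assms by (intro cinv_eqI) (simp_all add: cinv KD_idem_idem complexification_0 cmp_0)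

lemma conj_KD: "\<sigma> \<in> Emb \<Longrightarrow> conj_tensor (KD (idem \<sigma>) y) = KD (idem (conj_emb \<sigma>)) (conj_tensor y)"
  by (simp only: conj_tensor_scale[OF biadd(2)] cnj_idem[OF nf])

lemma conj_cmp_tens:
  assumes "\<sigma> \<in> Emb" "v \<in> betti M \<sigma>"
  shows "conj_tensor (cmp \<sigma> (tens v z)) = cmp (conj_emb \<sigma>) (tens (frob M \<sigma> v) (cnj z))"
proof -
  note c = conj_emb_embedding[OF assms(1)]
  have "conj_tensor (cmp \<sigma> (tens v z)) \<in> comparison M (conj_emb \<sigma>) (tens (frob M \<sigma> v) (cnj z))"
    using comparison_conj[OF assms] cmp_in_comparison[OF assms(1) complexification_tens[OF assms(2)]] by blast
  then have "KD (idem (conj_emb \<sigma>)) (conj_tensor (cmp \<sigma> (tens v z))) = cmp (conj_emb \<sigma>) (tens (frob M \<sigma> v) (cnj z))"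
    using cmp_eq_iff[OF c complexification_tens[OF frob_betti(1)[OF assms]]] by blast
  then show ?thesis by (simp only: conj_KD[OF assms(1), symmetric] idem_cmp_same[OF assms(1)])
qed

text \<open>The \<open>E \<otimes> \<complex>\<close>-linear extension of the infinite Frobenius, transported to \<open>M\<^sub>d\<^sub>R \<otimes> \<complex>\<close>:
  the composition of the conjugations of the two structures.\<close>

definition frobC :: "('d, complex) tensor \<Rightarrow> ('d, complex) tensor" where
  "frobC y = (\<Sum>\<sigma>\<in>Emb. conj_tensor (cmp \<sigma> (conj_tensor (cinv \<sigma> y))))"

lemma conj_cinv: "\<sigma> \<in> Emb \<Longrightarrow> conj_tensor (cinv \<sigma> y) \<in> CB \<sigma>"
  by (intro conj_tensor_complexification cinv)

lemma additive_frobC: "additive frobC"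
proof (rule additive.intro)
  fix x y
  have "conj_tensor (cmp \<sigma> (conj_tensor (cinv \<sigma> (x + y)))) = conj_tensor (cmp \<sigma> (conj_tensor (cinv \<sigma> x))) + conj_tensor (cmp \<sigma> (conj_tensor (cinv \<sigma> y)))"
    if s: "\<sigma> \<in> Emb" for \<sigma>
    by (simp only: additive.add[OF additive_cinv[OF s]] additive.add[OF additive_conj_tensor] cmp_add[OF s conj_cinv[OF s] conj_cinv[OF s]])
  then show "frobC (x + y) = frobC x + frobC y" unfolding frobC_def by (simp add: sum.distrib)
qed

lemma frobC_scale: "frobC (RD t y) = RD t (frobC y)"
  unfolding frobC_def RD.scale_sum_right
proof (rule sum.cong[OF refl])
  fix \<sigma> :: "'k \<Rightarrow> complex" assume s: "\<sigma> \<in> Emb"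
  show "conj_tensor (cmp \<sigma> (conj_tensor (cinv \<sigma> (RD t y)))) = RD t (conj_tensor (cmp \<sigma> (conj_tensor (cinv \<sigma> y))))"
    by (simp only: cinv_scale[OF s] conj_tensor_scale[OF biadd(1)] cmp_scale[OF s conj_cinv[OF s]]
        conj_tensor_scale[OF biadd(3)] conj_tensor_conj_tensor)
qed

lemma frobC_KD_idem:
  assumes s: "\<sigma> \<in> Emb"
  shows "frobC (KD (idem \<sigma>) y) = conj_tensor (cmp \<sigma> (conj_tensor (cinv \<sigma> y)))"
proof -
  have "frobC (KD (idem \<sigma>) y) = (\<Sum>\<tau>\<in>Emb. if \<tau> = \<sigma> then conj_tensor (cmp \<sigma> (conj_tensor (cinv \<sigma> y))) else 0)"
    unfolding frobC_def
    by (intro sum.cong refl) (simp add: cinv_KD_idem s cmp_0 additive.zero[OF additive_conj_tensor])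
  then show ?thesis using s idempotents_exist(1)[OF nf] by simp
qed

text \<open>The two conjugations cancel on the complex factor, and what remains is Frobenius on the
  Betti side. Compatibility of the comparison with complex conjugation is used below in this
  form.\<close>

lemma frobC_cmp_tens:
  assumes s: "\<sigma> \<in> Emb" and v: "v \<in> betti M \<sigma>"
  shows "frobC (cmp \<sigma> (tens v z)) = cmp (conj_emb \<sigma>) (tens (frob M \<sigma> v) z)"
proof -
  have "frobC (cmp \<sigma> (tens v z)) = frobC (KD (idem \<sigma>) (cmp \<sigma> (tens v z)))" by (simp add: idem_cmp s)
  also have "\<dots> = conj_tensor (cmp \<sigma> (tens v (cnj z)))"
    by (simp only: frobC_KD_idem[OF s] cinv_cmp[OF s complexification_tens[OF v]] conj_tensor_tens)
  finally show ?thesis by (simp only: conj_cmp_tens[OF s v] complex_cnj_cnj)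
qed

lemma KD_idem_frobC:
  assumes s: "\<sigma> \<in> Emb"
  shows "KD (idem (conj_emb \<sigma>)) (frobC y) = frobC (KD (idem \<sigma>) y)"
proof -
  have "KD (idem (conj_emb \<sigma>)) (frobC y) = (\<Sum>\<tau>\<in>Emb. if \<tau> = \<sigma> then conj_tensor (cmp \<sigma> (conj_tensor (cinv \<sigma> y))) else 0)"
    unfolding frobC_def KD.scale_sum_right
    by (intro sum.cong refl)
      (simp add: conj_KD[OF s, symmetric] idem_cmp s additive.zero[OF additive_conj_tensor])
  then show ?thesis using s idempotents_exist(1)[OF nf] by (simp add: frobC_KD_idem[OF s])
qed

lemma frobC_frobC: "frobC (frobC y) = y"
proof -
  have "frobC (frobC (cmp \<sigma> x)) = cmp \<sigma> x" if s: "\<sigma> \<in> Emb" and "x \<in> CB \<sigma>" for \<sigma> x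
    using that(2)
  proof (induction rule: complexification_induct)
    case (tens v z)
    then show ?case by (simp add: frobC_cmp_tens s frob_betti conj_emb_embedding)
  next
    case zero
    then show ?case by (simp add: cmp_0 s additive.zero[OF additive_frobC])
  next
    case (diff x y)
    then show ?case by (simp add: cmp_diff s additive.diff[OF additive_frobC])
  qed
  note cmp_case = this
  have "frobC (frobC (KD (idem \<sigma>) y)) = KD (idem \<sigma>) y" if "\<sigma> \<in> Emb" for \<sigma>
    using cmp_case[OF that cinv(1)[OF that, of y]] by (simp only: cinv(2)[OF that])
  then have "(\<Sum>\<sigma>\<in>Emb. frobC (frobC (KD (idem \<sigma>) y))) = (\<Sum>\<sigma>\<in>Emb. KD (idem \<sigma>) y)" by simp
  then show ?thesis
    unfolding additive.sum[OF additive_frobC, symmetric] sum_KD_idem .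
qed

abbreviation "FilC p \<equiv> complexification (filt M p)"

lemma filt_scale: "v \<in> filt M p \<Longrightarrow> dR_scale_K M k v \<in> filt M p" "v \<in> filt M p \<Longrightarrow> dR_scale_E M e v \<in> filt M p"
proof -
  interpret D: Modules.module "dR_scale M" by (rule dR_module)
  show "v \<in> filt M p \<Longrightarrow> dR_scale_K M k v \<in> filt M p" "v \<in> filt M p \<Longrightarrow> dR_scale_E M e v \<in> filt M p"
    using D.subspace_scale[OF filt_subspace] by (simp_all add: dR_scale_K_def dR_scale_E_def)
qed

lemma FilC_scale: "y \<in> FilC p \<Longrightarrow> KD u y \<in> FilC p" "y \<in> FilC p \<Longrightarrow> RD t y \<in> FilC p"
  by (erule complexification_scale[OF _ modules(2)], erule filt_scale)
    (erule complexification_scale[OF _ modules(3)], erule filt_scale)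

text \<open>The steps of the filtration are stable under K \<otimes> C, so a coset meets one of them
  exactly if its representative in the summand, obtained by applying \<open>idem \<sigma>\<close>,
  lies in it.\<close>

lemma hodge_iff:
  assumes s: "\<sigma> \<in> Emb"
  shows "x \<in> hodge M \<sigma> p q \<longleftrightarrow> x \<in> CB \<sigma> \<and> cmp \<sigma> x \<in> FilC p \<and> cmp \<sigma> (conj_tensor x) \<in> FilC q"
proof -
  have "comparison M \<sigma> x \<inter> FilC p \<noteq> {} \<longleftrightarrow> cmp \<sigma> x \<in> FilC p" if x: "x \<in> CB \<sigma>" for x p
  proof
    assume "comparison M \<sigma> x \<inter> FilC p \<noteq> {}"
    then obtain y where "y \<in> FilC p" "KD (idem \<sigma>) y = cmp \<sigma> x" using cmp_eq_iff[OF s x] by blast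
    then show "cmp \<sigma> x \<in> FilC p" using FilC_scale(1) by metis
  qed (use cmp_in_comparison[OF s x] in blast)
  then show ?thesis unfolding hodge_def using conj_tensor_complexification[of x "betti M \<sigma>"] by blast
qed

end

section \<open>\<open>FilW\<close> and its Frobenius image as complements\<close>

context bdr_over
begin

abbreviation "FilV \<equiv> filt M (weight M div 2 + 1)"
abbreviation "FilW \<equiv> complexification FilV"

lemma zero_in_hodge: "\<sigma> \<in> Emb \<Longrightarrow> 0 \<in> hodge M \<sigma> p q"
  by (simp add: hodge_iff complexification_0 cmp_0 additive.zero[OF additive_conj_tensor])

lemma FilC_mono: "y \<in> FilC q \<Longrightarrow> p \<le> q \<Longrightarrow> y \<in> FilC p"
  by (rule complexification_mono[OF _ filt_antimono])

text \<open>The Hodge decomposition is cut at \<open>m = w div 2 + 1\<close>. A component with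
  \<open>p < m\<close> has its conjugate in the step \<open>w - p\<close>, and
  \<open>w - p \<ge> m\<close> fails only for \<open>w = 2 * p\<close>, the case excluded by the
  vanishing middle Hodge number.\<close>

lemma hodge_split:
  assumes vm: "vanishing_middle_hodge_number M" and s: "\<sigma> \<in> Emb" and x: "x \<in> CB \<sigma>"
  obtains x1 x2 where "x1 \<in> CB \<sigma>" "x2 \<in> CB \<sigma>" "x = x1 + x2" "cmp \<sigma> x1 \<in> FilW" "cmp \<sigma> (conj_tensor x2) \<in> FilW"
proof -
  define w m where "w = weight M" and "m = w div 2 + 1"
  obtain h where h: "finite {p. h p \<noteq> 0}" "\<And>p. h p \<in> hodge M \<sigma> p (w - p)" "x = (\<Sum>p | h p \<noteq> 0. h p)"
    using ex1_implies_ex[OF hodge_decomposition[OF s x]] unfolding w_def by blast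
  have hp: "h p \<in> CB \<sigma>" "cmp \<sigma> (h p) \<in> FilC p" "cmp \<sigma> (conj_tensor (h p)) \<in> FilC (w - p)" for p
    using h(2)[of p] unfolding hodge_iff[OF s] by simp_all
  have c: "conj_tensor (h p) \<in> CB \<sigma>" for p by (intro conj_tensor_complexification hp)
  let ?A = "{p. h p \<noteq> 0 \<and> m \<le> p}" and ?B = "{p. h p \<noteq> 0 \<and> \<not> m \<le> p}"
  show ?thesis
  proof (rule that[of "sum h ?A" "sum h ?B"])
    show "sum h ?A \<in> CB \<sigma>" "sum h ?B \<in> CB \<sigma>" by (intro complexification_sum hp)+
    have "finite ?A" "finite ?B" by (rule finite_subset[OF _ h(1)]; blast)+
    moreover have "{p. h p \<noteq> 0} = ?A \<union> ?B" by blast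
    ultimately show "x = sum h ?A + sum h ?B"
      unfolding h(3) by (simp only:) (rule sum.union_disjoint, auto)
    have "cmp \<sigma> (h p) \<in> FilC m" if "p \<in> ?A" for p
      using FilC_mono[OF hp(2)[of p], of m] that by simp
    then show "cmp \<sigma> (sum h ?A) \<in> FilW"
      unfolding cmp_sum[OF s hp(1)] by (intro complexification_sum) (simp add: m_def w_def)
    have "cmp \<sigma> (conj_tensor (h p)) \<in> FilC m" if p: "p \<in> ?B" for p
    proof (rule FilC_mono[OF hp(3)[of p]])
      from vm consider "odd w" | k where "w = 2 * k" "\<forall>\<sigma>\<in>Emb. hodge M \<sigma> k k = {0}"
        by (auto simp: vanishing_middle_hodge_number_def w_def)
      then show "m \<le> w - p"
      proof cases
        case 1
        then show ?thesis using p unfolding m_def by (auto elim!: oddE)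
      next
        case 2
        have "p \<noteq> k"
        proof
          assume "p = k"
          then have "h p \<in> hodge M \<sigma> k k" using h(2)[of k] 2(1) by simp
          then show False using 2(2) s p by auto
        qed
        then show ?thesis using p 2(1) unfolding m_def by auto
      qed
    qed
    then show "cmp \<sigma> (conj_tensor (sum h ?B)) \<in> FilW"
      unfolding additive.sum[OF additive_conj_tensor] cmp_sum[OF s c]
      by (intro complexification_sum) (simp add: m_def w_def)
  qed
qed

text \<open>As \<open>w - m < m\<close>, a nonzero \<open>x\<close> would be of type
  \<open>(m, w - m)\<close> and also of type \<open>(w - m, m)\<close>. This would give two
  different Hodge decompositions of \<open>x\<close>, each with a single component.\<close>

lemma hodge_inter:
  assumes s: "\<sigma> \<in> Emb" and x: "x \<in> CB \<sigma>" "cmp \<sigma> x \<in> FilW" "cmp \<sigma> (conj_tensor x) \<in> FilW"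
  shows "x = 0"
proof (rule ccontr)
  assume "x \<noteq> 0"
  define w m where "w = weight M" and "m = w div 2 + 1"
  have m: "w - m \<le> m" "w - m \<noteq> m" unfolding m_def by presburger+
  have FilW: "FilW = FilC m" by (simp add: m_def w_def)
  define h where "h p0 p = (if p = p0 then x else 0)" for p0 p :: int
  have supp: "{p. h p0 p \<noteq> 0} = {p0}" for p0 using \<open>x \<noteq> 0\<close> by (auto simp: h_def)
  have hodge: "x \<in> hodge M \<sigma> m (w - m)" "x \<in> hodge M \<sigma> (w - m) (w - (w - m))"
    using x FilC_mono[OF _ m(1)] unfolding hodge_iff[OF s] FilW by simp_all
  let ?P = "\<lambda>h. finite {p. h p \<noteq> 0} \<and> (\<forall>p. h p \<in> hodge M \<sigma> p (w - p)) \<and> x = (\<Sum>p | h p \<noteq> 0. h p)"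
  have P: "?P (h p0)" if "x \<in> hodge M \<sigma> p0 (w - p0)" for p0
    unfolding supp using that zero_in_hodge[OF s] by (simp add: h_def)
  have "h m = h (w - m)"
    using hodge_decomposition[OF s x(1), folded w_def] P[OF hodge(1)] P[OF hodge(2)] by blast
  then have "h m m = h (w - m) m" by simp
  then show False using m(2) \<open>x \<noteq> 0\<close> by (simp add: h_def)
qed

lemma frobC_cmp: "\<sigma> \<in> Emb \<Longrightarrow> x \<in> CB \<sigma> \<Longrightarrow> frobC (cmp \<sigma> x) = conj_tensor (cmp \<sigma> (conj_tensor x))"
  using frobC_KD_idem[of \<sigma> "cmp \<sigma> x"] by (simp only: idem_cmp_same cinv_cmp)

text \<open>On the Betti side the second part has its conjugate in the filtration. Since
  \<open>FilW\<close> is stable under conjugation, \<open>frobC_cmp\<close> turns this into a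
  condition on \<open>frobC g\<close>. Together with \<open>Fil_inter\<close> the two subspaces are
  complementary.\<close>

lemma Fil_split:
  assumes "vanishing_middle_hodge_number M"
  obtains f g where "y = f + g" "f \<in> FilW" "frobC g \<in> FilW"
proof -
  have "\<exists>x1 x2. x1 \<in> CB \<sigma> \<and> x2 \<in> CB \<sigma> \<and> cinv \<sigma> y = x1 + x2 \<and> cmp \<sigma> x1 \<in> FilW \<and> cmp \<sigma> (conj_tensor x2) \<in> FilW"
    if "\<sigma> \<in> Emb" for \<sigma>
    using hodge_split[OF assms that cinv(1)[OF that], of y] by metis
  then obtain x1 x2 where x: "\<And>\<sigma>. \<sigma> \<in> Emb \<Longrightarrow> x1 \<sigma> \<in> CB \<sigma>" "\<And>\<sigma>. \<sigma> \<in> Emb \<Longrightarrow> x2 \<sigma> \<in> CB \<sigma>"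
    "\<And>\<sigma>. \<sigma> \<in> Emb \<Longrightarrow> cinv \<sigma> y = x1 \<sigma> + x2 \<sigma>" "\<And>\<sigma>. \<sigma> \<in> Emb \<Longrightarrow> cmp \<sigma> (x1 \<sigma>) \<in> FilW"
    "\<And>\<sigma>. \<sigma> \<in> Emb \<Longrightarrow> cmp \<sigma> (conj_tensor (x2 \<sigma>)) \<in> FilW"
    by metis
  show ?thesis
  proof (rule that)
    have "y = (\<Sum>\<sigma>\<in>Emb. cmp \<sigma> (cinv \<sigma> y))"
      using sum_KD_idem[of y] by (simp add: cinv(2) cong: sum.cong)
    also have "\<dots> = (\<Sum>\<sigma>\<in>Emb. cmp \<sigma> (x1 \<sigma>) + cmp \<sigma> (x2 \<sigma>))"
      by (intro sum.cong refl) (simp only: x(3) cmp_add[OF _ x(1,2)])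
    finally show "y = (\<Sum>\<sigma>\<in>Emb. cmp \<sigma> (x1 \<sigma>)) + (\<Sum>\<sigma>\<in>Emb. cmp \<sigma> (x2 \<sigma>))"
      by (simp only: sum.distrib)
    show "(\<Sum>\<sigma>\<in>Emb. cmp \<sigma> (x1 \<sigma>)) \<in> FilW" by (intro complexification_sum x)
    show "frobC (\<Sum>\<sigma>\<in>Emb. cmp \<sigma> (x2 \<sigma>)) \<in> FilW"
      unfolding additive.sum[OF additive_frobC]
    proof (rule complexification_sum)
      fix \<sigma> :: "'k \<Rightarrow> complex" assume s: "\<sigma> \<in> Emb"
      show "frobC (cmp \<sigma> (x2 \<sigma>)) \<in> FilW"
        unfolding frobC_cmp[OF s x(2)[OF s]] by (intro conj_tensor_complexification x s)
    qed
  qed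
qed

lemma Fil_inter:
  assumes "y \<in> FilW" "frobC y \<in> FilW"
  shows "y = 0"
proof -
  have "KD (idem \<sigma>) y = 0" if s: "\<sigma> \<in> Emb" for \<sigma>
  proof -
    have "cmp \<sigma> (cinv \<sigma> y) \<in> FilW" unfolding cinv(2)[OF s] by (rule FilC_scale(1)[OF assms(1)])
    moreover have "conj_tensor (KD (idem (conj_emb \<sigma>)) (frobC y)) \<in> FilW"
      by (intro conj_tensor_complexification FilC_scale assms(2))
    then have "cmp \<sigma> (conj_tensor (cinv \<sigma> y)) \<in> FilW"
      unfolding KD_idem_frobC[OF s] frobC_KD_idem[OF s] conj_tensor_conj_tensor .
    ultimately have "cinv \<sigma> y = 0" by (rule hodge_inter[OF s cinv(1)[OF s]])
    then show ?thesis using cinv(2)[OF s, of y] cmp_0[OF s] by simp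
  qed
  then show ?thesis using sum_KD_idem[of y] by simp
qed

end

section \<open>Betti bases over one half of the embeddings\<close>

locale bdr_betti_basis = bdr_over M
  for M :: "('k::field_char_0, 'e::field_char_0, 'b::ab_group_add, 'd::ab_group_add) bdr" +
  fixes \<Phi> :: "('k \<Rightarrow> complex) set" and B :: "('k \<Rightarrow> complex) \<Rightarrow> 'b set"
    and lB :: "('k \<Rightarrow> complex) \<Rightarrow> 'b \<Rightarrow> 'b \<Rightarrow> 'e"
  assumes vm: "vanishing_middle_hodge_number M"
    and Phi: "\<Phi> \<subseteq> embeddings UNIV" "\<And>\<sigma>. \<sigma> \<in> embeddings UNIV \<Longrightarrow> \<sigma> \<in> \<Phi> \<longleftrightarrow> conj_emb \<sigma> \<notin> \<Phi>"
    and B: "\<And>\<sigma>. \<sigma> \<in> \<Phi> \<Longrightarrow> finite (B \<sigma>)" "\<And>\<sigma>. \<sigma> \<in> \<Phi> \<Longrightarrow> B \<sigma> \<subseteq> betti M \<sigma>"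
    and lB: "\<And>\<sigma> b. \<sigma> \<in> \<Phi> \<Longrightarrow> additive (lB \<sigma> b)"
      "\<And>\<sigma> b a x. \<sigma> \<in> \<Phi> \<Longrightarrow> lB \<sigma> b (betti_scale M a x) = a * lB \<sigma> b x"
      "\<And>\<sigma> b b'. \<sigma> \<in> \<Phi> \<Longrightarrow> b' \<in> B \<sigma> \<Longrightarrow> lB \<sigma> b b' = (if b' = b then 1 else 0)"
      "\<And>\<sigma> x. \<sigma> \<in> \<Phi> \<Longrightarrow> x \<in> betti M \<sigma> \<Longrightarrow> x = (\<Sum>b\<in>B \<sigma>. betti_scale M (lB \<sigma> b x) b)"
begin

definition J :: "(('k \<Rightarrow> complex) \<times> 'b) set" where "J = Sigma \<Phi> B"

text \<open>The vectors \<open>u j\<close> and \<open>frobC (u j)\<close> form a basis of M_dR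
  \<otimes> C over E \<otimes> C; the coordinates of \<open>y\<close> in it are
  \<open>cu j y\<close> and \<open>cu j (frobC y)\<close>.\<close>

definition u :: "('k \<Rightarrow> complex) \<times> 'b \<Rightarrow> ('d, complex) tensor" where
  "u j = cmp (fst j) (tens (snd j) 1)"

definition cu :: "('k \<Rightarrow> complex) \<times> 'b \<Rightarrow> ('d, complex) tensor \<Rightarrow> ('e, complex) tensor" where
  "cu j y = linear_ext (lB (fst j) (snd j)) (cinv (fst j) y)"

lemma finite_Phi: "finite \<Phi>" by (rule finite_subset[OF Phi(1) idempotents_exist(1)[OF nf]])

lemma finite_J: "finite J" unfolding J_def by (intro finite_SigmaI finite_Phi B)

lemma PhiD: "\<sigma> \<in> \<Phi> \<Longrightarrow> \<sigma> \<in> Emb" "\<sigma> \<in> \<Phi> \<Longrightarrow> conj_emb \<sigma> \<in> Emb" "\<sigma> \<in> \<Phi> \<Longrightarrow> conj_emb \<sigma> \<notin> \<Phi>"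
  using Phi conj_emb_embedding by auto

lemma sum_Emb: "(\<Sum>\<sigma>\<in>Emb. f \<sigma>) = (\<Sum>\<sigma>\<in>\<Phi>. f \<sigma> + f (conj_emb \<sigma>))"
proof -
  have Emb: "Emb = \<Phi> \<union> conj_emb ` \<Phi>"
  proof
    show "\<Phi> \<union> conj_emb ` \<Phi> \<subseteq> Emb" using PhiD by auto
    show "Emb \<subseteq> \<Phi> \<union> conj_emb ` \<Phi>"
    proof
      fix \<sigma> :: "'k \<Rightarrow> complex" assume "\<sigma> \<in> Emb"
      then show "\<sigma> \<in> \<Phi> \<union> conj_emb ` \<Phi>" using Phi(2)[of \<sigma>] by (cases "\<sigma> \<in> \<Phi>") (auto intro: image_eqI[of \<sigma> conj_emb "conj_emb \<sigma>"])
    qed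
  qed
  have "\<Phi> \<inter> conj_emb ` \<Phi> = {}" using PhiD by auto
  then have "(\<Sum>\<sigma>\<in>Emb. f \<sigma>) = sum f \<Phi> + sum f (conj_emb ` \<Phi>)"
    unfolding Emb using finite_Phi by (intro sum.union_disjoint) auto
  also have "sum f (conj_emb ` \<Phi>) = (\<Sum>\<sigma>\<in>\<Phi>. f (conj_emb \<sigma>))"
    by (subst sum.reindex) (simp_all add: inj_on_inverseI[where g = conj_emb])
  finally show ?thesis by (simp only: sum.distrib)
qed

lemma JD: assumes "j \<in> J"
  shows "fst j \<in> \<Phi>" "snd j \<in> B (fst j)" "snd j \<in> betti M (fst j)" "fst j \<in> Emb"
  using assms B(2)[of "fst j"] PhiD(1)[of "fst j"] by (auto simp: J_def)

lemma additive_cu: "j \<in> J \<Longrightarrow> additive (cu j)"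
  unfolding cu_def by (rule additive_comp[OF additive_linear_ext[OF lB(1)] additive_cinv]) (auto dest: JD)

lemma cu_scale: "j \<in> J \<Longrightarrow> cu j (RD t y) = t * cu j y"
  unfolding cu_def cinv_scale[OF JD(4)] by (rule linear_ext_scale[OF biadd(1) lB(1) lB(2)]) (rule JD(1), assumption)+

lemma cu_u:
  assumes "i \<in> J" "j \<in> J"
  shows "cu j (u i) = (if i = j then 1 else 0)"
proof (cases "fst i = fst j")
  case True
  have "cinv (fst j) (u i) = tens (snd i) 1"
    unfolding u_def True using JD[OF assms(1)] True by (intro cinv_cmp JD(4)[OF assms(2)] complexification_tens) simp
  then have "cu j (u i) = tens (lB (fst j) (snd j) (snd i)) 1"
    by (simp only: cu_def linear_ext_tens[OF lB(1)[OF JD(1)[OF assms(2)]]])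
  also have "lB (fst j) (snd j) (snd i) = (if i = j then 1 else 0)"
    using lB(3)[OF JD(1)[OF assms(2)], of "snd i" "snd j"] JD(2)[OF assms(1)] True by (simp add: prod_eq_iff)
  finally show ?thesis by (cases "i = j") (simp_all flip: one_tensor_def)
next
  case False
  have "cinv (fst j) (u i) = cinv (fst j) (KD (idem (fst i)) (u i))" by (simp add: u_def idem_cmp_same JD(4)[OF assms(1)])
  also have "\<dots> = 0" using False by (simp add: cinv_KD_idem JD(4) assms)
  finally show ?thesis using False by (auto simp: cu_def additive.zero[OF additive_linear_ext[OF lB(1)]] JD(1)[OF assms(2)])
qed

lemma KD_idem_u:
  assumes "j \<in> J" "\<sigma> \<in> \<Phi>"
  shows "KD (idem \<sigma>) (u j) = (if fst j = \<sigma> then u j else 0)" "KD (idem (conj_emb \<sigma>)) (u j) = 0"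
    "KD (idem (conj_emb \<sigma>)) (frobC (u j)) = (if fst j = \<sigma> then frobC (u j) else 0)" "KD (idem \<sigma>) (frobC (u j)) = 0"
proof -
  show 1: "KD (idem \<sigma>) (u j) = (if fst j = \<sigma> then u j else 0)"
    unfolding u_def idem_cmp[OF JD(4)[OF assms(1)] PhiD(1)[OF assms(2)]] by auto
  have "conj_emb \<sigma> \<noteq> fst j" using PhiD(3)[OF assms(2)] JD(1)[OF assms(1)] by auto
  then show 2: "KD (idem (conj_emb \<sigma>)) (u j) = 0"
    unfolding u_def idem_cmp[OF JD(4)[OF assms(1)] PhiD(2)[OF assms(2)]] by simp
  show "KD (idem (conj_emb \<sigma>)) (frobC (u j)) = (if fst j = \<sigma> then frobC (u j) else 0)"
    unfolding KD_idem_frobC[OF PhiD(1)[OF assms(2)]] 1 by (simp add: additive.zero[OF additive_frobC])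
  show "KD (idem \<sigma>) (frobC (u j)) = 0"
    using KD_idem_frobC[OF PhiD(2)[OF assms(2)], of "u j"] 2 by (simp add: additive.zero[OF additive_frobC])
qed

lemma cu_frobC_u: 
  assumes "i \<in> J" "j \<in> J"
  shows "cu j (frobC (u i)) = 0"
proof -
  have "cinv (fst j) (frobC (u i)) = cinv (fst j) (KD (idem (fst j)) (frobC (u i)))"
    by (simp add: cinv_KD_idem JD(4) assms)
  then show ?thesis
    unfolding cu_def KD_idem_u(4)[OF assms(1) JD(1)[OF assms(2)]]
    by (simp only: additive.zero[OF additive_cinv[OF JD(4)[OF assms(2)]]] additive.zero[OF additive_linear_ext[OF lB(1)[OF JD(1)[OF assms(2)]]]])
qed

lemma expand_idem_Phi:
  assumes "\<sigma> \<in> \<Phi>"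
  shows "KD (idem \<sigma>) y = (\<Sum>b\<in>B \<sigma>. RD (cu (\<sigma>, b) y) (u (\<sigma>, b)))"
proof -
  note s = PhiD(1)[OF assms]
  note cb = complexification_tens[OF subsetD[OF B(2)[OF assms]]]
  have "cinv \<sigma> y - (\<Sum>b\<in>B \<sigma>. RB (linear_ext (lB \<sigma> b) (cinv \<sigma> y)) (tens b 1)) \<in> complexification {0}"
    by (rule coordinates_complexification[OF cinv(1)[OF s] modules(1) lB(1)[OF assms]])
      (simp add: lB(4)[OF assms, symmetric])
  then have "cinv \<sigma> y = (\<Sum>b\<in>B \<sigma>. RB (linear_ext (lB \<sigma> b) (cinv \<sigma> y)) (tens b 1))"
    by (simp add: complexification_singleton_0)
  then have "cmp \<sigma> (cinv \<sigma> y) = cmp \<sigma> (\<Sum>b\<in>B \<sigma>. RB (linear_ext (lB \<sigma> b) (cinv \<sigma> y)) (tens b 1))"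
    by (rule arg_cong)
  also have "\<dots> = (\<Sum>b\<in>B \<sigma>. cmp \<sigma> (RB (linear_ext (lB \<sigma> b) (cinv \<sigma> y)) (tens b 1)))"
    by (rule cmp_sum[OF s CB_scale[OF s cb]])
  also have "\<dots> = (\<Sum>b\<in>B \<sigma>. RD (cu (\<sigma>, b) y) (u (\<sigma>, b)))"
    by (intro sum.cong refl) (simp add: cmp_scale[OF s cb] cu_def u_def)
  finally show ?thesis by (simp only: cinv(2)[OF s])
qed

text \<open>The components at the conjugates of \<Phi> are those of \<open>frobC y\<close> at
  \<Phi>, carried back by Frobenius, so bases over \<Phi> suffice.\<close>

lemma expand_W: "y = (\<Sum>j\<in>J. RD (cu j y) (u j) + RD (cu j (frobC y)) (frobC (u j)))"
proof -
  have c: "KD (idem (conj_emb \<sigma>)) y = (\<Sum>b\<in>B \<sigma>. RD (cu (\<sigma>, b) (frobC y)) (frobC (u (\<sigma>, b))))" if "\<sigma> \<in> \<Phi>" for \<sigma>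
  proof -
    have "KD (idem (conj_emb \<sigma>)) y = frobC (KD (idem \<sigma>) (frobC y))"
      by (simp only: KD_idem_frobC[OF PhiD(1)[OF that], symmetric] frobC_frobC)
    also have "\<dots> = (\<Sum>b\<in>B \<sigma>. RD (cu (\<sigma>, b) (frobC y)) (frobC (u (\<sigma>, b))))"
      unfolding expand_idem_Phi[OF that] additive.sum[OF additive_frobC] frobC_scale ..
    finally show ?thesis .
  qed
  have "y = (\<Sum>\<sigma>\<in>\<Phi>. KD (idem \<sigma>) y + KD (idem (conj_emb \<sigma>)) y)"
    unfolding sum_Emb[of "\<lambda>\<sigma>. KD (idem \<sigma>) y", symmetric] sum_KD_idem ..
  also have "\<dots> = (\<Sum>\<sigma>\<in>\<Phi>. \<Sum>b\<in>B \<sigma>. RD (cu (\<sigma>, b) y) (u (\<sigma>, b)) + RD (cu (\<sigma>, b) (frobC y)) (frobC (u (\<sigma>, b))))"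
    by (intro sum.cong refl) (simp only: c expand_idem_Phi sum.distrib)
  also have "\<dots> = (\<Sum>j\<in>J. RD (cu j y) (u j) + RD (cu j (frobC y)) (frobC (u j)))"
    unfolding J_def by (subst sum.Sigma) (use finite_Phi B(1) in \<open>auto simp: case_prod_beta\<close>)
  finally show ?thesis .
qed

text \<open>Finite dimension descends from M_dR \<otimes> C. The finitely many basis vectors involve
  only finitely many vectors of M_dR, so everything lies in the complexification of their span. A
  vector outside the span would be detected by a coordinate that vanishes on the span.\<close>

lemma dR_finite: "\<exists>S. finite S \<and> Modules.module.span (dR_scale_E M) S = UNIV"
proof -
  interpret D: vector_space "dR_scale_E M" by (rule dR_vector_space)
  have "\<exists>S. finite S \<and> y \<in> complexification (D.span S)" for y :: "('d, complex) tensor"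
  proof (induction y)
    case zero
    show ?case using complexification_0 by blast
  next
    case (add v z y)
    then obtain S where S: "finite S" "y \<in> complexification (D.span S)" by blast
    have "tens v z + y \<in> complexification (D.span (insert v S))"
    proof (rule complexification_add)
      show "tens v z \<in> complexification (D.span (insert v S))"
        by (intro complexification_tens D.span_base) simp
      show "y \<in> complexification (D.span (insert v S))"
        by (rule complexification_mono[OF S(2)]) (rule D.span_mono, blast)
    qed
    then show ?case using S(1) by blast
  qed
  then obtain S where S: "\<And>y. finite (S y)" "\<And>y. y \<in> complexification (D.span (S y))" by metis
  define T where "T = (\<Union>j\<in>J. S (u j) \<union> S (frobC (u j)))"
  have finT: "finite T" unfolding T_def using finite_J S(1) by blast
  have uT: "u j \<in> complexification (D.span T)" "frobC (u j) \<in> complexification (D.span T)" if "j \<in> J" for j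
    by (rule complexification_mono[OF S(2) D.span_mono], use that in \<open>auto simp: T_def\<close>)+
  have sc: "RD t y \<in> complexification (D.span T)" if "y \<in> complexification (D.span T)" for t y
    by (rule complexification_scale[OF that modules(3)]) (rule D.span_scale)
  have "y \<in> complexification (D.span T)" for y
    by (subst expand_W[of y]) (intro complexification_sum complexification_add sc uT)
  moreover have "x \<in> D.span T" if "tens x 1 \<in> complexification (D.span T)" for x
  proof (rule ccontr)
    assume x: "x \<notin> D.span T"
    obtain T' where T': "T' \<subseteq> T" "D.independent T'" "D.span T' = D.span T"
      using D.maximal_independent_subset[of T] D.span_mono D.span_span by (metis D.span_minimal D.subspace_span subset_antisym)
    have ind: "D.independent (insert x T')" using x T' by (intro D.independent_insertI) auto
    have fin: "finite (insert x T')" using finT T'(1) finite_subset by blast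
    obtain l where l: "\<And>b. additive (l b)" "\<And>b a x. l b (dR_scale_E M a x) = a * l b x"
      "\<And>b b'. b' \<in> insert x T' \<Longrightarrow> l b b' = (if b' = b then 1 else 0)"
      "\<And>y. y \<in> D.span (insert x T') \<Longrightarrow> y = (\<Sum>b\<in>insert x T'. dR_scale_E M (l b y) b)"
      by (rule D.coordinates_exist[OF ind fin]) (rule that)
    have "x \<notin> T'" using x T' D.span_base by blast
    have "l x v = 0" if "v \<in> D.span T'" for v
      using that
    proof (induction rule: D.span_induct_alt)
      case base
      show ?case by (rule additive.zero[OF l(1)])
    next
      case (step c w v)
      then show ?case using \<open>x \<notin> T'\<close> by (auto simp: additive.add[OF l(1)] l(2,3))
    qed
    then have "linear_ext (l x) (tens x 1) = 0"
      by (intro linear_ext_vanish[OF that l(1)]) (simp add: T'(3))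
    then show False using l(3)[of x x] by (simp add: linear_ext_tens[OF l(1)] flip: one_tensor_def)
  qed
  ultimately have "D.span T = UNIV" by blast
  then show ?thesis using finT by blast
qed

end

section \<open>The period matrices\<close>

locale bdr_period_basis = bdr_betti_basis M \<Phi> B lB
  for M :: "('k::field_char_0, 'e::field_char_0, 'b::ab_group_add, 'd::ab_group_add) bdr" and \<Phi> B lB +
  fixes I :: "'d set" and lD :: "'d \<Rightarrow> 'd \<Rightarrow> 'e"
  assumes I: "finite I"
    and lD: "\<And>i. additive (lD i)" "\<And>i a x. lD i (dR_scale_E M a x) = a * lD i x"
      "\<And>i i'. i' \<in> I \<Longrightarrow> lD i i' = (if i' = i then 1 else 0)"
      "\<And>i x. i \<in> I \<Longrightarrow> x \<in> FilV \<Longrightarrow> lD i x = 0"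
      "\<And>x. x - (\<Sum>i\<in>I. dR_scale_E M (lD i x) i) \<in> FilV"
begin

definition L :: "'d \<Rightarrow> ('d, complex) tensor \<Rightarrow> ('e, complex) tensor" where
  "L i = linear_ext (lD i)"

lemma additive_L: "additive (L i)"
  unfolding L_def by (rule additive_linear_ext[OF lD(1)])

lemmas L_add = additive.add[OF additive_L]
lemmas L_sum = additive.sum[OF additive_L]
lemmas L_diff = additive.diff[OF additive_L]

lemma L_scale: "L i (RD t y) = t * L i y"
  unfolding L_def by (rule linear_ext_scale[OF biadd(3) lD(1,2)])

lemma L_Fil: "i \<in> I \<Longrightarrow> y \<in> FilW \<Longrightarrow> L i y = 0"
  unfolding L_def by (rule linear_ext_vanish[OF _ lD(1), where V = FilV]) (simp_all add: lD(4))

lemma L_expand: "y - (\<Sum>i\<in>I. RD (L i y) (tens i 1)) \<in> FilW"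
  unfolding L_def by (rule coordinates_complexification[OF complexification_UNIV modules(3) lD(1) lD(5)])

lemma L_dual: "i' \<in> I \<Longrightarrow> L i (tens i' 1) = (if i' = i then 1 else 0)"
  unfolding L_def linear_ext_tens[OF lD(1)] using lD(3)[of i' i] by (simp flip: one_tensor_def)

lemma L_cong: "i \<in> I \<Longrightarrow> y - z \<in> FilW \<Longrightarrow> L i y = L i z"
  using L_Fil[of i "y - z"] by (simp add: L_diff)

lemma FilW_if_L: "(\<And>i. i \<in> I \<Longrightarrow> L i y = 0) \<Longrightarrow> y \<in> FilW"
  using L_expand[of y] by simp

text \<open>With the sign included, both eigenspaces of Frobenius become spaces of fixed vectors and
  are treated together.\<close>

definition sfrob :: "int \<Rightarrow> ('d, complex) tensor \<Rightarrow> ('d, complex) tensor" where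
  "sfrob s y = (if s = 1 then frobC y else - frobC y)"

lemma additive_sfrob: "additive (sfrob s)"
  by (simp add: sfrob_def additive_def additive.add[OF additive_frobC])

lemma sfrob_scale: "sfrob s (RD t y) = RD t (sfrob s y)"
  by (simp add: sfrob_def frobC_scale)

lemma sfrob_sfrob: "sfrob s (sfrob s y) = y"
  by (simp add: sfrob_def additive.minus[OF additive_frobC] frobC_frobC)

lemma sfrob_Fil: "frobC y \<in> FilW \<Longrightarrow> sfrob s y \<in> FilW"
  by (simp add: sfrob_def complexification_uminus)

lemma sfrob_inter: "y \<in> FilW \<Longrightarrow> sfrob s y \<in> FilW \<Longrightarrow> y = 0"
  using Fil_inter complexification_uminus[of "- frobC y"] by (auto simp: sfrob_def split: if_splits)

text \<open>The candidate for the period matrix in the eigenvectors belonging to the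
  \<open>u j\<close> and the basis \<open>I\<close> of the quotient.
  \<open>rational_period_eq\<close> confirms it.\<close>

definition per :: "int \<Rightarrow> 'd \<Rightarrow> ('k \<Rightarrow> complex) \<times> 'b \<Rightarrow> ('e, complex) tensor" where
  "per s i j = L i (u j + sfrob s (u j))"

lemma eigen_expand:
  assumes "sfrob s y = y"
  shows "y = (\<Sum>j\<in>J. RD (cu j y) (u j + sfrob s (u j)))"
proof -
  have "RD (cu j (frobC y)) (frobC (u j)) = RD (cu j y) (sfrob s (u j))" if "j \<in> J" for j
  proof (cases "s = 1")
    case True
    then show ?thesis using assms by (simp add: sfrob_def)
  next
    case False
    then have "frobC y = - y" using assms by (simp add: sfrob_def minus_equation_iff)
    then show ?thesis using False that by (simp add: sfrob_def additive.minus[OF additive_cu])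
  qed
  then have "(\<Sum>j\<in>J. RD (cu j y) (u j) + RD (cu j (frobC y)) (frobC (u j))) = (\<Sum>j\<in>J. RD (cu j y) (u j + sfrob s (u j)))"
    by (intro sum.cong refl) (simp add: RD.scale_right_distrib)
  then show ?thesis using expand_W[of y] by (simp only:)
qed

lemma cu_sfrob_u: "i \<in> J \<Longrightarrow> j \<in> J \<Longrightarrow> cu j (sfrob s (u i)) = 0"
  by (simp add: sfrob_def cu_frobC_u additive.minus[OF additive_cu])

text \<open>The representative of the class of \<open>i\<close> modulo \<open>FilW\<close> that lies
  in the complement of \<open>FilW\<close>, its Frobenius image.\<close>

definition gI :: "'d \<Rightarrow> ('d, complex) tensor" where
  "gI i = (SOME g. tens i 1 - g \<in> FilW \<and> frobC g \<in> FilW)"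

lemma gI: "tens i 1 - gI i \<in> FilW" "frobC (gI i) \<in> FilW"
proof -
  obtain f g where "tens i 1 = f + g" "f \<in> FilW" "frobC g \<in> FilW" using Fil_split[OF vm] by blast
  then have "tens i 1 - g \<in> FilW \<and> frobC g \<in> FilW" by simp
  then have "tens i 1 - gI i \<in> FilW \<and> frobC (gI i) \<in> FilW" unfolding gI_def by (rule someI)
  then show "tens i 1 - gI i \<in> FilW" "frobC (gI i) \<in> FilW" by blast+
qed

lemma L_gI: "i \<in> I \<Longrightarrow> i' \<in> I \<Longrightarrow> L i (gI i') = (if i' = i then 1 else 0)"
  by (simp only: L_cong[OF _ gI(1), symmetric] L_dual)

text \<open>The inverse matrix lists the coordinates of eigenvectors \<open>X i\<close> congruent to
  \<open>i\<close> modulo \<open>FilW\<close>. One product is the expansion of \<open>X i\<close>;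
  for the other, an eigenvector in \<open>FilW\<close> must vanish, because \<open>FilW\<close>
  meets its Frobenius image only in 0.\<close>

lemma period_inverse:
  "\<exists>C. (\<forall>i\<in>I. \<forall>i'\<in>I. (\<Sum>j\<in>J. per s i j * C j i') = (if i = i' then 1 else 0)) \<and>
      (\<forall>j\<in>J. \<forall>j'\<in>J. (\<Sum>i\<in>I. C j i * per s i j') = (if j = j' then 1 else 0))"
proof -
  \<comment> \<open>The term that makes \<open>gI i\<close> an eigenvector lies in
    \<open>FilW\<close>, so the class modulo \<open>FilW\<close> is unchanged.\<close>
  define X where "X i = gI i + sfrob s (gI i)" for i
  have X: "sfrob s (X i) = X i" for i by (simp add: X_def additive.add[OF additive_sfrob] sfrob_sfrob add.commute)
  have LX: "L i (X i') = (if i = i' then 1 else 0)" if "i \<in> I" "i' \<in> I" for i i'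
    using that L_gI L_Fil[OF that(1) sfrob_Fil[OF gI(2)]] by (simp add: X_def L_add)
  have 1: "(\<Sum>j\<in>J. per s i j * cu j (X i')) = (if i = i' then 1 else 0)" if "i \<in> I" "i' \<in> I" for i i'
  proof -
    have "L i (\<Sum>j\<in>J. RD (cu j (X i')) (u j + sfrob s (u j))) = L i (X i')"
      by (simp only: eigen_expand[OF X, symmetric])
    then show ?thesis by (simp add: L_sum L_scale per_def LX that mult.commute)
  qed
  have 2: "(\<Sum>i\<in>I. cu j (X i) * per s i j') = (if j = j' then 1 else 0)" if j: "j \<in> J" "j' \<in> J" for j j'
  proof -
    define y z where "y = u j' + sfrob s (u j')" and "z = (\<Sum>i\<in>I. RD (per s i j') (X i)) - y"
    have "L k z = 0" if "k \<in> I" for k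
    proof -
      have "L k z = (\<Sum>i\<in>I. per s i j' * (if k = i then 1 else 0)) - per s k j'"
        using that by (simp add: z_def L_diff L_sum L_scale LX per_def y_def)
      then show ?thesis using that I by (simp add: if_distrib[of "\<lambda>x. _ * x"] cong: if_cong)
    qed
    then have "z \<in> FilW" by (rule FilW_if_L)
    moreover have "sfrob s z = z"
      by (simp add: z_def y_def additive.diff[OF additive_sfrob] additive.sum[OF additive_sfrob] sfrob_scale X
          additive.add[OF additive_sfrob] sfrob_sfrob add.commute)
    ultimately have "z = 0" using sfrob_inter[of z s] by simp
    then have "cu j (\<Sum>i\<in>I. RD (per s i j') (X i)) = cu j y" by (simp add: z_def)
    then show ?thesis
      using j by (simp add: additive.sum[OF additive_cu] cu_scale y_def additive.add[OF additive_cu] cu_u cu_sfrob_u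
          mult.commute eq_commute[of j'])
  qed
  show ?thesis by (rule exI[of _ "\<lambda>j i. cu j (X i)"]) (use 1 2 in blast)
qed

lemma card_I: "card I = card J"
proof -
  obtain C where C: "\<forall>i\<in>I. \<forall>i'\<in>I. (\<Sum>j\<in>J. per 1 i j * C j i') = (if i = i' then 1 else 0)"
      "\<forall>j\<in>J. \<forall>j'\<in>J. (\<Sum>i\<in>I. C j i * per 1 i j') = (if j = j' then 1 else 0)"
    using period_inverse[of 1] by blast
  show ?thesis by (rule length_eq_if_inverse[OF I finite_J, of "per 1" C]) (use C in simp_all)
qed

lemma det_period_unit:
  assumes "distinct is" "set is = I" "distinct js" "set js = J"
  shows "det (imat is js (per s)) dvd 1"
proof -
  obtain C where C: "\<forall>i\<in>I. \<forall>i'\<in>I. (\<Sum>j\<in>J. per s i j * C j i') = (if i = i' then 1 else 0)"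
    using period_inverse[of s] by blast
  have len: "length is = length js" using card_I assms by (metis distinct_card)
  have "det (imat is js (per s)) * det (imat js is C) = 1"
    by (rule det_inverse_imat[OF assms(1,3) len]) (use C assms in simp)
  then show ?thesis by (metis dvdI)
qed

text \<open>\<open>KD t\<close> preserves \<open>FilW\<close>, hence has a matrix on the quotient,
  and composition of operators becomes multiplication of these matrices.\<close>

lemma L_KD:
  assumes "i \<in> I"
  shows "L i (KD t y) = (\<Sum>k\<in>I. L i (KD t (tens k 1)) * L k y)"
proof -
  have "KD t (y - (\<Sum>k\<in>I. RD (L k y) (tens k 1))) \<in> FilW" by (rule FilC_scale(1)[OF L_expand])
  then have "L i (KD t y) = L i (\<Sum>k\<in>I. RD (L k y) (KD t (tens k 1)))"
    by (intro L_cong assms) (simp add: KD.scale_right_diff_distrib KD.scale_sum_right KD_RD)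
  then show ?thesis by (simp add: L_sum L_scale mult.commute)
qed

text \<open>The automorphism has opposite eigenvalues on the two halves of the basis of \<open>M\<^sub>d\<^sub>R \<otimes> \<complex>\<close>,
  so it exchanges the two eigenspaces of Frobenius.\<close>

lemma det_twist:
  assumes lists: "distinct is" "set is = I" "distinct js" "set js = J"
    and t: "\<And>j. j \<in> J \<Longrightarrow> KD t (u j) = RD (d j) (u j)" "\<And>j. j \<in> J \<Longrightarrow> KD t (frobC (u j)) = - RD (d j) (frobC (u j))"
  shows "det (imat is is (\<lambda>i k. L i (KD t (tens k 1)))) * det (imat is js (per 1)) =
    det (imat is js (per (-1))) * (\<Prod>j\<in>J. d j)"
proof -
  have len: "length is = length js" using card_I lists by (metis distinct_card)
  let ?H = "imat is is (\<lambda>i k. L i (KD t (tens k 1)))" and ?D = "imat js js (\<lambda>i j. if i = j then d i else 0)"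
  have "?H * imat is js (per 1) = imat is js (\<lambda>i j. per (-1) i j * d j)"
    unfolding imat_mult[OF lists(1)]
  proof (rule imat_cong)
    fix i j assume "i \<in> set is" "j \<in> set js"
    then have ij: "i \<in> I" "j \<in> J" using lists by auto
    have "(\<Sum>k\<in>I. L i (KD t (tens k 1)) * per 1 k j) = L i (KD t (u j + frobC (u j)))"
      by (subst L_KD[OF ij(1), of t "u j + frobC (u j)"]) (simp add: per_def sfrob_def)
    also have "KD t (u j + frobC (u j)) = RD (d j) (u j + sfrob (-1) (u j))"
      by (simp add: KD.scale_right_distrib t ij(2) sfrob_def RD.scale_right_distrib RD.scale_right_diff_distrib)
    finally show "(\<Sum>k\<in>set is. L i (KD t (tens k 1)) * per 1 k j) = per (-1) i j * d j"
      by (simp add: lists(2) L_scale per_def mult.commute)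
  qed
  also have "\<dots> = imat is js (per (-1)) * ?D"
    unfolding imat_mult[OF lists(3)]
    by (intro imat_cong) (simp add: if_distrib[of "\<lambda>x. _ * x"] cong: if_cong)
  finally have eq: "?H * imat is js (per 1) = imat is js (per (-1)) * ?D" .
  have c: "?H \<in> carrier_mat (length is) (length is)" "imat is js (per s) \<in> carrier_mat (length is) (length is)"
    "?D \<in> carrier_mat (length is) (length is)" for s
    using len by (simp_all add: imat_def)
  have "det (?H * imat is js (per 1)) = det (imat is js (per (-1)) * ?D)" by (simp only: eq)
  then show ?thesis
    by (simp only: det_mult[OF c(1,2)] det_mult[OF c(2,3)] det_imat_diag[OF lists(3)] lists(4))
qed

section \<open>Traces on the quotient by the filtration\<close>

definition gproj :: "('d, complex) tensor \<Rightarrow> ('d, complex) tensor" where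
  "gproj y = (\<Sum>i\<in>I. RD (L i y) (gI i))"

lemma additive_gproj: "additive gproj"
  unfolding gproj_def by (intro additive_sum_fun additive.intro) (simp add: L_add RD.scale_left_distrib)

lemma gproj: "y - gproj y \<in> FilW" "frobC (gproj y) \<in> FilW"
proof -
  have "y - gproj y = (y - (\<Sum>i\<in>I. RD (L i y) (tens i 1))) + (\<Sum>i\<in>I. RD (L i y) (tens i 1 - gI i))"
    by (simp add: gproj_def RD.scale_right_diff_distrib sum_subtractf)
  also have "\<dots> \<in> FilW"
    by (intro complexification_add L_expand complexification_sum FilC_scale(2) gI)
  finally show "y - gproj y \<in> FilW" .
  show "frobC (gproj y) \<in> FilW"
    unfolding gproj_def additive.sum[OF additive_frobC] frobC_scale by (intro complexification_sum FilC_scale(2) gI)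
qed

text \<open>The two conditions characterize the projection onto the Frobenius image of
  \<open>FilW\<close> along \<open>FilW\<close>, with no reference to the basis
  \<open>I\<close>.\<close>

lemma gproj_eqI:
  assumes "y - g \<in> FilW" "frobC g \<in> FilW"
  shows "gproj y = g"
proof -
  have "gproj y - g \<in> FilW" using complexification_diff[OF assms(1) gproj(1)[of y]] by simp
  moreover have "frobC (gproj y - g) \<in> FilW"
    unfolding additive.diff[OF additive_frobC] by (intro complexification_diff gproj assms)
  ultimately have "gproj y - g = 0" by (rule Fil_inter)
  then show ?thesis by simp
qed

text \<open>Conjugation by Frobenius exchanges the two complementary subspaces, hence also the two
  projections.\<close>

lemma gproj_frobC: "frobC (gproj (frobC y)) = y - gproj y"
proof -
  have "gproj (frobC y) = frobC (y - gproj y)"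
  proof (rule gproj_eqI)
    show "frobC y - frobC (y - gproj y) \<in> FilW" using gproj(2) by (simp add: additive.diff[OF additive_frobC])
    show "frobC (frobC (y - gproj y)) \<in> FilW" unfolding frobC_frobC by (rule gproj)
  qed
  then show ?thesis by (simp only: frobC_frobC)
qed

text \<open>The trace of \<open>t\<close> over E \<otimes> C on the quotient of M_dR \<otimes> C by
  \<open>FilW\<close>.\<close>

definition trV :: "('k, complex) tensor \<Rightarrow> ('e, complex) tensor" where
  "trV t = (\<Sum>i\<in>I. L i (KD t (tens i 1)))"

text \<open>The trace of \<open>t\<close> on the quotient equals the trace of \<open>gproj\<close>
  after \<open>t\<close> on the whole space, here written in the basis \<open>u j\<close>,
  \<open>frobC (u j)\<close>, on which the idempotents act in an obvious way.\<close>

lemma trV_eq: "trV t = (\<Sum>j\<in>J. cu j (gproj (KD t (u j))) + cu j (frobC (gproj (KD t (frobC (u j))))))"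
proof -
  have "trV t = (\<Sum>i\<in>I. L i (KD t (gI i)))"
    unfolding trV_def
  proof (intro sum.cong refl L_cong)
    show "KD t (tens i 1) - KD t (gI i) \<in> FilW" for i
      unfolding KD.scale_right_diff_distrib[symmetric] by (rule FilC_scale(1)[OF gI(1)])
  qed
  also have "\<dots> = (\<Sum>i\<in>I. \<Sum>j\<in>J. cu j (gI i) * L i (KD t (u j)) + cu j (frobC (gI i)) * L i (KD t (frobC (u j))))"
  proof (rule sum.cong[OF refl])
    fix i
    have "L i (KD t (gI i)) = L i (KD t (\<Sum>j\<in>J. RD (cu j (gI i)) (u j) + RD (cu j (frobC (gI i))) (frobC (u j))))"
      by (simp only: expand_W[of "gI i", symmetric])
    then show "L i (KD t (gI i)) = (\<Sum>j\<in>J. cu j (gI i) * L i (KD t (u j)) + cu j (frobC (gI i)) * L i (KD t (frobC (u j))))"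
      by (simp only: KD.scale_sum_right KD.scale_right_distrib KD_RD L_sum L_add L_scale)
  qed
  also have "\<dots> = (\<Sum>j\<in>J. \<Sum>i\<in>I. cu j (gI i) * L i (KD t (u j)) + cu j (frobC (gI i)) * L i (KD t (frobC (u j))))"
    by (rule sum.swap)
  also have "\<dots> = (\<Sum>j\<in>J. cu j (gproj (KD t (u j))) + cu j (frobC (gproj (KD t (frobC (u j))))))"
  proof (rule sum.cong[OF refl])
    fix j assume j: "j \<in> J"
    show "(\<Sum>i\<in>I. cu j (gI i) * L i (KD t (u j)) + cu j (frobC (gI i)) * L i (KD t (frobC (u j)))) =
      cu j (gproj (KD t (u j))) + cu j (frobC (gproj (KD t (frobC (u j)))))"
      unfolding gproj_def additive.sum[OF additive_frobC] frobC_scale additive.sum[OF additive_cu[OF j]] cu_scale[OF j] sum.distrib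
      by (simp only: mult.commute)
  qed
  finally show ?thesis .
qed

lemma sum_J_fst: "\<sigma> \<in> \<Phi> \<Longrightarrow> (\<Sum>j\<in>J. if fst j = \<sigma> then f j else 0) = (\<Sum>b\<in>B \<sigma>. f (\<sigma>, b))"
proof -
  assume s: "\<sigma> \<in> \<Phi>"
  have "(\<Sum>j\<in>J. if fst j = \<sigma> then f j else 0) = (\<Sum>j\<in>J \<inter> {j. fst j = \<sigma>}. f j)"
    by (simp add: sum.inter_restrict[OF finite_J])
  also have "J \<inter> {j. fst j = \<sigma>} = Pair \<sigma> ` B \<sigma>" using s by (auto simp: J_def)
  also have "sum f \<dots> = (\<Sum>b\<in>B \<sigma>. f (\<sigma>, b))" by (subst sum.reindex) (auto simp: inj_on_def)
  finally show ?thesis .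
qed

lemma cu_0: "j \<in> J \<Longrightarrow> cu j 0 = 0" by (rule additive.zero[OF additive_cu])
lemmas frobC_0 = additive.zero[OF additive_frobC]
lemmas gproj_0 = additive.zero[OF additive_gproj]

text \<open>As \<open>trV (idem \<sigma>)\<close> is the rank of the summand of \<open>M\<^sub>d\<^sub>R / F\<close> at \<open>\<sigma>\<close>, this is Hodge symmetry.\<close>

lemma trV_idem:
  assumes s: "\<sigma> \<in> \<Phi>"
  shows "trV (idem \<sigma>) + trV (idem (conj_emb \<sigma>)) = of_nat (card (B \<sigma>))"
proof -
  have "trV (idem \<sigma>) = (\<Sum>j\<in>J. if fst j = \<sigma> then cu j (gproj (u j)) else 0)"
    unfolding trV_eq by (intro sum.cong refl) (simp add: KD_idem_u[OF _ s] gproj_0 frobC_0 cu_0)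
  \<comment> \<open>By \<open>gproj_frobC\<close> the vector \<open>frobC (u j)\<close> contributes
    the coordinate of \<open>u j\<close> under the complementary projection, which is 1 minus the
    coordinate in the first sum.\<close>
  moreover have "trV (idem (conj_emb \<sigma>)) = (\<Sum>j\<in>J. if fst j = \<sigma> then 1 - cu j (gproj (u j)) else 0)"
    unfolding trV_eq
    by (intro sum.cong refl)
      (simp add: KD_idem_u[OF _ s] gproj_0 frobC_0 cu_0 gproj_frobC additive.diff[OF additive_cu] cu_u)
  ultimately have "trV (idem \<sigma>) + trV (idem (conj_emb \<sigma>)) = (\<Sum>j\<in>J. if fst j = \<sigma> then 1 else 0)"
    by (simp only: sum.distrib[symmetric]) (intro sum.cong refl, simp)
  then show ?thesis unfolding sum_J_fst[OF s] by simp
qed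

text \<open>Both sides are the trace of the idempotent on all of M_dR \<otimes> C, and the right
  side is its rank. The left side uses coordinates of M_dR over E, which makes it a value of the
  extension of a functional from K to E.\<close>

lemma trace_W:
  assumes fin: "finite I'" and l: "\<And>i. additive (l i)" "\<And>i a x. l i (dR_scale_E M a x) = a * l i x"
    "\<And>x. x = (\<Sum>i\<in>I'. dR_scale_E M (l i x) i)"
    and s: "\<sigma> \<in> \<Phi>"
  shows "(\<Sum>i\<in>I'. linear_ext (l i) (KD (idem \<sigma>) (tens i 1))) = of_nat (card (B \<sigma>))"
    "(\<Sum>i\<in>I'. linear_ext (l i) (KD (idem (conj_emb \<sigma>)) (tens i 1))) = of_nat (card (B \<sigma>))"
proof -
  define l' where "l' i = linear_ext (l i)" for i
  have l': "additive (l' i)" "l' i (RD t y) = t * l' i y" for i t y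
    unfolding l'_def by (rule additive_linear_ext[OF l(1)], rule linear_ext_scale[OF biadd(3) l(1,2)])
  have expand: "y = (\<Sum>i\<in>I'. RD (l' i y) (tens i 1))" for y
  proof -
    have "y - (\<Sum>i\<in>I'. RD (linear_ext (l i) y) (tens i 1)) \<in> complexification {0}"
      by (rule coordinates_complexification[OF complexification_UNIV modules(3) l(1)]) (simp add: l(3)[symmetric])
    then show ?thesis by (simp add: complexification_singleton_0 l'_def)
  qed
  have tr: "(\<Sum>i\<in>I'. l' i (KD t (tens i 1))) = (\<Sum>j\<in>J. cu j (KD t (u j)) + cu j (frobC (KD t (frobC (u j)))))" for t
  proof -
    have "(\<Sum>i\<in>I'. l' i (KD t (tens i 1)))
      = (\<Sum>i\<in>I'. \<Sum>j\<in>J. cu j (tens i 1) * l' i (KD t (u j)) + cu j (frobC (tens i 1)) * l' i (KD t (frobC (u j))))"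
    proof (rule sum.cong[OF refl])
      fix i
      have "l' i (KD t (tens i 1)) = l' i (KD t (\<Sum>j\<in>J. RD (cu j (tens i 1)) (u j) + RD (cu j (frobC (tens i 1))) (frobC (u j))))"
        by (simp only: expand_W[of "tens i 1", symmetric])
      then show "l' i (KD t (tens i 1)) = (\<Sum>j\<in>J. cu j (tens i 1) * l' i (KD t (u j)) + cu j (frobC (tens i 1)) * l' i (KD t (frobC (u j))))"
        by (simp only: KD.scale_sum_right KD.scale_right_distrib KD_RD additive.sum[OF l'(1)] additive.add[OF l'(1)] l'(2))
    qed
    also have "\<dots> = (\<Sum>j\<in>J. \<Sum>i\<in>I'. cu j (tens i 1) * l' i (KD t (u j)) + cu j (frobC (tens i 1)) * l' i (KD t (frobC (u j))))"
      by (rule sum.swap)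
    also have "\<dots> = (\<Sum>j\<in>J. cu j (KD t (u j)) + cu j (frobC (KD t (frobC (u j)))))"
    proof (rule sum.cong[OF refl])
      fix j assume j: "j \<in> J"
      have 1: "cu j y = (\<Sum>i\<in>I'. cu j (tens i 1) * l' i y)" for y
        by (subst expand[of y]) (simp only: additive.sum[OF additive_cu[OF j]] cu_scale[OF j] mult.commute)
      have 2: "cu j (frobC y) = (\<Sum>i\<in>I'. cu j (frobC (tens i 1)) * l' i y)" for y
        by (subst expand[of y])
          (simp only: additive.sum[OF additive_frobC] frobC_scale additive.sum[OF additive_cu[OF j]] cu_scale[OF j] mult.commute)
      show "(\<Sum>i\<in>I'. cu j (tens i 1) * l' i (KD t (u j)) + cu j (frobC (tens i 1)) * l' i (KD t (frobC (u j)))) =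
        cu j (KD t (u j)) + cu j (frobC (KD t (frobC (u j))))"
        by (simp only: sum.distrib 1[of "KD t (u j)"] 2[of "KD t (frobC (u j))"])
    qed
    finally show ?thesis .
  qed
  have "(\<Sum>i\<in>I'. l' i (KD (idem \<sigma>) (tens i 1))) = (\<Sum>j\<in>J. if fst j = \<sigma> then 1 else 0)"
    unfolding tr by (intro sum.cong refl) (simp add: KD_idem_u[OF _ s] frobC_0 cu_0 cu_u)
  then show "(\<Sum>i\<in>I'. linear_ext (l i) (KD (idem \<sigma>) (tens i 1))) = of_nat (card (B \<sigma>))"
    unfolding sum_J_fst[OF s] l'_def by simp
  have "(\<Sum>i\<in>I'. l' i (KD (idem (conj_emb \<sigma>)) (tens i 1))) = (\<Sum>j\<in>J. if fst j = \<sigma> then 1 else 0)"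
    unfolding tr by (intro sum.cong refl) (simp add: KD_idem_u[OF _ s] frobC_0 cu_0 cu_u frobC_frobC)
  then show "(\<Sum>i\<in>I'. linear_ext (l i) (KD (idem (conj_emb \<sigma>)) (tens i 1))) = of_nat (card (B \<sigma>))"
    unfolding sum_J_fst[OF s] l'_def by simp
qed

end

section \<open>Periods of the restriction of scalars\<close>

lemma (in bdr_over) betti_closed:
  assumes "\<sigma> \<in> Emb"
  shows "0 \<in> betti M \<sigma>" "x \<in> betti M \<sigma> \<Longrightarrow> - x \<in> betti M \<sigma>" "x \<in> betti M \<sigma> \<Longrightarrow> betti_scale M e x \<in> betti M \<sigma>"
    "x \<in> betti M \<sigma> \<Longrightarrow> y \<in> betti M \<sigma> \<Longrightarrow> x + y \<in> betti M \<sigma>"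
proof -
  interpret V: vector_space "betti_scale M" by (rule betti_vector_space)
  note sub = betti_subspace[OF assms]
  show "0 \<in> betti M \<sigma>" "x \<in> betti M \<sigma> \<Longrightarrow> - x \<in> betti M \<sigma>" "x \<in> betti M \<sigma> \<Longrightarrow> betti_scale M e x \<in> betti M \<sigma>"
    "x \<in> betti M \<sigma> \<Longrightarrow> y \<in> betti M \<sigma> \<Longrightarrow> x + y \<in> betti M \<sigma>"
    by (rule V.subspace_0[OF sub] V.subspace_neg[OF sub] V.subspace_scale[OF sub] V.subspace_add[OF sub]; assumption)+
qed

lemma (in bdr_over) frob_hom:
  assumes "\<sigma> \<in> Emb"
  shows "frob M \<sigma> 0 = 0" "x \<in> betti M \<sigma> \<Longrightarrow> frob M \<sigma> (- x) = - frob M \<sigma> x"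
    "finite A \<Longrightarrow> (\<And>b. b \<in> A \<Longrightarrow> g b \<in> betti M \<sigma>) \<Longrightarrow>
      (\<Sum>b\<in>A. betti_scale M (c b) (g b)) \<in> betti M \<sigma> \<and>
      frob M \<sigma> (\<Sum>b\<in>A. betti_scale M (c b) (g b)) = (\<Sum>b\<in>A. betti_scale M (c b) (frob M \<sigma> (g b)))"
proof -
  note cl = betti_closed[OF assms] and fr = frob_betti[OF assms]
  show 0: "frob M \<sigma> 0 = 0" using fr(3)[OF cl(1) cl(1)] by simp
  show "frob M \<sigma> (- x) = - frob M \<sigma> x" if x: "x \<in> betti M \<sigma>"
  proof -
    have "frob M \<sigma> x + frob M \<sigma> (- x) = 0" using fr(3)[OF x cl(2)[OF x]] 0 by simp
    then show ?thesis by (rule minus_unique[symmetric])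
  qed
  show "finite A \<Longrightarrow> (\<And>b. b \<in> A \<Longrightarrow> g b \<in> betti M \<sigma>) \<Longrightarrow>
      (\<Sum>b\<in>A. betti_scale M (c b) (g b)) \<in> betti M \<sigma> \<and>
      frob M \<sigma> (\<Sum>b\<in>A. betti_scale M (c b) (g b)) = (\<Sum>b\<in>A. betti_scale M (c b) (frob M \<sigma> (g b)))"
  proof (induction A rule: finite_induct)
    case empty
    then show ?case using cl(1) 0 by simp
  next
    case (insert b A)
    then have IH: "(\<Sum>b\<in>A. betti_scale M (c b) (g b)) \<in> betti M \<sigma>"
      "frob M \<sigma> (\<Sum>b\<in>A. betti_scale M (c b) (g b)) = (\<Sum>b\<in>A. betti_scale M (c b) (frob M \<sigma> (g b)))"
      and b: "g b \<in> betti M \<sigma>" by auto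
    show ?case using insert(1,2) cl(4)[OF cl(3)[OF b] IH(1)] fr(3)[OF cl(3)[OF b] IH(1)] IH(2) fr(4)[OF b] by simp
  qed
qed

lemma sum_list_to_set:
  assumes "distinct js" "length c = length js" "\<And>q. q < length js \<Longrightarrow> c ! q = g (js ! q)"
  shows "(\<Sum>q<length js. s (c ! q) (map f js ! q)) = (\<Sum>j\<in>set js. s (g j) (f j))"
proof -
  have "(\<Sum>q<length js. s (c ! q) (map f js ! q)) = (\<Sum>q<length js. s (g (js ! q)) (f (js ! q)))"
    using assms(3) by (intro sum.cong) auto
  then show ?thesis using sum_nth_distinct[OF assms(1), of "\<lambda>j. s (g j) (f j)"] by simp
qed

lemma basis_modI:
  fixes s :: "'e::field_char_0 \<Rightarrow> 'v::ab_group_add \<Rightarrow> 'v"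
  assumes "distinct js" "\<And>j. j \<in> set js \<Longrightarrow> f j \<in> V" "Modules.module s"
    and l: "\<And>j. j \<in> set js \<Longrightarrow> additive (l j)" "\<And>j a x. j \<in> set js \<Longrightarrow> l j (s a x) = a * l j x"
      "\<And>j x. j \<in> set js \<Longrightarrow> x \<in> N \<Longrightarrow> l j x = 0"
      "\<And>i j. i \<in> set js \<Longrightarrow> j \<in> set js \<Longrightarrow> l j (f i) = (if i = j then 1 else 0)"
      "\<And>x. x \<in> V \<Longrightarrow> x - (\<Sum>j\<in>set js. s (l j x) (f j)) \<in> N"
  shows "basis_mod s V N (map f js)"
  unfolding basis_mod_def
proof (intro conjI ballI)
  show "set (map f js) \<subseteq> V" using assms(2) by auto
  fix x assume x: "x \<in> V"
  show "\<exists>!c. length c = length (map f js) \<and> x - (\<Sum>i<length (map f js). s (c ! i) (map f js ! i)) \<in> N"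
  proof (rule ex1I[of _ "map (\<lambda>j. l j x) js"])
    show "length (map (\<lambda>j. l j x) js) = length (map f js) \<and>
      x - (\<Sum>i<length (map f js). s (map (\<lambda>j. l j x) js ! i) (map f js ! i)) \<in> N"
      using sum_list_to_set[OF assms(1), of "map (\<lambda>j. l j x) js" "\<lambda>j. l j x" s f] l(5)[OF x] by simp
    fix c assume c: "length c = length (map f js) \<and> x - (\<Sum>i<length (map f js). s (c ! i) (map f js ! i)) \<in> N"
    \<comment> \<open>The competing list \<open>c\<close> is read as a function on the elements of
      \<open>js\<close>, to which the dual functionals can be applied.\<close>
    define g where "g j = c ! (THE q. q < length js \<and> js ! q = j)" for j
    have g: "c ! q = g (js ! q)" if "q < length js" for q
    proof -
      have "(THE q'. q' < length js \<and> js ! q' = js ! q) = q"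
        using that assms(1) by (intro the_equality) (auto simp: nth_eq_iff_index_eq)
      then show ?thesis by (simp add: g_def)
    qed
    have "x - (\<Sum>j\<in>set js. s (g j) (f j)) \<in> N"
      using c sum_list_to_set[OF assms(1) _ g, of s f] by simp
    then have 0: "l k (x - (\<Sum>j\<in>set js. s (g j) (f j))) = 0" if "k \<in> set js" for k using l(3)[OF that] by blast
    have "l k x = g k" if k: "k \<in> set js" for k
    proof -
      have "l k (\<Sum>j\<in>set js. s (g j) (f j)) = (\<Sum>j\<in>set js. if j = k then g k else 0)"
        unfolding additive.sum[OF l(1)[OF k]] by (intro sum.cong refl) (simp add: l(2,4) k)
      then show ?thesis using 0[OF k] k by (simp add: additive.diff[OF l(1)[OF k]])
    qed
    then show "c = map (\<lambda>j. l j x) js" using c g by (intro nth_equalityI) auto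
  qed
qed

lemma basis_modD:
  assumes "basis_mod s V N vs"
  obtains c where "\<And>x. x \<in> V \<Longrightarrow> x - (\<Sum>q<length vs. s (c x q) (vs ! q)) \<in> N"
    "\<And>x g h q. x \<in> V \<Longrightarrow> x - (\<Sum>q<length vs. s (g q) (vs ! q)) \<in> N \<Longrightarrow> x - (\<Sum>q<length vs. s (h q) (vs ! q)) \<in> N \<Longrightarrow>
      q < length vs \<Longrightarrow> g q = h q"
proof -
  have ex1: "\<exists>!c. length c = length vs \<and> x - (\<Sum>i<length vs. s (c ! i) (vs ! i)) \<in> N" if "x \<in> V" for x
    using assms that unfolding basis_mod_def by blast
  have list: "(\<Sum>q<length vs. s (map g [0..<length vs] ! q) (vs ! q)) = (\<Sum>q<length vs. s (g q) (vs ! q))" for g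
    by (intro sum.cong) auto
  show ?thesis
  proof (rule that[of "\<lambda>x q. (THE c. length c = length vs \<and> x - (\<Sum>i<length vs. s (c ! i) (vs ! i)) \<in> N) ! q"])
    fix x assume "x \<in> V"
    then show "x - (\<Sum>q<length vs. s ((THE c. length c = length vs \<and> x - (\<Sum>i<length vs. s (c ! i) (vs ! i)) \<in> N) ! q) (vs ! q)) \<in> N"
      using theI'[OF ex1] by blast
  next
    fix x g h q
    assume x: "x \<in> V" and g: "x - (\<Sum>q<length vs. s (g q) (vs ! q)) \<in> N" and h: "x - (\<Sum>q<length vs. s (h q) (vs ! q)) \<in> N"
      and q: "q < length vs"
    have "map g [0..<length vs] = map h [0..<length vs]"
      using ex1[OF x] g h list[of g] list[of h] by (metis length_map length_upt minus_nat.diff_0)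
    then show "g q = h q" using q by (simp add: map_eq_conv)
  qed
qed

interpretation tens_left_hom: comm_ring_hom "\<lambda>x. tens (x :: 'e::field_char_0) (1 :: complex)"
  by unfold_locales (simp_all add: tens_add_left tens_times_tens flip: one_tensor_def)

lemma det_imat_tens: "det (imat is js (\<lambda>i j. tens (f i j) (1 :: complex))) = tens (det (imat is js f)) (1 :: complex)"
  if "length is = length js" for f :: "_ \<Rightarrow> _ \<Rightarrow> 'e::field_char_0"
proof -
  have "imat is js (\<lambda>i j. tens (f i j) (1 :: complex)) = map_mat (\<lambda>x. tens x 1) (imat is js f)"
    by (auto simp: imat_def intro!: eq_matI)
  then show ?thesis by (simp only: tens_left_hom.hom_det)
qed

lemma period_class_eqI: "period_class_eq x y \<Longrightarrow> period_class x = period_class y"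
  by (rule Quotient3_rel_abs[OF Quotient3_period_class])

context bdr_period_basis
begin

abbreviation "N \<equiv> restriction_of_scalars M"

lemma restriction_simps:
  "betti_scale N = (\<lambda>e x \<sigma>. betti_scale M e (x \<sigma>))"
  "betti N \<rho> = {x. (\<forall>\<sigma>\<in>Emb. x \<sigma> \<in> betti M \<sigma>) \<and> (\<forall>\<sigma>. \<sigma> \<notin> Emb \<longrightarrow> x \<sigma> = 0)}"
  "frob N \<rho> = (\<lambda>x \<sigma>. if \<sigma> \<in> Emb then frob M (conj_emb \<sigma>) (x (conj_emb \<sigma>)) else 0)"
  "filt N = filt M" "weight N = weight M" "dR_scale_E N = dR_scale_E M"
proof -
  have "additive (of_rat :: rat \<Rightarrow> 'k)" by (simp add: additive_def of_rat_add)
  then show "dR_scale_E N = dR_scale_E M"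
    by (intro ext) (simp add: dR_scale_E_def restriction_of_scalars_def tensor_map_tens[OF _ additive_id(1)])
qed (simp_all add: restriction_of_scalars_def)

text \<open>The Betti counterpart of \<open>u j + sfrob s (u j)\<close>: a basis vector together
  with its signed Frobenius image at the conjugate embedding.\<close>

definition w :: "int \<Rightarrow> ('k \<Rightarrow> complex) \<times> 'b \<Rightarrow> ('k \<Rightarrow> complex) \<Rightarrow> 'b" where
  "w s j = (\<lambda>\<tau>. if \<tau> = fst j then snd j
     else if \<tau> = conj_emb (fst j) then (if s = 1 then frob M (fst j) (snd j) else - frob M (fst j) (snd j)) else 0)"

definition cw :: "('k \<Rightarrow> complex) \<times> 'b \<Rightarrow> (('k \<Rightarrow> complex) \<Rightarrow> 'b) \<Rightarrow> 'e" where
  "cw j x = lB (fst j) (snd j) (x (fst j))"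

lemma additive_cw: "j \<in> J \<Longrightarrow> additive (cw j)"
  by (rule additive.intro) (simp add: cw_def additive.add[OF lB(1)[OF JD(1)]])

lemma cw_scale: "j \<in> J \<Longrightarrow> cw j (betti_scale N a x) = a * cw j x"
  by (simp add: cw_def restriction_simps lB(2) JD(1))

lemma cw_w:
  assumes "i \<in> J" "j \<in> J"
  shows "cw j (w s i) = (if i = j then 1 else 0)"
proof -
  note j = JD(1)[OF assms(2)]
  have "fst j \<noteq> conj_emb (fst i)" using PhiD(3)[OF JD(1)[OF assms(1)]] j by metis
  then show ?thesis
    using lB(3)[OF j, of "snd i" "snd j"] JD(2)[OF assms(1)] additive.zero[OF lB(1)[OF j]]
    by (auto simp: cw_def w_def prod_eq_iff)
qed

lemma eigenspace_iff:
  "x \<in> eigenspace N s \<longleftrightarrow> (\<forall>\<sigma>\<in>Emb. x \<sigma> \<in> betti M \<sigma>) \<and> (\<forall>\<sigma>. \<sigma> \<notin> Emb \<longrightarrow> x \<sigma> = 0) \<and>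
    (\<forall>\<sigma>\<in>Emb. frob M (conj_emb \<sigma>) (x (conj_emb \<sigma>)) = (if s = 1 then x \<sigma> else - x \<sigma>))"
proof -
  have "(\<lambda>\<sigma>. if \<sigma> \<in> Emb then frob M (conj_emb \<sigma>) (x (conj_emb \<sigma>)) else 0) = (if s = 1 then x else - x) \<longleftrightarrow>
      (\<forall>\<sigma>\<in>Emb. frob M (conj_emb \<sigma>) (x (conj_emb \<sigma>)) = (if s = 1 then x \<sigma> else - x \<sigma>))"
    (is "?f = ?g \<longleftrightarrow> ?P") if 0: "\<forall>\<sigma>. \<sigma> \<notin> Emb \<longrightarrow> x \<sigma> = 0"
  proof
    assume eq: "?f = ?g"
    show ?P
    proof
      fix \<sigma> :: "'k \<Rightarrow> complex" assume "\<sigma> \<in> Emb"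
      then show "frob M (conj_emb \<sigma>) (x (conj_emb \<sigma>)) = (if s = 1 then x \<sigma> else - x \<sigma>)"
        using fun_cong[OF eq, of \<sigma>] by (cases "s = 1") simp_all
    qed
  next
    assume P: ?P
    show "?f = ?g"
    proof
      fix \<sigma> show "?f \<sigma> = ?g \<sigma>"
        using bspec[OF P, of \<sigma>] 0 by (cases "\<sigma> \<in> Emb"; cases "s = 1") simp_all
    qed
  qed
  then show ?thesis unfolding eigenspace_def restriction_simps mem_Collect_eq by blast
qed

lemma w_eigenspace:
  assumes j: "j \<in> J"
  shows "w s j \<in> eigenspace N s"
  unfolding eigenspace_iff
proof (intro conjI ballI allI impI)
  define \<sigma> b where "\<sigma> = fst j" and "b = snd j"
  have s: "\<sigma> \<in> Emb" "conj_emb \<sigma> \<in> Emb" "b \<in> betti M \<sigma>" using JD[OF j] PhiD by (auto simp: \<sigma>_def b_def)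
  have ne: "conj_emb \<sigma> \<noteq> \<sigma>" using JD(1)[OF j] PhiD(3) by (metis \<sigma>_def)
  note Fb = frob_betti(1,2)[OF s(1,3)]
  have ww: "w s j = (\<lambda>\<tau>. if \<tau> = \<sigma> then b else if \<tau> = conj_emb \<sigma> then (if s = 1 then frob M \<sigma> b else - frob M \<sigma> b) else 0)"
    unfolding w_def \<sigma>_def b_def ..
  fix \<tau> :: "'k \<Rightarrow> complex"
  show "w s j \<tau> = 0" if "\<tau> \<notin> Emb" using that s by (auto simp: ww)
  assume t: "\<tau> \<in> Emb"
  note c = betti_closed[OF t] betti_closed[OF s(2)]
  show "w s j \<tau> \<in> betti M \<tau>" using s Fb c by (simp add: ww)
  consider "\<tau> = \<sigma>" | "\<tau> = conj_emb \<sigma>" | "\<tau> \<noteq> \<sigma>" "\<tau> \<noteq> conj_emb \<sigma>" by blast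
  then show "frob M (conj_emb \<tau>) (w s j (conj_emb \<tau>)) = (if s = 1 then w s j \<tau> else - w s j \<tau>)"
  proof cases
    case 1
    then show ?thesis unfolding ww using ne Fb frob_hom(2)[OF s(2) Fb(1)] by simp
  next
    case 2
    then show ?thesis unfolding ww using ne by simp
  next
    case 3
    then have "conj_emb \<tau> \<noteq> \<sigma>" "conj_emb \<tau> \<noteq> conj_emb \<sigma>" by (metis conj_emb_conj_emb)+
    then show ?thesis unfolding ww using 3 frob_hom(1)[OF conj_emb_embedding[OF t]] by simp
  qed
qed

text \<open>An eigenvector is determined by its components over \<Phi>, because each component at a
  conjugate embedding is the signed Frobenius image of one over \<Phi>.\<close>

lemma eigenspace_expand:
  assumes x: "x \<in> eigenspace N s"
  shows "x = (\<Sum>j\<in>J. betti_scale N (cw j x) (w s j))"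
proof
  interpret V: vector_space "betti_scale M" by (rule betti_vector_space)
  have e: "(\<Sum>j\<in>J. betti_scale N (cw j x) (w s j)) \<tau> = (\<Sum>j\<in>J. betti_scale M (cw j x) (w s j \<tau>))" for \<tau>
    unfolding additive.sum[OF additive.intro[of "\<lambda>f. f \<tau>", OF plus_fun_apply]] restriction_simps ..
  have xb: "x \<tau> \<in> betti M \<tau>" if "\<tau> \<in> Emb" for \<tau> using x that by (auto simp: eigenspace_iff)
  have P: "(\<Sum>j\<in>J. betti_scale M (cw j x) (w s j \<tau>)) = x \<tau>" if t: "\<tau> \<in> \<Phi>" for \<tau>
  proof -
    have "(\<Sum>j\<in>J. betti_scale M (cw j x) (w s j \<tau>)) = (\<Sum>j\<in>J. if fst j = \<tau> then betti_scale M (cw j x) (snd j) else 0)"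
    proof (rule sum.cong[OF refl])
      fix j assume "j \<in> J"
      then have "\<tau> \<noteq> conj_emb (fst j)" using t PhiD(3) JD(1) by metis
      then show "betti_scale M (cw j x) (w s j \<tau>) = (if fst j = \<tau> then betti_scale M (cw j x) (snd j) else 0)"
        by (auto simp: w_def)
    qed
    then show ?thesis unfolding sum_J_fst[OF t] using lB(4)[OF t xb[OF PhiD(1)[OF t]]] by (simp add: cw_def)
  qed
  have C: "(\<Sum>j\<in>J. betti_scale M (cw j x) (w s j (conj_emb \<tau>))) = x (conj_emb \<tau>)" if t: "\<tau> \<in> \<Phi>" for \<tau>
  proof -
    have "(\<Sum>j\<in>J. betti_scale M (cw j x) (w s j (conj_emb \<tau>)))
      = (\<Sum>j\<in>J. if fst j = \<tau> then betti_scale M (cw j x) (if s = 1 then frob M \<tau> (snd j) else - frob M \<tau> (snd j)) else 0)"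
    proof (rule sum.cong[OF refl])
      fix j assume "j \<in> J"
      then have "conj_emb \<tau> \<noteq> fst j" using t PhiD(3) JD(1) by metis
      moreover have "conj_emb \<tau> = conj_emb (fst j) \<longleftrightarrow> fst j = \<tau>" by (metis conj_emb_conj_emb)
      ultimately show "betti_scale M (cw j x) (w s j (conj_emb \<tau>)) =
        (if fst j = \<tau> then betti_scale M (cw j x) (if s = 1 then frob M \<tau> (snd j) else - frob M \<tau> (snd j)) else 0)"
        by (auto simp: w_def)
    qed
    also have "\<dots> = (\<Sum>b\<in>B \<tau>. betti_scale M (lB \<tau> b (x \<tau>)) (if s = 1 then frob M \<tau> b else - frob M \<tau> b))"
      unfolding sum_J_fst[OF t] by (simp add: cw_def cong: if_cong)
    also have "\<dots> = (if s = 1 then frob M \<tau> (x \<tau>) else - frob M \<tau> (x \<tau>))"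
    proof -
      have "frob M \<tau> (\<Sum>b\<in>B \<tau>. betti_scale M (lB \<tau> b (x \<tau>)) b) = (\<Sum>b\<in>B \<tau>. betti_scale M (lB \<tau> b (x \<tau>)) (frob M \<tau> b))"
        using frob_hom(3)[OF PhiD(1)[OF t] B(1)[OF t], of "\<lambda>b. b" "\<lambda>b. lB \<tau> b (x \<tau>)"] B(2)[OF t] by blast
      then show ?thesis
        unfolding lB(4)[OF t xb[OF PhiD(1)[OF t]], symmetric] by (simp add: sum_negf)
    qed
    also have "\<dots> = x (conj_emb \<tau>)"
      using x PhiD(2)[OF t] unfolding eigenspace_iff by (metis conj_emb_conj_emb minus_minus)
    finally show ?thesis .
  qed
  fix \<tau> :: "'k \<Rightarrow> complex"
  show "x \<tau> = (\<Sum>j\<in>J. betti_scale N (cw j x) (w s j)) \<tau>"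
  proof (cases "\<tau> \<in> Emb")
    case True
    then show ?thesis using P[of \<tau>] C[of "conj_emb \<tau>"] Phi(2)[of \<tau>] unfolding e by (cases "\<tau> \<in> \<Phi>") simp_all
  next
    case False
    have "w s j \<tau> = 0" if "j \<in> J" for j using w_eigenspace[OF that] False by (simp add: eigenspace_iff)
    then show ?thesis using False x unfolding e by (simp add: eigenspace_iff)
  qed
qed

text \<open>The image of \<open>tens x 1\<close> under the comparison isomorphism of the restriction
  of scalars, see \<open>comparison_N\<close>.\<close>

definition Y :: "(('k \<Rightarrow> complex) \<Rightarrow> 'b) \<Rightarrow> ('d, complex) tensor" where
  "Y x = (\<Sum>\<sigma>\<in>Emb. cmp \<sigma> (tens (x \<sigma>) 1))"

lemma KD_Y: "\<sigma> \<in> Emb \<Longrightarrow> KD (idem \<sigma>) (Y x) = cmp \<sigma> (tens (x \<sigma>) 1)"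
  using idempotents_exist(1)[OF nf]
  by (simp add: Y_def KD.scale_sum_right idem_cmp)

lemma comparison_N:
  assumes "x \<in> eigenspace N s"
  shows "comparison N of_rat (tens x 1) = {Y x}"
proof -
  have ev: "tensor_map (\<lambda>f. f \<sigma>) id (tens x (1::complex)) = tens (x \<sigma>) 1" for \<sigma> :: "'k \<Rightarrow> complex"
    unfolding tensor_map_tens[OF additive.intro[of "\<lambda>f. f \<sigma>"] additive_id(1), OF plus_fun_apply] by simp
  have "dR_coset M \<sigma> y = comparison M \<sigma> (tens (x \<sigma>) 1) \<longleftrightarrow> KD (idem \<sigma>) y = cmp \<sigma> (tens (x \<sigma>) 1)"
    if s: "\<sigma> \<in> Emb" for \<sigma> y
  proof -
    have "tens (x \<sigma>) 1 \<in> CB \<sigma>" using assms s by (intro complexification_tens) (simp add: eigenspace_iff)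
    then show ?thesis unfolding dR_coset_eq[OF s] comparison_eq[OF s \<open>tens (x \<sigma>) 1 \<in> CB \<sigma>\<close>] by auto
  qed
  then have "comparison N of_rat (tens x 1) = {y. \<forall>\<sigma>\<in>Emb. KD (idem \<sigma>) y = cmp \<sigma> (tens (x \<sigma>) 1)}"
    by (simp add: restriction_of_scalars_def ev cong: ball_cong)
  also have "\<dots> = {Y x}"
  proof (intro equalityI subsetI)
    fix y assume "y \<in> {y. \<forall>\<sigma>\<in>Emb. KD (idem \<sigma>) y = cmp \<sigma> (tens (x \<sigma>) 1)}"
    then have "(\<Sum>\<sigma>\<in>Emb. KD (idem \<sigma>) y) = (\<Sum>\<sigma>\<in>Emb. KD (idem \<sigma>) (Y x))" by (intro sum.cong refl) (simp add: KD_Y)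
    then show "y \<in> {Y x}" by (simp add: sum_KD_idem)
  qed (simp add: KD_Y)
  finally show ?thesis .
qed

text \<open>\<open>Y x\<close> is fixed by \<open>sfrob s\<close>, so \<open>eigen_expand\<close>
  applies, and its coordinates come from the coordinates \<open>cw j x\<close> in E. Periods of
  arbitrary eigenvectors are thus E-combinations of the \<open>per s i j\<close>.\<close>

lemma L_Y:
  assumes x: "x \<in> eigenspace N s"
  shows "L i (Y x) = (\<Sum>j\<in>J. tens (cw j x) 1 * per s i j)"
proof -
  have xb: "x \<tau> \<in> betti M \<tau>" if "\<tau> \<in> Emb" for \<tau> using x that by (auto simp: eigenspace_iff)
  have cu: "cu j (Y x) = tens (cw j x) 1" if j: "j \<in> J" for j
  proof -
    have "cinv (fst j) (Y x) = tens (x (fst j)) 1"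
      by (rule cinv_eqI[OF JD(4)[OF j] complexification_tens[OF xb[OF JD(4)[OF j]]]]) (rule KD_Y[OF JD(4)[OF j], symmetric])
    then show ?thesis unfolding cu_def cw_def by (simp only: linear_ext_tens[OF lB(1)[OF JD(1)[OF j]]])
  qed
  have F: "frobC (Y x) = (if s = 1 then Y x else - Y x)"
  proof -
    have cm: "cmp \<tau> (tens (if s = 1 then x \<tau> else - x \<tau>) 1) = (if s = 1 then cmp \<tau> (tens (x \<tau>) 1) else - cmp \<tau> (tens (x \<tau>) 1))"
      if t: "\<tau> \<in> Emb" for \<tau>
      using cmp_diff[OF t complexification_0 complexification_tens[OF xb[OF t]], of 1]
      by (simp add: cmp_0[OF t] tens_uminus_left)
    have "frobC (cmp \<sigma> (tens (x \<sigma>) 1)) = (if s = 1 then cmp (conj_emb \<sigma>) (tens (x (conj_emb \<sigma>)) 1) else - cmp (conj_emb \<sigma>) (tens (x (conj_emb \<sigma>)) 1))"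
      if t: "\<sigma> \<in> Emb" for \<sigma>
    proof -
      note ct = conj_emb_embedding[OF t]
      have "frob M \<sigma> (x \<sigma>) = (if s = 1 then x (conj_emb \<sigma>) else - x (conj_emb \<sigma>))"
        using x ct unfolding eigenspace_iff by (metis conj_emb_conj_emb)
      then show ?thesis unfolding frobC_cmp_tens[OF t xb[OF t]] by (simp only: cm[OF ct])
    qed
    then have "frobC (Y x) = (\<Sum>\<sigma>\<in>Emb. if s = 1 then cmp (conj_emb \<sigma>) (tens (x (conj_emb \<sigma>)) 1) else - cmp (conj_emb \<sigma>) (tens (x (conj_emb \<sigma>)) 1))"
      unfolding Y_def additive.sum[OF additive_frobC] by (intro sum.cong refl)
    also have "\<dots> = (\<Sum>\<sigma>\<in>Emb. if s = 1 then cmp \<sigma> (tens (x \<sigma>) 1) else - cmp \<sigma> (tens (x \<sigma>) 1))"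
      by (rule sum.reindex_bij_witness[of _ conj_emb conj_emb]) (auto intro: conj_emb_embedding)
    finally show ?thesis by (simp add: Y_def sum_negf)
  qed
  have "sfrob s (Y x) = Y x" using F by (simp add: sfrob_def)
  then have "Y x = (\<Sum>j\<in>J. RD (cu j (Y x)) (u j + sfrob s (u j)))" by (rule eigen_expand)
  also have "\<dots> = (\<Sum>j\<in>J. RD (tens (cw j x) 1) (u j + sfrob s (u j)))" by (intro sum.cong refl) (simp only: cu)
  finally have "L i (Y x) = L i (\<Sum>j\<in>J. RD (tens (cw j x) 1) (u j + sfrob s (u j)))" by (rule arg_cong)
  then show ?thesis by (simp add: L_sum L_scale per_def)
qed

lemma modules_N: "Modules.module (betti_scale N)"
proof -
  interpret V: vector_space "betti_scale M" by (rule betti_vector_space)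
  show ?thesis by unfold_locales (simp_all add: restriction_simps fun_eq_iff V.scale_right_distrib V.scale_left_distrib)
qed

end

context bdr_period_basis
begin

lemma basis_mod_betti:
  assumes "distinct js" "set js = J"
  shows "basis_mod (betti_scale N) (eigenspace N s) {0} (map (w s) js)"
proof (rule basis_modI[where l = cw, OF assms(1) _ modules_N])
  show "x - (\<Sum>j\<in>set js. betti_scale N (cw j x) (w s j)) \<in> {0}" if "x \<in> eigenspace N s" for x
    using eigenspace_expand[OF that] unfolding assms(2) by (metis right_minus_eq singletonI)
qed (simp_all add: assms w_eigenspace additive_cw cw_scale cw_w additive.zero[OF additive_cw])

lemma basis_mod_dR:
  assumes "distinct is" "set is = I"
  shows "basis_mod (dR_scale_E N) UNIV FilV is"
proof -
  have "basis_mod (dR_scale_E M) UNIV FilV (map (\<lambda>i. i) is)"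
    by (rule basis_modI[where l = lD, OF assms(1) _ modules(3)]) (use assms lD in simp_all)
  then show ?thesis by (simp add: restriction_simps(6))
qed

text \<open>The period is a definite description over all E-bases, so independence of the bases is
  part of the claim. Another pair of bases changes the period matrix by invertible matrices over E
  on both sides, and the determinant by a unit of E.\<close>

lemma rational_period_eq:
  assumes "is": "distinct is" "set is = I" and js: "distinct js" "set js = J"
  shows "rational_period N s = period_class (det (imat is js (per s)))"
  unfolding rational_period_def restriction_simps(4,5)
proof (rule the_equality)
  let ?A0 = "imat is js (per s)"
  have len: "length is = length js" using distinct_card[OF "is"(1)] distinct_card[OF js(1)] by (simp add: "is"(2) js(2) card_I)
  have "period_matrix N (map (w s) js) is ?A0"
    unfolding period_matrix_def restriction_simps(4,5,6)
  proof (intro conjI allI impI)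
    show "?A0 \<in> carrier_mat (length is) (length (map (w s) js))" by (simp add: imat_def)
    fix q assume q: "q < length (map (w s) js)"
    then have jq: "js ! q \<in> J" using nth_mem[of q js] unfolding js(2) by simp
    have wq: "map (w s) js ! q = w s (js ! q)" using q by simp
    have LY: "L i (Y (w s (js ! q))) = per s i (js ! q)" if "i \<in> I" for i
      unfolding L_Y[OF w_eigenspace[OF jq]]
      using jq finite_J by (simp add: cw_w if_distrib[of "\<lambda>x. tens x 1 * _"] flip: one_tensor_def cong: if_cong)
    have "(\<Sum>p<length is. RD (?A0 $$ (p, q)) (tens (is ! p) 1)) = (\<Sum>p<length is. RD (per s (is ! p) (js ! q)) (tens (is ! p) 1))"
      using q by (intro sum.cong) (auto simp: imat_def)
    also have "\<dots> = (\<Sum>i\<in>I. RD (L i (Y (w s (js ! q)))) (tens i 1))"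
      using sum_nth_distinct[OF "is"(1), of "\<lambda>i. RD (per s i (js ! q)) (tens i 1)"] by (simp add: "is"(2) LY)
    finally have "Y (w s (js ! q)) - (\<Sum>p<length is. RD (?A0 $$ (p, q)) (tens (is ! p) 1)) \<in> FilW"
      using L_expand by simp
    then show "\<exists>y\<in>comparison N of_rat (tens (map (w s) js ! q) 1).
        y - (\<Sum>i<length is. RD (?A0 $$ (i, q)) (tens (is ! i) 1)) \<in> FilW"
      unfolding wq comparison_N[OF w_eigenspace[OF jq]] by blast
  qed
  then show "\<exists>bs ds A. basis_mod (betti_scale N) (eigenspace N s) {0} bs \<and> basis_mod (dR_scale_E N) UNIV FilV ds \<and>
      length bs = length ds \<and> period_matrix N bs ds A \<and> det A dvd 1 \<and> period_class (det ?A0) = period_class (det A)"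
    using basis_mod_betti[OF js, of s] basis_mod_dR[OF "is"] det_period_unit[OF "is" js, of s] len
    by (intro exI[of _ "map (w s) js"] exI[of _ "is"] exI[of _ ?A0] conjI) (simp_all only: length_map)
next
  let ?A0 = "imat is js (per s)"
  fix c
  assume "\<exists>bs ds A. basis_mod (betti_scale N) (eigenspace N s) {0} bs \<and> basis_mod (dR_scale_E N) UNIV FilV ds \<and>
      length bs = length ds \<and> period_matrix N bs ds A \<and> det A dvd 1 \<and> c = period_class (det A)"
  then obtain bs ds A where bs: "basis_mod (betti_scale N) (eigenspace N s) {0} bs"
    and ds: "basis_mod (dR_scale_E N) UNIV FilV ds" and lbd: "length bs = length ds"
    and A: "period_matrix N bs ds A" and c: "c = period_class (det A)" by blast
  define n where "n = length bs"
  have lds: "length ds = n" using lbd by (simp add: n_def)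
  have len: "length is = length js" using distinct_card[OF "is"(1)] distinct_card[OF js(1)] by (simp add: "is"(2) js(2) card_I)
  have bsE: "bs ! q \<in> eigenspace N s" if "q < n" for q
    using bs that unfolding basis_mod_def n_def by (meson nth_mem subsetD)
  \<comment> \<open>The change of basis on the Betti side. \<open>G'\<close> is its inverse, which
    also shows that the foreign basis has the right length.\<close>
  define G where "G j q = cw j (bs ! q)" for j q
  obtain cb where cb: "\<And>x. x \<in> eigenspace N s \<Longrightarrow> x - (\<Sum>q<length bs. betti_scale N (cb x q) (bs ! q)) \<in> {0}"
    "\<And>x g h q. x \<in> eigenspace N s \<Longrightarrow> x - (\<Sum>q<length bs. betti_scale N (g q) (bs ! q)) \<in> {0} \<Longrightarrow>
      x - (\<Sum>q<length bs. betti_scale N (h q) (bs ! q)) \<in> {0} \<Longrightarrow> q < length bs \<Longrightarrow> g q = h q"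
    by (rule basis_modD[OF bs]) (rule that)
  define G' where "G' q j = cb (w s j) q" for q j
  have wG': "w s j = (\<Sum>q<n. betti_scale N (G' q j) (bs ! q))" if "j \<in> J" for j
    using cb(1)[OF w_eigenspace[OF that, of s]] by (simp add: G'_def n_def)
  have GG': "(\<Sum>q<n. G i q * G' q j) = (if i = j then 1 else 0)" if "i \<in> J" "j \<in> J" for i j
  proof -
    have "cw i (w s j) = cw i (\<Sum>q<n. betti_scale N (G' q j) (bs ! q))" using wG'[OF that(2)] by simp
    also have "\<dots> = (\<Sum>q<n. G i q * G' q j)"
      by (simp add: additive.sum[OF additive_cw[OF that(1)]] cw_scale[OF that(1)] G_def mult.commute)
    finally show ?thesis using cw_w[OF that(2,1), of s] by auto
  qed
  interpret VN: Modules.module "betti_scale N" by (rule modules_N)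
  have G'G: "(\<Sum>j\<in>J. G' q j * G j p) = (if q = p then 1 else 0)" if qp: "q < n" "p < n" for p q
  proof (rule cb(2)[OF bsE[OF qp(2)], where g = "\<lambda>q. \<Sum>j\<in>J. G' q j * G j p" and h = "\<lambda>q. if q = p then 1 else 0" and q = q])
    have "bs ! p = (\<Sum>j\<in>J. betti_scale N (G j p) (\<Sum>q<n. betti_scale N (G' q j) (bs ! q)))"
      by (subst eigenspace_expand[OF bsE[OF qp(2)]]) (simp add: G_def wG')
    also have "\<dots> = (\<Sum>j\<in>J. \<Sum>q<n. betti_scale N (G' q j * G j p) (bs ! q))"
      by (simp add: VN.scale_sum_right mult.commute)
    also have "\<dots> = (\<Sum>q<n. \<Sum>j\<in>J. betti_scale N (G' q j * G j p) (bs ! q))" by (rule sum.swap)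
    finally show "bs ! p - (\<Sum>q<length bs. betti_scale N (\<Sum>j\<in>J. G' q j * G j p) (bs ! q)) \<in> {0}"
      by (simp add: VN.scale_sum_left n_def)
    have "(\<Sum>q<n. betti_scale N (if q = p then 1 else 0) (bs ! q)) = (\<Sum>q<n. if q = p then bs ! q else 0)"
      by (intro sum.cong) auto
    then show "bs ! p - (\<Sum>q<length bs. betti_scale N (if q = p then 1 else 0) (bs ! q)) \<in> {0}"
      using qp by (simp add: n_def)
    show "q < length bs" using qp by (simp add: n_def)
  qed
  have "card J = card {..<n}"
    by (rule length_eq_if_inverse[OF finite_J finite_lessThan, of G G']) (simp_all add: GG' G'G)
  then have ljs: "length js = n" using distinct_card[OF js(1)] by (simp add: js(2))
  \<comment> \<open>The change of basis on the de Rham side, modulo the filtration, with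
    \<open>cd\<close> as its inverse.\<close>
  define H where "H i p = lD i (ds ! p)" for i p
  obtain cd where cd: "\<And>x. x \<in> UNIV \<Longrightarrow> x - (\<Sum>q<length ds. dR_scale_E N (cd x q) (ds ! q)) \<in> FilV"
    "\<And>x g h q. x \<in> UNIV \<Longrightarrow> x - (\<Sum>q<length ds. dR_scale_E N (g q) (ds ! q)) \<in> FilV \<Longrightarrow>
      x - (\<Sum>q<length ds. dR_scale_E N (h q) (ds ! q)) \<in> FilV \<Longrightarrow> q < length ds \<Longrightarrow> g q = h q"
    by (rule basis_modD[OF ds]) (rule that)
  have HH': "(\<Sum>p<n. H i p * cd k p) = (if i = k then 1 else 0)" if "i \<in> I" "k \<in> I" for i k
  proof -
    have "lD i (k - (\<Sum>p<n. dR_scale_E M (cd k p) (ds ! p))) = 0"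
      using lD(4)[OF that(1) cd(1)[of k]] by (simp add: lds restriction_simps(6))
    then have "lD i k = (\<Sum>p<n. H i p * cd k p)"
      by (simp add: additive.diff[OF lD(1)] additive.sum[OF lD(1)] lD(2) H_def mult.commute)
    then show ?thesis using lD(3)[OF that(2), of i] by auto
  qed
  have eq: "(\<Sum>j\<in>J. per s i j * tens (G j q) 1) = (\<Sum>p<n. tens (H i p) 1 * A $$ (p, q))" if i: "i \<in> I" and q: "q < n" for i q
  proof -
    obtain y where "y \<in> comparison N of_rat (tens (bs ! q) 1)"
      "y - (\<Sum>p<n. RD (A $$ (p, q)) (tens (ds ! p) 1)) \<in> FilW"
      using A q unfolding period_matrix_def restriction_simps(4,5,6) lds n_def by blast
    then have "Y (bs ! q) - (\<Sum>p<n. RD (A $$ (p, q)) (tens (ds ! p) 1)) \<in> FilW"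
      unfolding comparison_N[OF bsE[OF q]] by simp
    then have "L i (Y (bs ! q)) = L i (\<Sum>p<n. RD (A $$ (p, q)) (tens (ds ! p) 1))" by (rule L_cong[OF i])
    also have "\<dots> = (\<Sum>p<n. tens (H i p) 1 * A $$ (p, q))"
      unfolding L_sum L_scale by (simp add: L_def linear_ext_tens[OF lD(1)] H_def mult.commute)
    finally show ?thesis unfolding L_Y[OF bsE[OF q]] by (simp add: G_def mult.commute)
  qed
  \<comment> \<open>The foreign bases are arbitrary lists, so their matrices are indexed by
    positions.\<close>
  let ?ns = "[0..<n]"
  have ns: "distinct ?ns" "set ?ns = {..<n}" "length ?ns = n" by auto
  have A_imat: "A = imat ?ns ?ns (\<lambda>p q. A $$ (p, q))"
    using A unfolding period_matrix_def by (intro eq_matI) (auto simp: imat_def lds n_def)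
  have prod: "?A0 * imat js ?ns (\<lambda>j q. tens (G j q) 1) = imat is ?ns (\<lambda>i p. tens (H i p) 1) * A"
    apply (subst A_imat)
    unfolding imat_mult[OF js(1)] imat_mult[OF ns(1)]
    by (intro imat_cong) (use eq "is" js in \<open>simp add: atLeast0LessThan\<close>)
  have carr: "?A0 \<in> carrier_mat n n" "imat js ?ns f \<in> carrier_mat n n" "imat is ?ns f' \<in> carrier_mat n n" "A \<in> carrier_mat n n" for f f'
    using len ljs A unfolding period_matrix_def by (auto simp: imat_def lds n_def)
  have "det ?A0 * det (imat js ?ns (\<lambda>j q. tens (G j q) 1)) = det (imat is ?ns (\<lambda>i p. tens (H i p) 1)) * det A"
    using arg_cong[OF prod, of det] unfolding det_mult[OF carr(1,2)] det_mult[OF carr(3,4)] .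
  then have dets: "det ?A0 * tens (det (imat js ?ns G)) 1 = tens (det (imat is ?ns H)) 1 * det A"
    using det_imat_tens[of js ?ns G] det_imat_tens[of "is" ?ns H] len ljs by simp
  have "det (imat js ?ns G) * det (imat ?ns js G') = 1"
    by (rule det_inverse_imat[OF js(1) ns(1)]) (simp_all add: ljs GG' js atLeast0LessThan)
  then have dG: "det (imat js ?ns G) \<noteq> 0" by auto
  have "det (imat is ?ns H) * det (imat ?ns is (\<lambda>p k. cd k p)) = 1"
    by (rule det_inverse_imat[OF "is"(1) ns(1)]) (simp_all add: ljs len HH' "is" atLeast0LessThan)
  then have dH: "det (imat is ?ns H) \<noteq> 0" by auto
  have "det A = tens (inverse (det (imat is ?ns H)) * det (imat is ?ns H)) 1 * det A" using dH by (simp flip: one_tensor_def)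
  also have "\<dots> = tens (inverse (det (imat is ?ns H))) 1 * (tens (det (imat is ?ns H)) 1 * det A)"
    by (simp add: tens_times_tens flip: mult.assoc)
  also have "\<dots> = tens (inverse (det (imat is ?ns H)) * det (imat js ?ns G)) 1 * det ?A0"
    unfolding dets[symmetric] using tens_times_tens[of "inverse (det (imat is ?ns H))" "1::complex" "det (imat js ?ns G)" 1]
    by (simp add: mult_ac)
  finally have "det A = tens (inverse (det (imat is ?ns H)) * det (imat js ?ns G)) 1 * det ?A0" .
  moreover have "inverse (det (imat is ?ns H)) * det (imat js ?ns G) \<noteq> 0" using dG dH by simp
  ultimately have "period_class_eq (det ?A0) (det A)"
    using det_period_unit[OF "is" js] unfolding period_class_eq_def by blast
  then show "c = period_class (det ?A0)" unfolding c by (rule period_class_eqI[symmetric])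
qed

section \<open>Trace functionals on K and the ranks at the embeddings\<close>

lemma eval_C_linear_ext:
  fixes h :: "'e \<Rightarrow> rat" and g :: "'k \<Rightarrow> 'e"
  assumes "additive h" "additive g"
  shows "eval_C (\<lambda>k. of_rat (h (g k))) y = eval_C (\<lambda>e. of_rat (h e)) (linear_ext g y)"
proof -
  have ad: "additive (\<lambda>k. complex_of_rat (h (g k)))" "additive (\<lambda>e. complex_of_rat (h e))"
    using assms by (simp_all add: additive_def of_rat_add)
  show ?thesis
    by (rule tensor_eqI[of "eval_C (\<lambda>k. of_rat (h (g k)))" "\<lambda>y. eval_C (\<lambda>e. of_rat (h e)) (linear_ext g y)"])
      (simp_all only: eval_C(1,2)[OF ad(1)] eval_C(1)[OF ad(2)] linear_ext_tens[OF assms(2)]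
        additive_comp[OF eval_C(2)[OF ad(2)] additive_linear_ext[OF assms(2)]])
qed

text \<open>The trace of the action of K is a functional from K to E. Its C-linear extension yields
  the traces of the idempotents, although these do not come from K.\<close>

lemma linear_ext_trace:
  assumes "\<And>i. additive (l i)"
  shows "additive (\<lambda>k. \<Sum>i\<in>I'. l i (dR_scale_K M k i))"
    "linear_ext (\<lambda>k. \<Sum>i\<in>I'. l i (dR_scale_K M k i)) y = (\<Sum>i\<in>I'. linear_ext (l i) (KD y (tens i 1)))"
proof -
  interpret K: Modules.module "dR_scale_K M" by (rule modules)
  show ad: "additive (\<lambda>k. \<Sum>i\<in>I'. l i (dR_scale_K M k i))"
    by (intro additive_sum_fun additive.intro) (simp add: K.scale_left_distrib additive.add[OF assms])
  show "linear_ext (\<lambda>k. \<Sum>i\<in>I'. l i (dR_scale_K M k i)) y = (\<Sum>i\<in>I'. linear_ext (l i) (KD y (tens i 1)))"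
  proof (rule tensor_eqI[of "linear_ext (\<lambda>k. \<Sum>i\<in>I'. l i (dR_scale_K M k i))"])
    show "additive (linear_ext (\<lambda>k. \<Sum>i\<in>I'. l i (dR_scale_K M k i)) :: ('k, complex) tensor \<Rightarrow> _)"
      by (rule additive_linear_ext[OF ad])
    show "additive (\<lambda>y. \<Sum>i\<in>I'. linear_ext (l i) (KD y (tens i 1)))"
      by (intro additive_sum_fun additive.intro) (simp only: KD.scale_left_distrib additive.add[OF additive_linear_ext[OF assms]])
    show "linear_ext (\<lambda>k. \<Sum>i\<in>I'. l i (dR_scale_K M k i)) (tens k z) = (\<Sum>i\<in>I'. linear_ext (l i) (KD (tens k z) (tens i 1)))" for k z
      unfolding linear_ext_tens[OF ad] tensor_scale_simps(1)[OF biadd(2)] linear_ext_tens[OF assms] mult_1_right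
      by (rule tens_sum_left)
  qed
qed

lemma eval_C_of_nat:
  fixes h :: "'e \<Rightarrow> rat"
  assumes "additive h"
  shows "eval_C (\<lambda>e. of_rat (h e)) (of_nat n) = of_rat (h 1) * of_nat n"
  unfolding tens_1_of_nat[symmetric] by (rule eval_C(1)) (use assms in \<open>simp add: additive_def of_rat_add\<close>)

lemma dR_coordinates:
  obtains I' l where "finite I'" "\<And>i. additive (l i)" "\<And>i a x. l i (dR_scale_E M a x) = a * l i x"
    "\<And>x. x = (\<Sum>i\<in>I'. dR_scale_E M (l i x) i)"
proof -
  interpret D: vector_space "dR_scale_E M" by (rule dR_vector_space)
  obtain S where S: "finite S" "D.span S = UNIV" using dR_finite by blast
  have span: "UNIV \<subseteq> D.span S" by (simp add: S(2))
  obtain I' :: "'d set" and l where l: "finite I'" "card I' = D.dim (UNIV :: 'd set)" "I' \<subseteq> UNIV" "\<And>b. additive (l b)"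
    "\<And>b a x. l b (dR_scale_E M a x) = a * l b x" "\<And>b b'. b' \<in> I' \<Longrightarrow> l b b' = (if b' = b then 1 else 0)"
    "\<And>x. x \<in> UNIV \<Longrightarrow> x = (\<Sum>b\<in>I'. dR_scale_E M (l b x) b)"
    by (rule D.subspace_coordinates_exist[OF D.subspace_UNIV S(1) span]) (rule that)
  show ?thesis by (rule that[OF l(1,4,5)]) (rule l(7)[OF UNIV_I])
qed

text \<open>The trace of K on M_dR, composed with an additive map \<open>h\<close> from E to the
  rationals with \<open>h 1 = 1\<close>, is represented by some \<open>a\<close> in K. The conjugate
  of \<open>a\<close> at \<sigma> is the dimension at \<sigma>. A conjugate that is a natural number
  determines \<open>a\<close>, so all these dimensions agree.\<close>

lemma card_B_const:
  assumes "\<sigma> \<in> \<Phi>" "\<tau> \<in> \<Phi>"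
  shows "card (B \<sigma>) = card (B \<tau>)"
proof -
  obtain I' l where l: "finite I'" "\<And>i. additive (l i)" "\<And>i a x. l i (dR_scale_E M a x) = a * l i x"
    "\<And>x. x = (\<Sum>i\<in>I'. dR_scale_E M (l i x) i)"
    by (rule dR_coordinates) (rule that)
  define tr where "tr k = (\<Sum>i\<in>I'. l i (dR_scale_K M k i))" for k
  have tr: "additive tr" unfolding tr_def by (rule linear_ext_trace(1)[OF l(2)])
  obtain h :: "'e \<Rightarrow> rat" where h: "additive h" "h 1 = 1"
    using field_char_0_functional[where 'a = 'e] by (auto simp: additive_def)
  obtain a :: 'k where a: "\<And>\<sigma>. \<sigma> \<in> Emb \<Longrightarrow> \<sigma> a = eval_C (\<lambda>k. of_rat (h (tr k))) (idem \<sigma>)"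
    using trace_duality[OF nf additive_comp[OF h(1) tr]] by blast
  have "a = of_nat (card (B \<sigma>))" if s: "\<sigma> \<in> \<Phi>" for \<sigma>
  proof -
    have "linear_ext tr (idem \<sigma>) = of_nat (card (B \<sigma>))"
      unfolding tr_def linear_ext_trace(2)[OF l(2)] by (rule trace_W(1)[OF l s])
    then have "\<sigma> a = \<sigma> (of_nat (card (B \<sigma>)))"
      unfolding a[OF PhiD(1)[OF s]] eval_C_linear_ext[OF h(1) tr]
      by (simp add: eval_C_of_nat[OF h(1)] h(2) embedding_of_nat[OF PhiD(1)[OF s]])
    then show ?thesis by (simp only: embedding_inj[OF PhiD(1)[OF s]])
  qed
  from this[OF assms(1)] this[OF assms(2)] show ?thesis by (metis of_nat_eq_iff)
qed

text \<open>Unless the ranks of the two summands of \<open>M\<^sub>d\<^sub>R / F\<close> for conjugate embeddings agree, the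
  difference of the traces is dual to a nonzero element with purely imaginary conjugates.\<close>

lemma trV_eq_half:
  assumes no: "\<nexists>r :: 'k. purely_imaginary r" and s: "\<sigma> \<in> \<Phi>"
  shows "2 * trV (idem \<sigma>) = of_nat (card (B \<sigma>))"
proof -
  obtain I' l where l: "finite I'" "\<And>i. additive (l i)" "\<And>i a x. l i (dR_scale_E M a x) = a * l i x"
    "\<And>x. x = (\<Sum>i\<in>I'. dR_scale_E M (l i x) i)"
    by (rule dR_coordinates) (rule that)
  define tr1 where "tr1 k = (\<Sum>i\<in>I'. l i (dR_scale_K M k i))" for k
  define tr2 where "tr2 k = (\<Sum>i\<in>I. lD i (dR_scale_K M k i))" for k
  \<comment> \<open>At \<open>idem \<sigma>\<close> the extension of this functional is the rank of
    the summand of \<open>FilW\<close> minus that of the quotient, which changes sign under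
    conjugation by Hodge symmetry.\<close>
  define g where "g k = tr1 k - (tr2 k + tr2 k)" for k
  have tr: "additive tr1" "additive tr2"
    unfolding tr1_def tr2_def by (rule linear_ext_trace(1)[OF l(2)], rule linear_ext_trace(1)[OF lD(1)])
  then have g: "additive g" unfolding g_def by (simp add: additive_def)
  have gext: "linear_ext g y = linear_ext tr1 y - (trV y + trV y)" for y
  proof -
    have "linear_ext g y = linear_ext tr1 y - (linear_ext tr2 y + linear_ext tr2 y)"
    proof (rule tensor_eqI[of "linear_ext g"])
      show "additive (\<lambda>y. linear_ext tr1 y - (linear_ext tr2 y + linear_ext tr2 y) :: ('e, complex) tensor)"
        by (rule additive.intro)
          (simp add: additive.add[OF additive_linear_ext[OF tr(1)]] additive.add[OF additive_linear_ext[OF tr(2)]])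
      show "linear_ext g (tens a b) = linear_ext tr1 (tens a b) - (linear_ext tr2 (tens a b) + linear_ext tr2 (tens a b))" for a b
        by (simp only: linear_ext_tens[OF g] linear_ext_tens[OF tr(1)] linear_ext_tens[OF tr(2)] g_def tens_diff_left tens_add_left)
    qed (rule additive_linear_ext[OF g])
    moreover have "linear_ext tr2 y = trV y"
      unfolding tr2_def trV_def L_def by (rule linear_ext_trace(2)[OF lD(1)])
    ultimately show ?thesis by simp
  qed
  have g1: "linear_ext g (idem \<tau>) = of_nat (card (B \<tau>)) - (trV (idem \<tau>) + trV (idem \<tau>))"
    and g2: "linear_ext g (idem (conj_emb \<tau>)) = - linear_ext g (idem \<tau>)" if t: "\<tau> \<in> \<Phi>" for \<tau>
  proof -
    show 1: "linear_ext g (idem \<tau>) = of_nat (card (B \<tau>)) - (trV (idem \<tau>) + trV (idem \<tau>))"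
      unfolding gext tr1_def linear_ext_trace(2)[OF l(2)] trace_W(1)[OF l t] ..
    have "linear_ext g (idem (conj_emb \<tau>)) = of_nat (card (B \<tau>)) - (trV (idem (conj_emb \<tau>)) + trV (idem (conj_emb \<tau>)))"
      unfolding gext tr1_def linear_ext_trace(2)[OF l(2)] trace_W(2)[OF l t] ..
    moreover have "trV (idem (conj_emb \<tau>)) = of_nat (card (B \<tau>)) - trV (idem \<tau>)" using trV_idem[OF t] by (simp add: algebra_simps)
    ultimately show "linear_ext g (idem (conj_emb \<tau>)) = - linear_ext g (idem \<tau>)" unfolding 1 by simp
  qed
  have h0: "h (g x) = 0" if h: "additive h" for h :: "'e \<Rightarrow> rat" and x
  proof -
    have ad: "additive (\<lambda>e. complex_of_rat (h e))" "additive (\<lambda>k. complex_of_rat (h (g k)))"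
      using h g by (simp_all add: additive_def of_rat_add)
    obtain a :: 'k where a: "\<And>\<sigma>. \<sigma> \<in> Emb \<Longrightarrow> \<sigma> a = eval_C (\<lambda>k. of_rat (h (g k))) (idem \<sigma>)"
      using trace_duality[OF nf additive_comp[OF h g]] by blast
    have conj: "conj_emb \<tau> a = - \<tau> a" if t: "\<tau> \<in> \<Phi>" for \<tau>
      unfolding a[OF PhiD(1)[OF t]] a[OF PhiD(2)[OF t]] eval_C_linear_ext[OF h g] g2[OF t]
      by (rule eval_C(6)[OF ad(1)])
    have "Re (\<tau> a) = 0" if t: "\<tau> \<in> Emb" for \<tau>
    proof (cases "\<tau> \<in> \<Phi>")
      case True
      then show ?thesis using arg_cong[OF conj[OF True], of Re] by (simp add: conj_emb_def)
    next
      case False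
      then have "conj_emb \<tau> \<in> \<Phi>" using Phi(2)[OF t] by simp
      from arg_cong[OF conj[OF this], of Re] show ?thesis by (simp add: conj_emb_def)
    qed
    then have "a = 0" using no by (auto simp: purely_imaginary_def)
    \<comment> \<open>The functional vanishes at all idempotents, since its values there are the
      conjugates of \<open>a = 0\<close>, and hence on their combinations.\<close>
    have "complex_of_rat (h (g x)) = eval_C (\<lambda>k. of_rat (h (g k))) (tens x 1 * (\<Sum>\<sigma>\<in>Emb. idem \<sigma>))"
      by (simp add: sum_idem[OF nf] eval_C(1)[OF ad(2)])
    also have "\<dots> = (\<Sum>\<sigma>\<in>Emb. \<sigma> x * eval_C (\<lambda>k. of_rat (h (g k))) (idem \<sigma>))"
      unfolding sum_distrib_left eval_C(5)[OF ad(2)]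
      by (intro sum.cong refl) (simp only: tens_idem[OF nf] eval_C_scale[OF ad(2)])
    also have "\<dots> = 0" using a \<open>a = 0\<close> by (intro sum.neutral) (simp add: embedding_hom)
    finally show ?thesis by simp
  qed
  have "g x = 0" for x
  proof (rule ccontr)
    assume "g x \<noteq> 0"
    obtain h :: "'e \<Rightarrow> rat" where h: "additive h" "h 1 = 1"
      using field_char_0_functional[where 'a = 'e] by (auto simp: additive_def)
    \<comment> \<open>Rescaling moves the nonzero value \<open>g x\<close> to 1, where
      \<open>h\<close> does not vanish.\<close>
    have "additive (\<lambda>e. h (e / g x))" by (simp add: additive_def add_divide_distrib additive.add[OF h(1)])
    from h0[OF this, of x] show False using \<open>g x \<noteq> 0\<close> h(2) by simp
  qed
  then have "linear_ext g (idem \<sigma>) = 0"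
    by (intro linear_ext_vanish[OF complexification_UNIV g])
  then show ?thesis unfolding g1[OF s] by simp
qed

lemma KD_tens_1_RD: "KD (tens 1 c) y = RD (tens 1 c) y"
proof (rule tensor_eqI[of "KD (tens 1 c)", OF additive_KD additive_RD])
  interpret E: Modules.module "dR_scale_E M" by (rule modules)
  show "KD (tens 1 c) (tens a b) = RD (tens 1 c) (tens a b)" for a b
    unfolding KD_tens_1 tensor_scale_simps(1)[OF biadd(3)] by simp
qed

end

section \<open>Existence of the bases\<close>

lemma (in bdr_over) betti_basis_exists:
  assumes vm: "vanishing_middle_hodge_number M"
    and Phi: "\<Phi> \<subseteq> Emb" "\<And>\<sigma>. \<sigma> \<in> Emb \<Longrightarrow> \<sigma> \<in> \<Phi> \<longleftrightarrow> conj_emb \<sigma> \<notin> \<Phi>"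
  obtains B lB where "bdr_betti_basis M \<Phi> B lB"
    "\<And>\<sigma>. \<sigma> \<in> \<Phi> \<Longrightarrow> card (B \<sigma>) = vector_space.dim (betti_scale M) (betti M \<sigma>)"
proof -
  interpret V: vector_space "betti_scale M" by (rule betti_vector_space)
  define P where "P \<sigma> B l \<longleftrightarrow> finite B \<and> card B = V.dim (betti M \<sigma>) \<and> B \<subseteq> betti M \<sigma> \<and> (\<forall>b. additive (l b)) \<and>
    (\<forall>b a x. l b (betti_scale M a x) = a * l b x) \<and> (\<forall>b b'. b' \<in> B \<longrightarrow> l b b' = (if b' = b then 1 else 0)) \<and>
    (\<forall>x\<in>betti M \<sigma>. x = (\<Sum>b\<in>B. betti_scale M (l b x) b))" for \<sigma> B and l :: "'b \<Rightarrow> 'b \<Rightarrow> 'e"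
  have "\<exists>B l. P \<sigma> B l" if s: "\<sigma> \<in> \<Phi>" for \<sigma>
  proof -
    have e: "\<sigma> \<in> Emb" using s Phi(1) by blast
    obtain S where S: "finite S" "V.span S = betti M \<sigma>" using betti_finite[OF e] by blast
    have sub: "betti M \<sigma> \<subseteq> V.span S" by (simp add: S(2))
    obtain B :: "'b set" and l where Bl: "finite B" "card B = V.dim (betti M \<sigma>)" "B \<subseteq> betti M \<sigma>" "\<And>b. additive (l b)"
      "\<And>b a x. l b (betti_scale M a x) = a * l b x" "\<And>b b'. b' \<in> B \<Longrightarrow> l b b' = (if b' = b then 1 else 0)"
      "\<And>x. x \<in> betti M \<sigma> \<Longrightarrow> x = (\<Sum>b\<in>B. betti_scale M (l b x) b)"
      by (rule V.subspace_coordinates_exist[OF betti_subspace[OF e] S(1) sub]) (rule that)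
    have "P \<sigma> B l" unfolding P_def by (intro conjI allI ballI impI Bl)
    then show ?thesis by blast
  qed
  then obtain B where "\<forall>\<sigma>\<in>\<Phi>. \<exists>l. P \<sigma> (B \<sigma>) l" using bchoice[of \<Phi> "\<lambda>\<sigma> B. \<exists>l. P \<sigma> B l"] by blast
  then obtain l where Bl: "\<And>\<sigma>. \<sigma> \<in> \<Phi> \<Longrightarrow> P \<sigma> (B \<sigma>) (l \<sigma>)" using bchoice[of \<Phi> "\<lambda>\<sigma>. P \<sigma> (B \<sigma>)"] by blast
  show ?thesis
  proof (rule that)
    show "bdr_betti_basis M \<Phi> B l"
      by (intro bdr_betti_basis.intro bdr_over_axioms bdr_betti_basis_axioms.intro)
        (use vm Phi Bl in \<open>simp_all add: P_def\<close>)
  qed (use Bl[unfolded P_def] in blast)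
qed

text \<open>A basis of \<open>FilV\<close> is extended to one of M_dR. The added vectors represent a
  basis of the quotient, and their coordinates vanish on \<open>FilV\<close>.\<close>

lemma (in bdr_betti_basis) dR_basis_exists:
  obtains I lD where "bdr_period_basis M \<Phi> B lB I lD"
proof -
  interpret D: vector_space "dR_scale_E M" by (rule dR_vector_space)
  interpret D': Modules.module "dR_scale M" by (rule dR_module)
  obtain S where S: "finite S" "D.span S = UNIV" using dR_finite by blast
  have sub: "D.subspace FilV"
    unfolding D.subspace_def dR_scale_E_def using filt_subspace unfolding D'.subspace_def by blast
  obtain B1 where B1: "B1 \<subseteq> FilV" "D.independent B1" "FilV \<subseteq> D.span B1" using D.basis_exists[of FilV] by metis
  define B2 where "B2 = D.extend_basis B1"
  have B2: "B1 \<subseteq> B2" "D.independent B2" "D.span B2 = UNIV"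
    using B1(2) by (simp_all add: B2_def D.extend_basis_superset D.independent_extend_basis D.span_extend_basis)
  have fin: "finite B2" using D.independent_span_bound[OF S(1) B2(2)] S(2) by blast
  obtain l where l: "\<And>b. additive (l b)" "\<And>b a x. l b (dR_scale_E M a x) = a * l b x"
    "\<And>b b'. b' \<in> B2 \<Longrightarrow> l b b' = (if b' = b then 1 else 0)"
    "\<And>x. x \<in> D.span B2 \<Longrightarrow> x = (\<Sum>b\<in>B2. dR_scale_E M (l b x) b)"
    by (rule D.coordinates_exist[OF B2(2) fin]) (rule that)
  have "l i x = 0" if i: "i \<in> B2 - B1" and x: "x \<in> FilV" for i x
  proof -
    have "D.subspace {x. l i x = 0}"
      unfolding D.subspace_def by (simp add: additive.add[OF l(1)] additive.zero[OF l(1)] l(2))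
    moreover have "B1 \<subseteq> {x. l i x = 0}" using i B2(1) l(3) by auto
    ultimately have "D.span B1 \<subseteq> {x. l i x = 0}" by (intro D.span_minimal)
    then show ?thesis using x B1(3) by blast
  qed
  moreover have "x - (\<Sum>i\<in>B2 - B1. dR_scale_E M (l i x) i) \<in> FilV" for x
  proof -
    have "x = (\<Sum>b\<in>B2. dR_scale_E M (l b x) b)" by (rule l(4)) (simp add: B2(3))
    also have "\<dots> = (\<Sum>b\<in>B2 - B1. dR_scale_E M (l b x) b) + (\<Sum>b\<in>B1. dR_scale_E M (l b x) b)"
      by (rule sum.subset_diff[OF B2(1) fin])
    finally have "x - (\<Sum>i\<in>B2 - B1. dR_scale_E M (l i x) i) = (\<Sum>b\<in>B1. dR_scale_E M (l b x) b)"
      by (simp add: diff_eq_eq add.commute)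
    also have "\<dots> \<in> FilV" by (rule D.subspace_sum[OF sub], rule D.subspace_scale[OF sub], use B1(1) in blast)
    finally show ?thesis .
  qed
  ultimately have "bdr_period_basis M \<Phi> B lB (B2 - B1) l"
    by (intro bdr_period_basis.intro bdr_betti_basis_axioms bdr_period_basis_axioms.intro)
      (use fin l in \<open>blast | simp\<close>)+
  then show ?thesis by (rule that)
qed

section \<open>Determinants of involutions\<close>

lemma sum_diag_mat_mult_commute:
  fixes A C :: "'a::comm_ring_1 mat"
  assumes "A \<in> carrier_mat n m" "C \<in> carrier_mat m n"
  shows "(\<Sum>i<n. (A * C) $$ (i, i)) = (\<Sum>i<m. (C * A) $$ (i, i))"
proof -
  have "(\<Sum>i<n. (A * C) $$ (i, i)) = (\<Sum>i<n. \<Sum>k<m. A $$ (i, k) * C $$ (k, i))"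
    using assms by (intro sum.cong refl) (simp add: scalar_prod_def atLeast0LessThan)
  also have "\<dots> = (\<Sum>k<m. \<Sum>i<n. C $$ (k, i) * A $$ (i, k))"
    by (subst sum.swap) (simp add: mult.commute)
  also have "\<dots> = (\<Sum>i<m. (C * A) $$ (i, i))"
    using assms by (intro sum.cong refl) (simp add: scalar_prod_def atLeast0LessThan)
  finally show ?thesis .
qed

text \<open>In triangular form the diagonal entries are square roots of 1, and trace 0 means that
  exactly half of them are -1.\<close>

lemma det_traceless_involution:
  fixes H :: "complex mat"
  assumes H: "H \<in> carrier_mat n n" "H * H = 1\<^sub>m n" and tr: "(\<Sum>i<n. H $$ (i, i)) = 0"
  shows "det H = (-1) ^ (n div 2)"
proof -
  obtain as where "char_poly H = (\<Prod>a\<leftarrow>as. [:- a, 1:])" using char_poly_factorized[OF H(1)] by blast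
  then obtain B P Q where sw: "similar_mat_wit H B P Q" and ut: "upper_triangular B"
    using schur_decomposition_exists[OF H(1)] unfolding similar_mat_def by blast
  note s = similar_mat_witD2[OF H(1) sw]
  have BQP: "B = Q * (H * P)"
  proof -
    have "Q * (H * P) = (Q * P) * B * (Q * P)"
      unfolding s(3) using s(5-7) by (simp add: assoc_mult_mat[of _ n n _ n _ n])
    then show ?thesis using s(5) by (simp add: s(2))
  qed
  have BB: "B * B = 1\<^sub>m n"
  proof -
    have "B * B = Q * H * (P * Q) * H * P"
      unfolding BQP using H(1) s(6,7) by (simp add: assoc_mult_mat[of _ n n _ n _ n])
    also have "\<dots> = Q * (H * H) * P" using H(1) s(6,7) by (simp add: s(1) assoc_mult_mat[of _ n n _ n _ n])
    also have "\<dots> = 1\<^sub>m n" using s(6,7) by (simp add: H(2) s(2))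
    finally show ?thesis .
  qed
  have sq: "B $$ (i, i) * B $$ (i, i) = 1" if i: "i < n" for i
  proof -
    have "1 = (B * B) $$ (i, i)" using i by (simp add: BB)
    also have "\<dots> = (\<Sum>k<n. B $$ (i, k) * B $$ (k, i))"
      using i s(5) by (simp add: scalar_prod_def atLeast0LessThan)
    also have "\<dots> = (\<Sum>k<n. if k = i then B $$ (i, i) * B $$ (i, i) else 0)"
    proof (intro sum.cong refl)
      fix k assume "k \<in> {..<n}"
      then show "B $$ (i, k) * B $$ (k, i) = (if k = i then B $$ (i, i) * B $$ (i, i) else 0)"
        using ut i s(5) by (cases k i rule: linorder_cases) (auto simp: upper_triangular_def)
    qed
    finally show ?thesis using i by simp
  qed
  define N where "N = {i\<in>{..<n}. B $$ (i, i) = -1}"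
  have val: "B $$ (i, i) = (if i \<in> N then -1 else 1)" if "i < n" for i
    using sq[OF that] that by (auto simp: N_def square_eq_1_iff)
  have "(\<Sum>i<n. B $$ (i, i)) = (\<Sum>i<n. H $$ (i, i))"
    unfolding BQP
    by (subst sum_diag_mat_mult_commute[of Q n n "H * P"])
      (use H(1) s in \<open>simp_all add: assoc_mult_mat[of _ n n _ n _ n]\<close>)
  moreover have "(\<Sum>i<n. B $$ (i, i)) = (\<Sum>i<n. 1 - 2 * (if i \<in> N then 1 else 0))"
    by (intro sum.cong refl) (simp add: val)
  moreover have "\<dots> = of_nat n - 2 * of_nat (card N)"
  proof -
    have "(\<Sum>i<n. if i \<in> N then 1 else 0 :: complex) = (\<Sum>i\<in>{..<n} \<inter> N. 1)"
      by (rule sum.inter_restrict[symmetric]) simp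
    also have "{..<n} \<inter> N = N" by (auto simp: N_def)
    finally show ?thesis by (simp add: sum_subtractf flip: sum_distrib_left)
  qed
  ultimately have "(of_nat n :: complex) = of_nat (2 * card N)" using tr by simp
  then have n: "n = 2 * card N" by (simp only: of_nat_eq_iff)
  have "similar_mat H B" using sw unfolding similar_mat_def by blast
  then have "det H = det B" by (rule det_similar)
  also have "\<dots> = (\<Prod>i<n. B $$ (i, i))"
    using det_upper_triangular[OF ut s(5)] s(5) by (simp add: prod_list_diag_prod atLeast0LessThan)
  also have "\<dots> = (\<Prod>i<n. if i \<in> N then -1 else 1)" by (intro prod.cong refl) (simp add: val)
  also have "\<dots> = (-1) ^ card N" by (simp add: N_def prod.If_cases Int_def)
  finally show ?thesis using n by simp
qed

text \<open>E \<otimes> C is a product of copies of C, and the sign depends only on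
  \<open>n\<close>. It is therefore the same in all factors, which places the determinant in
  E.\<close>

lemma det_traceless_involution_tensor:
  fixes H :: "('e::field_char_0, complex) tensor mat"
  assumes nfE: "number_field TYPE('e)"
    and H: "H \<in> carrier_mat n n" "H * H = 1\<^sub>m n" and tr: "(\<Sum>i<n. H $$ (i, i)) = 0"
  shows "det H = (-1) ^ (n div 2)"
proof (rule tensor_eqI_eval_C[OF nfE])
  fix \<tau> :: "'e \<Rightarrow> complex" assume t: "\<tau> \<in> embeddings UNIV"
  note ev = eval_C[OF embedding_hom(4)[OF t]] eval_C_mult[OF t]
  interpret h: comm_ring_hom "eval_C \<tau>" by unfold_locales (simp_all add: ev)
  let ?H = "map_mat (eval_C \<tau>) H"
  have "eval_C \<tau> (det H) = det ?H" by (simp add: h.hom_det)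
  also have "\<dots> = (-1) ^ (n div 2)"
  proof (rule det_traceless_involution)
    show "?H \<in> carrier_mat n n" using H(1) by simp
    show "?H * ?H = 1\<^sub>m n" using arg_cong[OF H(2), of "map_mat (eval_C \<tau>)"] by (simp add: h.mat_hom_mult[OF H(1,1)] h.mat_hom_one)
    have "(\<Sum>i<n. ?H $$ (i, i)) = eval_C \<tau> (\<Sum>i<n. H $$ (i, i))"
      using H(1) by (simp add: h.hom_sum)
    then show "(\<Sum>i<n. ?H $$ (i, i)) = 0" by (simp add: tr)
  qed
  also have "\<dots> = eval_C \<tau> ((-1) ^ (n div 2))" by (simp add: h.hom_power h.hom_uminus)
  finally show "eval_C \<tau> (det H) = eval_C \<tau> ((-1) ^ (n div 2))" .
qed

section \<open>Period classes\<close>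

lemma period_class_mult:
  fixes x y :: "('e::field_char_0, complex) tensor"
  assumes "x dvd 1" "y dvd 1"
  shows "period_class x * period_class y = period_class (x * y)"
proof -
  have refl: "period_class_eq z z" if "z dvd 1" for z :: "('e, complex) tensor"
    using that by (auto simp: period_class_eq_def one_tensor_def[symmetric] intro!: exI[of _ 1])
  have rep: "period_class_eq (rep_period_class (period_class z)) z" if "z dvd 1" for z :: "('e, complex) tensor"
    by (rule Quotient3_rep_abs[OF Quotient3_period_class refl[OF that]])
  have "period_class_eq (rep_period_class (period_class x) * rep_period_class (period_class y)) (x * y)"
    using rel_funD[OF rel_funD[OF times_period_class.rsp rep[OF assms(1)]] rep[OF assms(2)]] .
  then show ?thesis unfolding times_period_class_def map_fun_apply
    by (rule period_class_eqI)
qed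

lemma period_class_1: "period_class 1 = 1"
  by (simp add: one_period_class_def)

lemma period_class_power: "x dvd 1 \<Longrightarrow> period_class x ^ n = period_class (x ^ n)"
  by (induction n) (use dvd_power_same[of x 1] in \<open>simp_all add: period_class_1 period_class_mult\<close>)

lemma tens_1_dvd_1: "z \<noteq> 0 \<Longrightarrow> tens (1 :: 'e::field_char_0) (z :: complex) dvd 1"
  by (rule dvdI[of _ _ "tens 1 (inverse z)"]) (simp add: tens_times_tens flip: one_tensor_def)

lemma period_of_scalar_class:
  assumes "z \<noteq> 0"
  shows "period_of_scalar (scalar_class z) = period_class (tens (1 :: 'e::field_char_0) z)"
proof -
  have rep: "scalar_class_eq (rep_scalar_class (scalar_class z)) z"
    by (rule Quotient3_rep_abs[OF Quotient3_scalar_class scalar_class_eq_refl[OF assms]])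
  show ?thesis unfolding period_of_scalar_def map_fun_apply id_apply
    by (rule period_class_eqI) (rule rel_funD[OF period_of_scalar.rsp rep])
qed

lemma period_class_divide_eqI:
  assumes "x dvd 1" "y dvd 1" "z dvd 1" "e \<noteq> 0" "tens e 1 * x = y * z"
  shows "period_class x / period_class y = period_class z"
proof -
  have "period_class x = period_class (y * z)"
    unfolding assms(5)[symmetric]
    by (rule period_class_eqI) (use assms(1,4) in \<open>unfold period_class_eq_def, blast\<close>)
  also have "\<dots> = period_class y * period_class z" by (rule period_class_mult[OF assms(2,3), symmetric])
  finally have "period_class x / period_class y = period_class z * (period_class y * inverse (period_class y))"
    by (simp add: divide_period_class_def mult_ac)
  then show ?thesis by (simp add: period_class_right_inverse)
qed

context bdr_period_basis
begin

lemma KD_products: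
  assumes "i \<in> I" "k \<in> I" "t * t' = 1"
  shows "(\<Sum>l\<in>I. L i (KD t (tens l 1)) * L l (KD t' (tens k 1))) = (if i = k then 1 else 0)"
proof -
  have "(\<Sum>l\<in>I. L i (KD t (tens l 1)) * L l (KD t' (tens k 1))) = L i (KD t (KD t' (tens k 1)))"
    by (rule L_KD[OF assms(1), symmetric])
  also have "\<dots> = L i (tens k 1)" unfolding KD.scale_scale assms(3) KD.scale_one ..
  also have "\<dots> = (if i = k then 1 else 0)" using L_dual[OF assms(2), of i] by auto
  finally show ?thesis .
qed

text \<open>Once the determinant of \<open>t\<close> on the quotient comes from a unit of E, it
  disappears in the period class, and \<open>det_twist\<close> computes the ratio.\<close>

lemma period_quotient:
  assumes "is": "distinct is" "set is = I"
    and t: "\<And>j. j \<in> J \<Longrightarrow> KD t (u j) = RD (d j) (u j)" "\<And>j. j \<in> J \<Longrightarrow> KD t (frobC (u j)) = - RD (d j) (frobC (u j))"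
    and det: "det (imat is is (\<lambda>i k. L i (KD t (tens k 1)))) = tens e 1" "e \<noteq> 0" and d: "(\<Prod>j\<in>J. d j) dvd 1"
  shows "c_plus M / c_minus M = period_class (\<Prod>j\<in>J. d j)"
proof -
  obtain js where js: "distinct js" "set js = J" using finite_distinct_list[OF finite_J] by blast
  show ?thesis
    unfolding c_plus_def c_minus_def rational_period_eq[OF "is" js]
    by (rule period_class_divide_eqI[OF det_period_unit[OF "is" js] det_period_unit[OF "is" js] d det(2)])
      (rule det_twist[OF "is" js t, unfolded det(1)])
qed

lemma period_quotient_imaginary:
  assumes r: "\<And>\<sigma>. \<sigma> \<in> Emb \<Longrightarrow> conj_emb \<sigma> r = - \<sigma> r" "r \<noteq> 0"
    and n: "\<And>\<sigma>. \<sigma> \<in> \<Phi> \<Longrightarrow> card (B \<sigma>) = n"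
  shows "c_plus M / c_minus M = period_of_scalar (scalar_class (\<Prod>\<sigma>\<in>\<Phi>. \<sigma> r)) ^ n"
proof -
  obtain "is" where "is": "distinct is" "set is = I" using finite_distinct_list[OF I] by blast
  have idem: "KD (tens r 1) (KD (idem \<sigma>) y) = RD (tens 1 (\<sigma> r)) (KD (idem \<sigma>) y)" if "\<sigma> \<in> Emb" for \<sigma> y
    unfolding KD_tens_1_RD[symmetric] KD.scale_scale tens_idem[OF nf that] ..
  have t1: "KD (tens r 1) (u j) = RD (tens 1 (fst j r)) (u j)" if j: "j \<in> J" for j
  proof -
    have p: "fst j \<in> \<Phi>" using j by (auto simp: J_def)
    show ?thesis using idem[OF PhiD(1)[OF p], of "u j"] by (simp add: KD_idem_u(1)[OF j p])
  qed
  have t2: "KD (tens r 1) (frobC (u j)) = - RD (tens 1 (fst j r)) (frobC (u j))" if j: "j \<in> J" for j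
  proof -
    have p: "fst j \<in> \<Phi>" using j by (auto simp: J_def)
    show ?thesis using idem[OF PhiD(2)[OF p], of "frobC (u j)"]
      by (simp add: KD_idem_u(3)[OF j p] r(1)[OF PhiD(1)[OF p]] tens_1_hom.hom_uminus RD.scale_minus_left)
  qed
  \<comment> \<open>\<open>r\<close> acts E-linearly on M_dR itself, so its matrix on the quotient
    already has entries in E; the matrix of \<open>inverse r\<close> shows below that
    \<open>e\<close> is nonzero.\<close>
  define e where "e = det (imat is is (\<lambda>i k. lD i (dR_scale_K M r k)))"
  have det: "det (imat is is (\<lambda>i k. L i (KD (tens r 1) (tens k 1)))) = tens e 1"
    unfolding KD_tens L_def linear_ext_tens[OF lD(1)] e_def by (rule det_imat_tens) simp
  have "tens e 1 * det (imat is is (\<lambda>i k. L i (KD (tens (inverse r) 1) (tens k 1)))) = (1 :: ('e, complex) tensor)"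
    unfolding det[symmetric]
    by (rule det_inverse_imat[OF "is"(1) "is"(1) refl])
      (use r(2) in \<open>simp add: "is"(2) KD_products tens_times_tens flip: one_tensor_def\<close>)
  then have e0: "e \<noteq> 0" by (metis mult_zero_left tens_left_hom.hom_zero zero_neq_one)
  define z where "z = (\<Prod>\<sigma>\<in>\<Phi>. \<sigma> r)"
  have z0: "z \<noteq> 0" unfolding z_def prod_zero_iff[OF finite_Phi]
    using r(2) PhiD(1) embedding_inj[of _ r 0] embedding_hom(5) by metis
  have "(\<Prod>j\<in>J. tens 1 (fst j r)) = (tens 1 (\<Prod>j\<in>J. fst j r) :: ('e, complex) tensor)"
    by (rule tens_1_hom.hom_prod[symmetric])
  also have "(\<Prod>j\<in>J. fst j r) = (\<Prod>\<sigma>\<in>\<Phi>. \<Prod>b\<in>B \<sigma>. \<sigma> r)"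
    unfolding J_def by (subst prod.Sigma) (use finite_Phi B(1) in \<open>auto simp: case_prod_beta\<close>)
  also have "\<dots> = z ^ n" by (simp add: n z_def prod_power_distrib)
  finally have d: "(\<Prod>j\<in>J. tens 1 (fst j r)) = (tens 1 (z ^ n) :: ('e, complex) tensor)" .
  have "c_plus M / c_minus M = period_class (\<Prod>j\<in>J. tens 1 (fst j r))"
    by (rule period_quotient[OF "is" t1 t2 det e0]) (use z0 in \<open>simp_all add: d tens_1_dvd_1\<close>)
  also have "\<dots> = period_of_scalar (scalar_class z) ^ n"
    using z0 by (simp add: d period_of_scalar_class period_class_power tens_1_dvd_1 tens_1_hom.hom_power)
  finally show ?thesis unfolding z_def .
qed

lemma period_quotient_not_imaginary:
  assumes nfE: "number_field TYPE('e)" and no: "\<nexists>r :: 'k. purely_imaginary r"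
  shows "c_plus M / c_minus M = 1"
proof -
  obtain "is" where "is": "distinct is" "set is = I" using finite_distinct_list[OF I] by blast
  define t :: "('k, complex) tensor" where "t = (\<Sum>\<sigma>\<in>\<Phi>. idem \<sigma> - idem (conj_emb \<sigma>))"
  have KDt: "KD t y = (\<Sum>\<sigma>\<in>\<Phi>. KD (idem \<sigma>) y - KD (idem (conj_emb \<sigma>)) y)" for y
    unfolding t_def KD.scale_sum_left KD.scale_left_diff_distrib ..
  have t1: "KD t (u j) = RD 1 (u j)" and t2: "KD t (frobC (u j)) = - RD 1 (frobC (u j))" if j: "j \<in> J" for j
  proof -
    have p: "fst j \<in> \<Phi>" using j by (auto simp: J_def)
    have "KD t (u j) = (\<Sum>\<sigma>\<in>\<Phi>. if fst j = \<sigma> then u j else 0)"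
      unfolding KDt by (intro sum.cong refl) (simp add: KD_idem_u[OF j])
    then show "KD t (u j) = RD 1 (u j)" using p by (simp add: finite_Phi)
    have "KD t (frobC (u j)) = (\<Sum>\<sigma>\<in>\<Phi>. if fst j = \<sigma> then - frobC (u j) else 0)"
      unfolding KDt by (intro sum.cong refl) (simp add: KD_idem_u[OF j])
    then show "KD t (frobC (u j)) = - RD 1 (frobC (u j))" using p by (simp add: finite_Phi)
  qed
  have tt: "t * t = 1"
  proof (rule tensor_eqI_eval_C[OF nf])
    fix \<tau> :: "'k \<Rightarrow> complex" assume tau: "\<tau> \<in> Emb"
    note ev = eval_C[OF embedding_hom(4)[OF tau]] eval_C_mult[OF tau]
    have t: "eval_C \<tau> t = (\<Sum>\<sigma>\<in>\<Phi>. (if \<tau> = \<sigma> then 1 else 0) - (if \<tau> = conj_emb \<sigma> then 1 else 0))"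
      unfolding t_def ev(5,7) by (intro sum.cong refl) (simp add: eval_idem[OF nf _ tau] PhiD)
    have "eval_C \<tau> t = 1 \<or> eval_C \<tau> t = -1"
    proof (cases "\<tau> \<in> \<Phi>")
      case True
      then have "eval_C \<tau> t = (\<Sum>\<sigma>\<in>\<Phi>. if \<tau> = \<sigma> then 1 else 0)"
        unfolding t by (intro sum.cong refl) (use PhiD(3) in auto)
      then show ?thesis using True by (simp add: finite_Phi)
    next
      case False
      then have c: "conj_emb \<tau> \<in> \<Phi>" using Phi(2)[OF tau] by simp
      have "eval_C \<tau> t = (\<Sum>\<sigma>\<in>\<Phi>. if conj_emb \<tau> = \<sigma> then -1 else 0)"
        unfolding t by (intro sum.cong refl) (use False in auto)
      then show ?thesis using c by (simp add: finite_Phi)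
    qed
    then show "eval_C \<tau> (t * t) = eval_C \<tau> 1" by (auto simp: ev)
  qed
  have add: "additive trV"
    unfolding trV_def by (intro additive_sum_fun additive.intro) (simp only: KD.scale_left_distrib L_add)
  have "trV t = (\<Sum>\<sigma>\<in>\<Phi>. trV (idem \<sigma>) - trV (idem (conj_emb \<sigma>)))"
    unfolding t_def additive.sum[OF add] additive.diff[OF add] ..
  also have "\<dots> = 0"
  \<comment> \<open>Hodge symmetry gives the sum of the two ranks and \<open>trV_eq_half\<close>
    gives twice one of them, so the ranks are equal.\<close>
  proof (intro sum.neutral ballI)
    fix \<sigma> assume s: "\<sigma> \<in> \<Phi>"
    have "trV (idem \<sigma>) + trV (idem (conj_emb \<sigma>)) = trV (idem \<sigma>) + trV (idem \<sigma>)"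
      unfolding trV_idem[OF s] trV_eq_half[OF no s, symmetric] by (rule mult_2)
    then show "trV (idem \<sigma>) - trV (idem (conj_emb \<sigma>)) = 0" by simp
  qed
  finally have tr: "trV t = 0" .
  let ?H = "imat is is (\<lambda>i k. L i (KD t (tens k 1)))"
  have "det ?H = (-1) ^ (length is div 2)"
  proof (rule det_traceless_involution_tensor[OF nfE])
    show "?H \<in> carrier_mat (length is) (length is)" by simp
    show "?H * ?H = 1\<^sub>m (length is)"
      unfolding imat_mult[OF "is"(1)] imat_one[OF "is"(1), symmetric]
      by (rule imat_cong) (simp add: "is"(2) KD_products tt)
    show "(\<Sum>i<length is. ?H $$ (i, i)) = 0"
      using tr sum_nth_distinct[OF "is"(1), of "\<lambda>i. L i (KD t (tens i 1))"]
      by (simp add: imat_def trV_def "is"(2))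
  qed
  also have "\<dots> = tens ((-1 :: 'e) ^ (length is div 2)) 1" by (simp add: tens_left_hom.hom_power tens_left_hom.hom_uminus)
  finally have det: "det ?H = tens ((-1 :: 'e) ^ (length is div 2)) 1" .
  have "c_plus M / c_minus M = period_class (\<Prod>j\<in>J. 1)"
    by (rule period_quotient[where d = "\<lambda>_. 1", OF "is" t1 t2 det]) (assumption | simp add: power_not_zero)+
  then show ?thesis by (simp add: period_class_1)
qed

end

section \<open>The ratio of the periods\<close>

theorem theorem3p4p1:
  fixes M :: "('k::field_char_0, 'e::field_char_0, 'b::ab_group_add, 'd::ab_group_add) bdr"
    and \<sigma> :: "'k \<Rightarrow> complex" and n :: nat
  assumes "number_field TYPE('k)" and "totally_imaginary (UNIV :: 'k set)"
    and "number_field TYPE('e)"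
    and "betti_de_rham_system M" and "vanishing_middle_hodge_number M"
    and "\<sigma> \<in> embeddings UNIV" and "n = vector_space.dim (betti_scale M) (betti M \<sigma>)"
  shows "c_plus M / c_minus M = period_of_scalar (delta TYPE('k)) ^ n"
proof -
  note nf = assms(1) and vm = assms(5)
  interpret bdr_over M by unfold_locales (fact assms)+
  show ?thesis
  proof (cases "\<exists>r :: 'k. purely_imaginary r")
    case True
    then obtain r0 :: 'k where r0: "purely_imaginary r0" by blast
    have Im0: "Im (\<tau> r) \<noteq> 0" if "\<tau> \<in> Emb" "purely_imaginary r" for \<tau> :: "'k \<Rightarrow> complex" and r
      using that embedding_inj[OF that(1), of r 0] by (simp add: purely_imaginary_def embedding_hom(5)[OF that(1)] complex_eq_iff)
    \<comment> \<open>Passing to \<open>- r0\<close> if necessary puts the given \<sigma> into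
      \<Phi>, the only embeddings at which \<open>card_B_const\<close> compares dimensions. Then
      \<open>n\<close> is the dimension over all of \<Phi>.\<close>
    obtain r :: 'k where r: "purely_imaginary r" "Im (\<sigma> r) > 0"
    proof (cases "Im (\<sigma> r0) > 0")
      case False
      have "purely_imaginary (- r0)" using r0 by (simp add: purely_imaginary_def embedding_hom)
      moreover have "Im (\<sigma> (- r0)) > 0" using False Im0[OF assms(6) r0] by (simp add: embedding_hom[OF assms(6)])
      ultimately show ?thesis by (rule that)
    qed (rule that[OF r0])
    define \<Phi> where "\<Phi> = {\<tau> \<in> Emb. Im (\<tau> r) > 0}"
    have Phi: "\<Phi> \<subseteq> Emb" "\<And>\<tau>. \<tau> \<in> Emb \<Longrightarrow> \<tau> \<in> \<Phi> \<longleftrightarrow> conj_emb \<tau> \<notin> \<Phi>"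
      using Im0[OF _ r(1)] by (force simp: \<Phi>_def conj_emb_embedding conj_emb_apply)+
    have rc: "conj_emb \<tau> r = - \<tau> r" if "\<tau> \<in> Emb" for \<tau>
      using r(1) that by (simp add: purely_imaginary_def conj_emb_apply complex_eq_iff)
    obtain B lB where b: "bdr_betti_basis M \<Phi> B lB" "\<And>\<tau>. \<tau> \<in> \<Phi> \<Longrightarrow> card (B \<tau>) = vector_space.dim (betti_scale M) (betti M \<tau>)"
      by (rule betti_basis_exists[OF vm Phi(1)], erule Phi(2)) (rule that)
    interpret b: bdr_betti_basis M \<Phi> B lB by (rule b(1))
    obtain I lD where "bdr_period_basis M \<Phi> B lB I lD" by (rule b.dR_basis_exists)
    then interpret p: bdr_period_basis M \<Phi> B lB I lD .
    have s: "\<sigma> \<in> \<Phi>" using r(2) assms(6) by (simp add: \<Phi>_def)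
    have "card (B \<tau>) = n" if "\<tau> \<in> \<Phi>" for \<tau>
      using p.card_B_const[OF that s] b(2)[OF s] assms(7) by simp
    then have "c_plus M / c_minus M = period_of_scalar (scalar_class (\<Prod>\<tau>\<in>\<Phi>. \<tau> r)) ^ n"
      using r(1) by (intro p.period_quotient_imaginary rc) (simp_all add: purely_imaginary_def)
    then show ?thesis unfolding delta_CM_eq_prod[OF nf r(1)] \<Phi>_def .
  next
    case False
    \<comment> \<open>Total imaginarity enters here: an embedding equal to its conjugate would have
      real values.\<close>
    have ne: "conj_emb \<tau> \<noteq> \<tau>" if t: "\<tau> \<in> Emb" for \<tau>
    proof
      assume "conj_emb \<tau> = \<tau>"
      then have "\<tau> x \<in> \<real>" for x by (metis conj_emb_apply Reals_cnj_iff)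
      then show False using assms(2) t by (auto simp: totally_imaginary_def)
    qed
    \<comment> \<open>One embedding is chosen from each conjugate pair. The choice depends only on
      the unordered pair, so \<tau> and its conjugate receive the same representative.\<close>
    define s where "s \<tau> = (SOME \<rho>. \<rho> \<in> {\<tau>, conj_emb \<tau>})" for \<tau> :: "'k \<Rightarrow> complex"
    have s: "s \<tau> \<in> {\<tau>, conj_emb \<tau>}" for \<tau> unfolding s_def by (rule someI[of _ \<tau>]) simp
    have sc: "s (conj_emb \<tau>) = s \<tau>" for \<tau> unfolding s_def by (simp add: insert_commute)
    define \<Phi> where "\<Phi> = {\<tau> \<in> Emb. s \<tau> = \<tau>}"
    have Phi: "\<Phi> \<subseteq> Emb" "\<And>\<tau>. \<tau> \<in> Emb \<Longrightarrow> \<tau> \<in> \<Phi> \<longleftrightarrow> conj_emb \<tau> \<notin> \<Phi>"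
    proof -
      show "\<tau> \<in> \<Phi> \<longleftrightarrow> conj_emb \<tau> \<notin> \<Phi>" if "\<tau> \<in> Emb" for \<tau>
        using s[of \<tau>] ne[OF that] that by (auto simp: \<Phi>_def sc conj_emb_embedding)
    qed (auto simp: \<Phi>_def)
    obtain B lB where b: "bdr_betti_basis M \<Phi> B lB" "\<And>\<tau>. \<tau> \<in> \<Phi> \<Longrightarrow> card (B \<tau>) = vector_space.dim (betti_scale M) (betti M \<tau>)"
      by (rule betti_basis_exists[OF vm Phi(1)], erule Phi(2)) (rule that)
    interpret b: bdr_betti_basis M \<Phi> B lB by (rule b(1))
    obtain I lD where "bdr_period_basis M \<Phi> B lB I lD" by (rule b.dR_basis_exists)
    then interpret p: bdr_period_basis M \<Phi> B lB I lD .
    have "(period_of_scalar 1 :: 'e period_class) = 1"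
      using period_of_scalar_class[of 1] by (simp add: scalar_class_1 period_class_1 flip: one_tensor_def)
    then show ?thesis
      using p.period_quotient_not_imaginary[OF assms(3) False] max_CM_or_real_subfield_real[OF nf False] by simp
  qed
qed

end
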